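(* Let $\Lambda$ be a row-finite source-free $k$-graph and let $\pi$ be an irreducible representation of $C^*(\Lambda)$ arising from a $\Lambda$-semibranching function system on a measure space $(X,\mu)$, where $\mu$ has an atom. Then $\pi$ is monic.
   Context: A $k$-graph is a countable small category $\Lambda$ with a functor $d:\Lambda\to\mathbb{N}^k$ with unique factorization; vertices $\Lambda^0$, range/source $r,s$; row-finite/source-free: each $v\Lambda^n$ (paths of degree $n$ with range $v$) is finite/nonempty. $C^*(\Lambda)$ is the universal $C^*$-algebra of a Cuntz–Krieger $\Lambda$-family $\{s_\lambda\}$ ($\{s_v\}$ orthogonal projections, $s_\lambda s_\eta=s_{\lambda\eta}$, $s_\lambda^*s_\lambda=s_{s(\lambda)}$, $s_v=\sum_{\lambda\in v\Lambda^n}s_\lambda s_\lambda^*$). A $\Lambda$-semibranching function system on $(X,\mu)$: measurable $D_\lambda$, prefixing maps $\tau_\lambda:D_\lambda\to X$ with ranges $R_\lambda$, coding maps $\tau^m:X\to X$ such that for each $m$ the family $\{\tau_\lambda:d(\lambda)=m\}$ is a semibranching function system with coding map $\tau^m$ ($0<\mu(D_\lambda)<\infty$, $R_\lambda$ of finite measure, pairwise a.e. disjoint, covering $X$ a.e., $\Phi_\lambda=d(\mu\circ\tau_\lambda)/d\mu>0$ a.e. on $D_\lambda$, $\tau^m\circ\tau_\lambda=\mathrm{id}$), $\tau_v=\mathrm{id}$, $R_\nu\subseteq D_\lambda$ a.e. and $\tau_\lambda\tau_\nu=\tau_{\lambda\nu}$ a.e. for $\nu\in s(\lambda)\Lambda$,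 and $\tau^m\tau^n=\tau^{m+n}$. The representation arising from it is $\pi(s_\lambda)\xi(x)=\chi_{R_\lambda}(x)\Phi_\lambda(\tau^{d(\lambda)}(x))^{-1/2}\xi(\tau^{d(\lambda)}(x))$ on $L^2(X,\mu)$. A representation $\{t_\lambda\}$ on $\mathcal H$ is monic if all $t_\lambda\ne0$ and there is $\xi\in\mathcal H$ with $\overline{\mathrm{span}}\{t_\lambda t_\lambda^*\xi:\lambda\in\Lambda\}=\mathcal H$. *)

theory Defs
  imports "HOL-Analysis.Analysis"
begin

text \<open>A k-graph is encoded by its set of morphisms; objects are identified with
their identity morphisms, range and source map a morphism to (the identity of)
its range/source object; composition is cmp; degrees are functions nat => nat
vanishing from index k on (i.e. elements of N^k).\<close>

record 'a kgraph =
  arr :: "'a set"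
  rng :: "'a \<Rightarrow> 'a"
  src :: "'a \<Rightarrow> 'a"
  cmp :: "'a \<Rightarrow> 'a \<Rightarrow> 'a"
  deg :: "'a \<Rightarrow> nat \<Rightarrow> nat"

definition Nk :: "nat \<Rightarrow> (nat \<Rightarrow> nat) set" where
  "Nk k = {m. \<forall>i\<ge>k. m i = 0}"

definition kgraph :: "nat \<Rightarrow> 'a kgraph \<Rightarrow> bool" where
  "kgraph k G \<longleftrightarrow>
     countable (arr G) \<and>
     (\<forall>l\<in>arr G. rng G l \<in> arr G \<and> src G l \<in> arr G \<and>
        rng G (rng G l) = rng G l \<and> src G (rng G l) = rng G l \<and>
        rng G (src G l) = src G l \<and> src G (src G l) = src G l) \<and>
     (\<forall>l\<in>arr G. cmp G (rng G l) l = l \<and> cmp G l (src G l) = l) \<and>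
     (\<forall>l\<in>arr G. \<forall>m\<in>arr G. src G l = rng G m \<longrightarrow>
        cmp G l m \<in> arr G \<and> rng G (cmp G l m) = rng G l \<and> src G (cmp G l m) = src G m) \<and>
     (\<forall>l\<in>arr G. \<forall>m\<in>arr G. \<forall>n\<in>arr G. src G l = rng G m \<and> src G m = rng G n \<longrightarrow>
        cmp G (cmp G l m) n = cmp G l (cmp G m n)) \<and>
     (\<forall>l\<in>arr G. deg G l \<in> Nk k) \<and>
     (\<forall>l\<in>arr G. \<forall>m\<in>arr G. src G l = rng G m \<longrightarrow>
        deg G (cmp G l m) = (\<lambda>i. deg G l i + deg G m i)) \<and>
     (\<forall>l\<in>arr G. \<forall>m n. (\<forall>i. deg G l i = m i + n i) \<longrightarrow>
        (\<exists>!p. fst p \<in> arr G \<and> snd p \<in> arr G \<and> src G (fst p) = rng G (snd p) \<and>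
              deg G (fst p) = m \<and> deg G (snd p) = n \<and> cmp G (fst p) (snd p) = l))"

definition vertices :: "'a kgraph \<Rightarrow> 'a set" where
  "vertices G = rng G ` arr G"

definition paths_to :: "'a kgraph \<Rightarrow> 'a \<Rightarrow> (nat \<Rightarrow> nat) \<Rightarrow> 'a set" where
  "paths_to G v n = {l \<in> arr G. rng G l = v \<and> deg G l = n}"

definition row_finite :: "nat \<Rightarrow> 'a kgraph \<Rightarrow> bool" where
  "row_finite k G \<longleftrightarrow> (\<forall>v\<in>vertices G. \<forall>n\<in>Nk k. finite (paths_to G v n))"

definition source_free :: "nat \<Rightarrow> 'a kgraph \<Rightarrow> bool" where
  "source_free k G \<longleftrightarrow> (\<forall>v\<in>vertices G. \<forall>n\<in>Nk k. paths_to G v n \<noteq> {})"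

definition sbfs_family ::
  "'x measure \<Rightarrow> 'a set \<Rightarrow> ('a \<Rightarrow> 'x set) \<Rightarrow> ('a \<Rightarrow> 'x \<Rightarrow> 'x) \<Rightarrow> ('a \<Rightarrow> 'x \<Rightarrow> real)
     \<Rightarrow> ('x \<Rightarrow> 'x) \<Rightarrow> bool" where
  "sbfs_family M I D tau Phi c \<longleftrightarrow>
     (\<forall>l\<in>I. D l \<in> sets M \<and> 0 < emeasure M (D l) \<and> emeasure M (D l) < \<infinity> \<and>
        tau l \<in> measurable (restrict_space M (D l)) M \<and>
        tau l ` D l \<in> sets M \<and> emeasure M (tau l ` D l) < \<infinity> \<and>
        Phi l \<in> borel_measurable M \<and>
        (\<forall>E\<in>sets M. E \<subseteq> D l \<longrightarrow>
           tau l ` E \<in> sets M \<and> emeasure M (tau l ` E) = (\<integral>\<^sup>+x\<in>E. ennreal (Phi l x) \<partial>M)) \<and>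
        (AE x in M. x \<in> D l \<longrightarrow> 0 < Phi l x) \<and>
        (\<forall>x\<in>D l. c (tau l x) = x)) \<and>
     (\<forall>l\<in>I. \<forall>l'\<in>I. l \<noteq> l' \<longrightarrow> emeasure M (tau l ` D l \<inter> tau l' ` D l') = 0) \<and>
     (AE x in M. \<exists>l\<in>I. x \<in> tau l ` D l) \<and>
     c \<in> measurable M M"

definition lambda_sbfs ::
  "nat \<Rightarrow> 'a kgraph \<Rightarrow> 'x measure \<Rightarrow> ('a \<Rightarrow> 'x set) \<Rightarrow> ('a \<Rightarrow> 'x \<Rightarrow> 'x)
     \<Rightarrow> ('a \<Rightarrow> 'x \<Rightarrow> real) \<Rightarrow> ((nat \<Rightarrow> nat) \<Rightarrow> 'x \<Rightarrow> 'x) \<Rightarrow> bool" where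
  "lambda_sbfs k G M D tau Phi cod \<longleftrightarrow>
     (\<forall>m\<in>Nk k. sbfs_family M {l \<in> arr G. deg G l = m} D tau Phi (cod m)) \<and>
     (\<forall>v\<in>vertices G. \<forall>x\<in>D v. tau v x = x) \<and>
     (\<forall>l\<in>arr G. \<forall>n\<in>arr G. src G l = rng G n \<longrightarrow>
        emeasure M (tau n ` D n - D l) = 0 \<and>
        emeasure M ((D n - D (cmp G l n)) \<union> (D (cmp G l n) - D n)) = 0 \<and>
        (AE x in M. x \<in> D n \<longrightarrow> tau l (tau n x) = tau (cmp G l n) x)) \<and>
     (\<forall>m\<in>Nk k. \<forall>n\<in>Nk k. cod m \<circ> cod n = cod (\<lambda>i. m i + n i))"

definition sbfs_op ::
  "'a kgraph \<Rightarrow> ('a \<Rightarrow> 'x set) \<Rightarrow> ('a \<Rightarrow> 'x \<Rightarrow> 'x) \<Rightarrow> ('a \<Rightarrow> 'x \<Rightarrow> real)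
     \<Rightarrow> ((nat \<Rightarrow> nat) \<Rightarrow> 'x \<Rightarrow> 'x) \<Rightarrow> 'a \<Rightarrow> ('x \<Rightarrow> complex) \<Rightarrow> 'x \<Rightarrow> complex" where
  "sbfs_op G D tau Phi cod l \<xi> x =
     (if x \<in> tau l ` D l
      then complex_of_real (inverse (sqrt (Phi l (cod (deg G l) x)))) * \<xi> (cod (deg G l) x)
      else 0)"

text \<open>Elements of L^2 are represented by square-integrable measurable functions;
vectors of the Hilbert space are their a.e.-classes.\<close>

definition L2 :: "'x measure \<Rightarrow> ('x \<Rightarrow> complex) set" where
  "L2 M = {f. f \<in> borel_measurable M \<and> integrable M (\<lambda>x. (cmod (f x))\<^sup>2)}"

definition l2inner :: "'x measure \<Rightarrow> ('x \<Rightarrow> complex) \<Rightarrow> ('x \<Rightarrow> complex) \<Rightarrow> complex" where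
  "l2inner M f g = (LINT x|M. f x * cnj (g x))"

definition l2norm :: "'x measure \<Rightarrow> ('x \<Rightarrow> complex) \<Rightarrow> real" where
  "l2norm M f = sqrt (LINT x|M. (cmod (f x))\<^sup>2)"

definition l2null :: "'x measure \<Rightarrow> ('x \<Rightarrow> complex) set" where
  "l2null M = {f \<in> L2 M. AE x in M. f x = 0}"

definition closed_subspace :: "'x measure \<Rightarrow> ('x \<Rightarrow> complex) set \<Rightarrow> bool" where
  "closed_subspace M V \<longleftrightarrow>
     V \<subseteq> L2 M \<and> (\<lambda>x. 0) \<in> V \<and>
     (\<forall>f\<in>V. \<forall>g\<in>V. (\<lambda>x. f x + g x) \<in> V) \<and>
     (\<forall>c. \<forall>f\<in>V. (\<lambda>x. c * f x) \<in> V) \<and>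
     (\<forall>f\<in>V. \<forall>g\<in>L2 M. (AE x in M. f x = g x) \<longrightarrow> g \<in> V) \<and>
     (\<forall>g\<in>L2 M. (\<forall>e>0. \<exists>f\<in>V. l2norm M (\<lambda>x. g x - f x) < e) \<longrightarrow> g \<in> V)"

definition is_adjoint ::
  "'x measure \<Rightarrow> (('x \<Rightarrow> complex) \<Rightarrow> ('x \<Rightarrow> complex)) \<Rightarrow> (('x \<Rightarrow> complex) \<Rightarrow> ('x \<Rightarrow> complex)) \<Rightarrow> bool" where
  "is_adjoint M T S \<longleftrightarrow> (\<forall>g\<in>L2 M. S g \<in> L2 M) \<and>
     (\<forall>f\<in>L2 M. \<forall>g\<in>L2 M. l2inner M (T f) g = l2inner M f (S g))"

definition adj ::
  "'x measure \<Rightarrow> (('x \<Rightarrow> complex) \<Rightarrow> ('x \<Rightarrow> complex)) \<Rightarrow> ('x \<Rightarrow> complex) \<Rightarrow> ('x \<Rightarrow> complex)" where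
  "adj M T = (SOME S. is_adjoint M T S)"

text \<open>Irreducible: no closed subspace other than 0 and H is invariant under all
generators t_l and their adjoints (equivalently under the image of C*(Lambda)).\<close>

definition irreducible_rep ::
  "'x measure \<Rightarrow> 'a set \<Rightarrow> ('a \<Rightarrow> ('x \<Rightarrow> complex) \<Rightarrow> ('x \<Rightarrow> complex)) \<Rightarrow> bool" where
  "irreducible_rep M I T \<longleftrightarrow>
     (\<forall>V. closed_subspace M V \<and>
          (\<forall>l\<in>I. (\<forall>f\<in>V. T l f \<in> V) \<and> (\<forall>f\<in>V. adj M (T l) f \<in> V))
        \<longrightarrow> V = l2null M \<or> V = L2 M)"

definition cspan :: "('x \<Rightarrow> complex) set \<Rightarrow> ('x \<Rightarrow> complex) set" where
  "cspan S = {g. \<exists>F c. finite F \<and> F \<subseteq> S \<and> g = (\<lambda>x. \<Sum>f\<in>F. c f * f x)}"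

definition monic_rep ::
  "'x measure \<Rightarrow> 'a set \<Rightarrow> ('a \<Rightarrow> ('x \<Rightarrow> complex) \<Rightarrow> ('x \<Rightarrow> complex)) \<Rightarrow> bool" where
  "monic_rep M I T \<longleftrightarrow>
     (\<forall>l\<in>I. \<exists>\<xi>\<in>L2 M. \<not> (AE x in M. T l \<xi> x = 0)) \<and>
     (\<exists>\<xi>\<in>L2 M. \<forall>g\<in>L2 M. \<forall>e>0. \<exists>h\<in>cspan ((\<lambda>l. T l (adj M (T l) \<xi>)) ` I).
         l2norm M (\<lambda>x. g x - h x) < e)"

definition has_atom :: "'x measure \<Rightarrow> bool" where
  "has_atom M \<longleftrightarrow> (\<exists>A\<in>sets M. 0 < emeasure M A \<and>
      (\<forall>B\<in>sets M. B \<subseteq> A \<longrightarrow> emeasure M B = 0 \<or> emeasure M (A - B) = 0))"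

end

theory Submission
  imports Defs
begin

text \<open>The generators and their adjoints permute the unit vectors of atoms, up to killing some of them.
  By irreducibility \<open>\<langle>f, w g\<rangle> = 0\<close> for all words \<open>w\<close> in the generators and adjoints forces \<open>f = 0\<close> or
  \<open>g = 0\<close>. Applied to an atom this shows that its orbit under the words exhausts \<open>X\<close>, so the unit
  vectors of the orbit form an orthonormal basis.

  Suppose that two atoms of the orbit lie over the same infinite path. Some word maps one to the other;
  it acts as a bijection \<open>W\<close> on the atoms over this path, and it commutes there with all words,
  since both are determined by their degrees. If the orbit of \<open>W\<close> is finite, take for \<open>f\<close> its sum and
  for \<open>g\<close> the difference of two consecutive atoms; if it is a copy of the integers, take for \<open>f\<close> and
  \<open>g\<close> two square-summable sequences all of whose translates are mutually orthogonal. Both choices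
  contradict irreducibility. Hence the sets \<open>R\<^sub>\<lambda>\<close> separate the atoms, and any vector with nonzero
  coordinate at every atom is cyclic for the range projections.\<close>

subsection \<open>Square-summable sequences with orthogonal translates\<close>

text \<open>The obstacle is periodicity of paths. Each range projection treats all atoms over one
  path alike, so if a path carried two atoms of the orbit, no vector could be cyclic for these
  projections; irreducibility is what has to exclude this. Following a single bijection
  \<open>W\<close> reduces the words that act over a path to a cyclic situation: everything commutes
  with \<open>W\<close>, so each word either translates the \<open>W\<close>-orbit or moves it off
  itself.

  On an infinite orbit the translating words act as powers of the bilateral shift on l^2 of the
  integers. Fourier series turn shifts into multiplication by characters, and two vectors have all
  translates orthogonal exactly when the product of the transforms vanishes almost everywhere. A
  nonzero vector of finite support is a trigonometric polynomial, which has finitely many zeros, so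
  both vectors must have infinite support: hence the two half circles and the sums over odd
  integers. On a finite orbit the constant vector and a vector of sum zero play the same role for
  the cyclic shift.

  Atoms are encoded so that equality up to null sets becomes genuine equality; orbits, injectivity
  and commutation then concern an honest partial action on a set.\<close>

definition inv_odd :: "int \<Rightarrow> real" where
  "inv_odd i = 1 / (2 * of_int i + 1)"

lemma odd_nz: "2 * real_of_int i + 1 \<noteq> 0"
proof -
  have "2 * i + 1 \<noteq> 0" by presburger
  then have "real_of_int (2 * i + 1) \<noteq> 0" by (simp only: of_int_eq_0_iff not_False_eq_True)
  then show ?thesis by simp
qed

lemma has_sum_int_nonneg_iff:
  "(f has_sum S) {0::int..} \<longleftrightarrow> ((\<lambda>n. f (int n)) has_sum S) UNIV"
  by (rule has_sum_reindex_bij_witness[of _ int nat]) auto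

lemma inv_odd_telescope_nonneg: "((\<lambda>i. inv_odd i - inv_odd (i + 1)) has_sum 1) {0..}"
proof -
  have "(\<lambda>n. inv_odd (int n)) \<longlonglongrightarrow> 0"
    unfolding inv_odd_def
    by (rule real_tendsto_divide_at_top[OF tendsto_const])
      (auto intro!: filterlim_tendsto_add_at_top filterlim_at_top_add_at_top
        filterlim_tendsto_pos_mult_at_top[OF tendsto_const] filterlim_real_sequentially
        filterlim_at_top_mono[OF filterlim_real_sequentially])
  from telescope_sums'[OF this]
  have "(\<lambda>n. inv_odd (int n) - inv_odd (int n + 1)) sums 1"
    by (simp add: inv_odd_def add.commute)
  moreover have "inv_odd (int n) - inv_odd (int n + 1) \<ge> 0" for n
    by (simp add: inv_odd_def field_simps)
  ultimately show ?thesis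
    unfolding has_sum_int_nonneg_iff by (rule sums_nonneg_imp_has_sum)
qed

text \<open>The reflection of \<open>i\<close> to \<open>-1 - i\<close> negates
  \<open>inv_odd\<close>, so the terms with \<open>i\<close> at most -2 contribute another 1. The
  remaining term at \<open>i = -1\<close> is -1 - 1 = -2 and cancels both halves.\<close>

lemma inv_odd_telescope: "((\<lambda>i. inv_odd i - inv_odd (i + 1)) has_sum 0) UNIV"
proof -
  let ?u = "\<lambda>i. inv_odd i - inv_odd (i + 1)"
  have refl: "inv_odd (- 1 - i) = - inv_odd i" for i
    using odd_nz[of i] odd_nz[of "- 1 - i"] by (simp add: inv_odd_def field_simps)
  have sym: "?u (- 2 - i) = ?u i" for i
  proof -
    have "- 2 - i = - 1 - (i + 1)" "- 2 - i + 1 = - 1 - i" by simp_all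
    then show ?thesis by (simp only: refl)
  qed
  have "(?u has_sum 1) {..-2}"
    by (rule iffD1[OF has_sum_reindex_bij_witness[of _ "\<lambda>i. - 2 - i" "\<lambda>i. - 2 - i"] inv_odd_telescope_nonneg])
      (use sym in auto)
  then have "(?u has_sum (1 + 1)) ({..-2} \<union> {0..})"
    by (rule has_sum_Un_disjoint[OF _ inv_odd_telescope_nonneg]) auto
  then have "(?u has_sum (?u (-1) + 2)) (insert (-1) ({..-2} \<union> {0..}))"
    by (intro has_sum_insert) auto
  moreover have "insert (-1) ({..-2} \<union> {0..}) = (UNIV :: int set)" by auto
  moreover have "?u (-1) + 2 = 0" by (simp add: inv_odd_def)
  ultimately show ?thesis by simp
qed

lemma has_sum_int_shift:
  fixes f :: "int \<Rightarrow> 'b::{comm_monoid_add, topological_space}"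
  shows "((\<lambda>i. f (i + m)) has_sum S) UNIV \<longleftrightarrow> (f has_sum S) UNIV"
  by (rule has_sum_reindex_bij_witness[of _ "\<lambda>i. i - m" "\<lambda>i. i + m"]) auto

text \<open>A difference over \<open>n\<close> steps is a sum of \<open>n\<close> unit steps, each a
  translate of the telescoping family. Negative \<open>n\<close> is reduced to positive
  \<open>n\<close> by a shift of the index.\<close>

lemma inv_odd_diff_sum: "((\<lambda>i. inv_odd i - inv_odd (i + n)) has_sum 0) UNIV"
proof -
  have nat: "((\<lambda>i. inv_odd i - inv_odd (i + int n)) has_sum 0) UNIV" for n
  proof (induction n)
    case (Suc n)
    have "((\<lambda>i. inv_odd (i + int n) - inv_odd (i + int n + 1)) has_sum 0) UNIV"
      using has_sum_int_shift[of "\<lambda>i. inv_odd i - inv_odd (i + 1)" "int n" 0]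
      by (simp add: inv_odd_telescope)
    from has_sum_add[OF Suc this] show ?case
      by (simp add: algebra_simps)
  qed auto
  show ?thesis
  proof (cases "n \<ge> 0")
    case True then show ?thesis using nat[of "nat n"] by simp
  next
    case False
    then have "((\<lambda>i. inv_odd (i + n) - inv_odd i) has_sum 0) UNIV"
      using nat[of "nat (- n)"]
      by (subst has_sum_int_shift[of _ "- n", symmetric]) simp
    then show ?thesis using has_sum_uminusI by fastforce
  qed
qed

text \<open>Partial fractions: the product of the two reciprocals is their difference divided by
  \<open>2 * n\<close>.\<close>

lemma inv_odd_correlation:
  assumes "n \<noteq> 0" shows "((\<lambda>i. inv_odd i * inv_odd (i + n)) has_sum 0) UNIV"
proof -
  have "inv_odd i * inv_odd (i + n) = (inv_odd i - inv_odd (i + n)) * (1 / (2 * of_int n))" for i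
    using assms odd_nz[of i] odd_nz[of "i + n"] by (simp add: inv_odd_def divide_simps)
  then show ?thesis
    using has_sum_cmult_left[OF inv_odd_diff_sum[of n], of "1 / (2 * of_int n)"] by simp
qed

lemma inv_odd_square_summable: "(\<lambda>i. (inv_odd i)\<^sup>2) summable_on UNIV"
proof -
  have pos: "(\<lambda>i. (inv_odd i)\<^sup>2) summable_on {0..}"
  proof (rule summable_on_comparison_test)
    \<comment> \<open>The difference is 2 / ((2i+1)(2i+3)). It dominates the square for
      \<open>i\<close> at least 1 but is only 2/3 at \<open>i = 0\<close>, which the factor 2
      repairs.\<close>
    show "(\<lambda>i. (inv_odd i - inv_odd (i + 1)) * 2) summable_on {0..}"
      by (rule summable_on_cmult_left[OF has_sum_imp_summable[OF inv_odd_telescope_nonneg]])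
  next
    fix i :: int assume "i \<in> {0..}"
    then show "(inv_odd i)\<^sup>2 \<le> (inv_odd i - inv_odd (i + 1)) * 2"
      by (simp add: inv_odd_def power2_eq_square divide_simps)
  qed simp
  have "(\<lambda>i. (inv_odd i)\<^sup>2) summable_on {..-1}"
  proof (rule iffD1[OF summable_on_reindex_bij_witness[of _ "\<lambda>i. - 1 - i" "\<lambda>i. - 1 - i"] pos])
    fix i show "(inv_odd (- 1 - i))\<^sup>2 = (inv_odd i)\<^sup>2"
      using odd_nz[of i] odd_nz[of "- 1 - i"] by (simp add: inv_odd_def power2_eq_square field_simps)
  qed auto
  then have "(\<lambda>i. (inv_odd i)\<^sup>2) summable_on ({..-1} \<union> {0..})"
    using pos by (rule summable_on_Un_disjoint) auto
  moreover have "{..-1} \<union> {0..} = (UNIV :: int set)" by auto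
  ultimately show ?thesis by simp
qed

text \<open>Up to a scalar these are the Fourier coefficients of the square wave, the function equal
  to 1 on one half circle and -1 on the other.\<close>

definition odd_recip :: "int \<Rightarrow> real" where
  "odd_recip j = (if odd j then 1 / of_int j else 0)"

lemma has_sum_odd_int:
  fixes f :: "int \<Rightarrow> 'b::{comm_monoid_add, topological_space}"
  assumes "\<And>j. even j \<Longrightarrow> f j = 0"
  shows "(f has_sum S) UNIV \<longleftrightarrow> ((\<lambda>i. f (2 * i + 1)) has_sum S) UNIV"
proof -
  have "(f has_sum S) UNIV \<longleftrightarrow> (f has_sum S) {j. odd j}"
    by (rule has_sum_cong_neutral) (use assms in auto)
  also have "\<dots> \<longleftrightarrow> ((\<lambda>i. f (2 * i + 1)) has_sum S) UNIV"
    by (rule has_sum_reindex_bij_witness[of _ "\<lambda>i. 2 * i + 1" "\<lambda>j. j div 2"]) auto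
  finally show ?thesis .
qed

lemma odd_recip_odd: "odd_recip (2 * i + 1) = inv_odd i"
  by (simp add: odd_recip_def inv_odd_def)

text \<open>For odd \<open>m\<close> the indices \<open>j\<close> and \<open>j + m\<close> have
  opposite parity and every product is zero. For even \<open>m\<close> only odd \<open>j\<close>
  contribute, which is the correlation of \<open>inv_odd\<close>. In Fourier terms, the square wave
  has constant modulus.\<close>

lemma odd_recip_correlation:
  assumes "m \<noteq> 0" shows "((\<lambda>j. odd_recip j * odd_recip (j + m)) has_sum 0) UNIV"
proof (cases "even m")
  case True
  then obtain n where n: "m = 2 * n" by blast
  have "odd_recip (2 * i + 1 + m) = inv_odd (i + n)" for i
    using odd_recip_odd[of "i + n"] by (simp add: n algebra_simps)
  then show ?thesis
    using inv_odd_correlation[of n] assms n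
    by (subst has_sum_odd_int) (simp_all add: odd_recip_odd, simp add: odd_recip_def)
next
  case False
  then have "(\<lambda>j. odd_recip j * odd_recip (j + m)) = (\<lambda>j. 0)" by (auto simp: odd_recip_def)
  then show ?thesis by (simp only: has_sum_0_simp)
qed

lemma odd_recip_square_summable: "(\<lambda>j. (odd_recip j)\<^sup>2) summable_on UNIV"
  using inv_odd_square_summable unfolding summable_on_def
  by (subst has_sum_odd_int) (simp_all add: odd_recip_odd, simp add: odd_recip_def)

text \<open>Up to scaling, \<open>a\<close> and \<open>b\<close> are the Fourier coefficients of the indicator functions of two
  complementary half circles.\<close>

lemma orthogonal_translates:
  obtains a b :: "int \<Rightarrow> complex"
  where "(\<lambda>j. (cmod (a j))\<^sup>2) summable_on UNIV" "(\<lambda>j. (cmod (b j))\<^sup>2) summable_on UNIV"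
    "\<exists>j. a j \<noteq> 0" "\<exists>j. b j \<noteq> 0"
    "\<And>m. ((\<lambda>j. a j * cnj (b (j + m))) has_sum 0) UNIV"
proof -
  \<comment> \<open>The number is pi/2, half the mean-value term of the scaled picture aside, but
    only its square is needed: as the root of the sum it makes the correlation at
    \<open>m = 0\<close> cancel without evaluating the series.\<close>
  define c where "c = sqrt (\<Sum>\<^sub>\<infinity>j. (odd_recip j)\<^sup>2)"
  have c2: "((\<lambda>j. (odd_recip j)\<^sup>2) has_sum c\<^sup>2) UNIV"
    using has_sum_infsum[OF odd_recip_square_summable] by (simp add: c_def infsum_nonneg)
  define a b :: "int \<Rightarrow> complex"
    where "a j = of_real (odd_recip j) + (if j = 0 then \<i> * of_real c else 0)"
      and "b j = of_real (odd_recip j) - (if j = 0 then \<i> * of_real c else 0)" for j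
  have r0: "odd_recip 0 = 0" by (simp add: odd_recip_def)
  have "(\<lambda>j. (odd_recip j)\<^sup>2 + (if j = 0 then c\<^sup>2 else 0)) summable_on UNIV"
    by (intro summable_on_add odd_recip_square_summable
        has_sum_imp_summable[OF has_sum_finite_neutralI[of "{0}"]]) auto
  moreover have "(cmod (a j))\<^sup>2 = (odd_recip j)\<^sup>2 + (if j = 0 then c\<^sup>2 else 0)"
    "(cmod (b j))\<^sup>2 = (odd_recip j)\<^sup>2 + (if j = 0 then c\<^sup>2 else 0)" for j
    by (auto simp: a_def b_def r0 norm_mult power_mult_distrib)
  ultimately have 1: "(\<lambda>j. (cmod (a j))\<^sup>2) summable_on UNIV" "(\<lambda>j. (cmod (b j))\<^sup>2) summable_on UNIV"
    by simp_all
  have 2: "a 1 \<noteq> 0" "b 1 \<noteq> 0" by (simp_all add: a_def b_def odd_recip_def)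
  have 3: "((\<lambda>j. a j * cnj (b (j + m))) has_sum 0) UNIV" for m
  proof -
    let ?r = "\<lambda>j. complex_of_real (odd_recip j)"
    let ?K = "if m = 0 then complex_of_real (c\<^sup>2) else 0"
    have K: "((\<lambda>j. ?r j * ?r (j + m)) has_sum ?K) UNIV"
    proof (cases "m = 0")
      case True
      then show ?thesis using has_sum_of_real[OF c2] by (simp add: power2_eq_square)
    next
      case False
      then show ?thesis using has_sum_of_real[OF odd_recip_correlation[OF False]] by simp
    qed
    define z where "z = \<i> * complex_of_real c"
    have z: "cnj z = - z" "z * z = - complex_of_real (c\<^sup>2)"
      by (simp_all add: z_def complex_eq_iff power2_eq_square)
    have L: "((\<lambda>j. if j = 0 then z * ?r m else 0) has_sum z * ?r m) UNIV"
      "((\<lambda>j. if j = - m then ?r (-m) * z else 0) has_sum ?r (-m) * z) UNIV"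
      "((\<lambda>j. if j = 0 then (if m = 0 then z * z else 0) else 0) has_sum (if m = 0 then z * z else 0)) UNIV"
      by (rule has_sum_finite_neutralI[of "{0}"] has_sum_finite_neutralI[of "{-m}"]; simp)+
    have eq: "a j * cnj (b (j + m)) = ?r j * ?r (j + m) + (if j = 0 then z * ?r m else 0)
      + (if j = - m then ?r (-m) * z else 0) + (if j = 0 then (if m = 0 then z * z else 0) else 0)" for j
    proof -
      have "cnj (b (j + m)) = ?r (j + m) + (if j = - m then z else 0)"
        using z by (auto simp: b_def z_def[symmetric])
      then show ?thesis by (auto simp: a_def z_def[symmetric] algebra_simps)
    qed
    \<comment> \<open>For nonzero \<open>m\<close> the correlation is zero and the two cross terms
      cancel because \<open>odd_recip\<close> is odd. For \<open>m = 0\<close> the cross terms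
      vanish and \<open>z * z\<close> cancels the square of \<open>c\<close>.\<close>
    have "odd_recip (- m) = - odd_recip m" by (simp add: odd_recip_def)
    then have "?K + z * ?r m + ?r (-m) * z + (if m = 0 then z * z else 0) = 0"
      using z by simp
    then show ?thesis
      using has_sum_add[OF has_sum_add[OF has_sum_add[OF K L(1)] L(2)] L(3)]
      unfolding eq by simp
  qed
  show thesis using that[OF 1] 2 3 by blast
qed

subsection \<open>Square-integrable functions and cyclic vectors\<close>

lemma L2I: "f \<in> borel_measurable M \<Longrightarrow> integrable M (\<lambda>x. (cmod (f x))\<^sup>2) \<Longrightarrow> f \<in> L2 M"
  by (simp add: L2_def)

lemma L2_measurable [measurable_dest]: "f \<in> L2 M \<Longrightarrow> f \<in> borel_measurable M"
  by (simp add: L2_def)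

lemma L2_integrable_square: "f \<in> L2 M \<Longrightarrow> integrable M (\<lambda>x. (cmod (f x))\<^sup>2)"
  by (simp add: L2_def)

lemma L2_zero: "(\<lambda>x. 0) \<in> L2 M"
  by (simp add: L2_def)

lemma L2_bounded:
  assumes "g \<in> L2 M" "f \<in> borel_measurable M" "\<And>x. cmod (f x) \<le> cmod (g x)"
  shows "f \<in> L2 M"
  using assms(2) by (intro L2I Bochner_Integration.integrable_bound[OF L2_integrable_square[OF assms(1)]])
    (auto intro!: AE_I2 power_mono assms(3))

lemma L2_scale:
  assumes "f \<in> L2 M" shows "(\<lambda>x. c * f x) \<in> L2 M"
  using assms by (auto simp: L2_def norm_mult power_mult_distrib)

lemma L2_add:
  assumes "f \<in> L2 M" "g \<in> L2 M" shows "(\<lambda>x. f x + g x) \<in> L2 M"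
proof (rule L2I)
  show "(\<lambda>x. f x + g x) \<in> borel_measurable M" using assms by measurable
  show "integrable M (\<lambda>x. (cmod (f x + g x))\<^sup>2)"
  proof (rule Bochner_Integration.integrable_bound)
    show "integrable M (\<lambda>x. 2 * (cmod (f x))\<^sup>2 + 2 * (cmod (g x))\<^sup>2)"
      using assms by (auto simp: L2_def)
    show "(\<lambda>x. (cmod (f x + g x))\<^sup>2) \<in> borel_measurable M" using assms by measurable
    show "AE x in M. norm ((cmod (f x + g x))\<^sup>2) \<le> norm (2 * (cmod (f x))\<^sup>2 + 2 * (cmod (g x))\<^sup>2)"
    proof (rule AE_I2)
      fix x
      have "(cmod (f x + g x))\<^sup>2 \<le> (cmod (f x) + cmod (g x))\<^sup>2"
        by (intro power_mono norm_triangle_ineq) simp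
      also have "\<dots> \<le> 2 * (cmod (f x))\<^sup>2 + 2 * (cmod (g x))\<^sup>2"
        using sum_squares_bound[of "cmod (f x)" "cmod (g x)"] by (simp add: power2_sum)
      finally show "norm ((cmod (f x + g x))\<^sup>2) \<le> norm (2 * (cmod (f x))\<^sup>2 + 2 * (cmod (g x))\<^sup>2)"
        by simp
    qed
  qed
qed

lemma L2_diff:
  assumes "f \<in> L2 M" "g \<in> L2 M" shows "(\<lambda>x. f x - g x) \<in> L2 M"
  using L2_add[OF assms(1) L2_scale[OF assms(2), of "-1"]] by simp

lemma L2_indicator:
  assumes "A \<in> sets M" "emeasure M A < \<infinity>" shows "(\<lambda>x. complex_of_real (indicator A x)) \<in> L2 M"
proof (rule L2I)
  have "(\<lambda>x. (cmod (complex_of_real (indicator A x)))\<^sup>2) = indicat_real A"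
    by (auto simp: indicator_def)
  then show "integrable M (\<lambda>x. (cmod (complex_of_real (indicator A x)))\<^sup>2)"
    using assms by (simp add: integrable_indicator_iff less_top)
qed (use assms in measurable)

lemma measurable_cnj [measurable (raw)]:
  "f \<in> borel_measurable M \<Longrightarrow> (\<lambda>x. cnj (f x)) \<in> borel_measurable M"
  by (rule borel_measurable_continuous_on[OF continuous_on_cnj[OF continuous_on_id]])

lemma L2_prod_integrable:
  assumes "f \<in> L2 M" "g \<in> L2 M" shows "integrable M (\<lambda>x. f x * cnj (g x))"
proof (rule Bochner_Integration.integrable_bound)
  show "integrable M (\<lambda>x. (cmod (f x))\<^sup>2 + (cmod (g x))\<^sup>2)"
    using assms by (auto simp: L2_def)
  show "(\<lambda>x. f x * cnj (g x)) \<in> borel_measurable M" using assms by measurable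
  show "AE x in M. norm (f x * cnj (g x)) \<le> norm ((cmod (f x))\<^sup>2 + (cmod (g x))\<^sup>2)"
  proof (rule AE_I2)
    fix x
    have "2 * (cmod (f x) * cmod (g x)) \<le> (cmod (f x))\<^sup>2 + (cmod (g x))\<^sup>2"
      using sum_squares_bound[of "cmod (f x)" "cmod (g x)"] by simp
    moreover have "0 \<le> cmod (f x) * cmod (g x)" by simp
    ultimately have "cmod (f x) * cmod (g x) \<le> (cmod (f x))\<^sup>2 + (cmod (g x))\<^sup>2"
      by linarith
    then show "norm (f x * cnj (g x)) \<le> norm ((cmod (f x))\<^sup>2 + (cmod (g x))\<^sup>2)"
      by (simp add: norm_mult)
  qed
qed

lemma l2inner_cnj: "cnj (l2inner M f g) = l2inner M g f"
  unfolding l2inner_def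
  by (subst integral_bounded_linear'[OF bounded_linear_cnj bounded_linear_cnj, symmetric])
    (simp_all add: mult.commute)

lemma l2inner_add_left:
  assumes "f \<in> L2 M" "g \<in> L2 M" "h \<in> L2 M"
  shows "l2inner M (\<lambda>x. f x + g x) h = l2inner M f h + l2inner M g h"
  unfolding l2inner_def
  by (subst Bochner_Integration.integral_add[symmetric])
    (auto intro!: L2_prod_integrable assms simp: algebra_simps)

lemma l2inner_scale_left: "l2inner M (\<lambda>x. c * f x) h = c * l2inner M f h"
  by (simp add: l2inner_def mult.assoc)

lemma l2inner_diff_left:
  assumes "f \<in> L2 M" "g \<in> L2 M" "h \<in> L2 M"
  shows "l2inner M (\<lambda>x. f x - g x) h = l2inner M f h - l2inner M g h"
  unfolding l2inner_def
  by (subst Bochner_Integration.integral_diff[symmetric])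
    (auto intro!: L2_prod_integrable assms simp: algebra_simps)

lemma l2inner_add_right:
  assumes "f \<in> L2 M" "g \<in> L2 M" "h \<in> L2 M"
  shows "l2inner M h (\<lambda>x. f x + g x) = l2inner M h f + l2inner M h g"
  using arg_cong[OF l2inner_add_left[OF assms], of cnj] by (simp add: l2inner_cnj)

lemma l2inner_scale_right: "l2inner M h (\<lambda>x. c * f x) = cnj c * l2inner M h f"
  using arg_cong[OF l2inner_scale_left[of M c f h], of cnj] by (simp add: l2inner_cnj)

lemma l2inner_cong_AE:
  assumes "f \<in> L2 M" "f' \<in> L2 M" "g \<in> L2 M" "g' \<in> L2 M"
    "AE x in M. f x = f' x" "AE x in M. g x = g' x"
  shows "l2inner M f g = l2inner M f' g'"
  unfolding l2inner_def using assms(5,6)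
  by (intro integral_cong_AE borel_measurable_integrable[OF L2_prod_integrable]) (auto intro: assms)

lemma l2inner_self: "l2inner M f f = of_real ((l2norm M f)\<^sup>2)"
proof -
  have "l2inner M f f = (LINT x|M. complex_of_real ((cmod (f x))\<^sup>2))"
    unfolding l2inner_def by (simp only: complex_norm_square)
  also have "\<dots> = of_real ((l2norm M f)\<^sup>2)"
    by (simp only: integral_complex_of_real) (simp add: l2norm_def)
  finally show ?thesis .
qed

lemma l2norm_nonneg: "0 \<le> l2norm M f"
  by (simp add: l2norm_def)

lemma l2norm_zero_AE:
  assumes "f \<in> L2 M" "l2norm M f = 0" shows "AE x in M. f x = 0"
proof -
  have "(LINT x|M. (cmod (f x))\<^sup>2) = 0" using assms(2) by (simp add: l2norm_def)
  then show ?thesis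
    using integral_nonneg_eq_0_iff_AE[OF L2_integrable_square[OF assms(1)]] by simp
qed

lemma l2norm_scale: "l2norm M (\<lambda>x. c * f x) = cmod c * l2norm M f"
  by (simp add: l2norm_def norm_mult power_mult_distrib real_sqrt_mult)

lemma l2norm_add_square:
  assumes "f \<in> L2 M" "g \<in> L2 M"
  shows "(l2norm M (\<lambda>x. f x + g x))\<^sup>2 = (l2norm M f)\<^sup>2 + 2 * Re (l2inner M f g) + (l2norm M g)\<^sup>2"
proof -
  have "complex_of_real ((l2norm M (\<lambda>x. f x + g x))\<^sup>2)
    = l2inner M f f + l2inner M f g + (cnj (l2inner M f g) + l2inner M g g)"
    by (simp only: l2inner_self[symmetric] l2inner_add_left l2inner_add_right L2_add assms l2inner_cnj)
  from arg_cong[OF this, of Re] show ?thesis by (simp add: l2inner_self)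
qed

lemma l2inner_bound:
  assumes "f \<in> L2 M" "g \<in> L2 M"
  shows "cmod (l2inner M f g) \<le> l2norm M f * l2norm M g"
proof (cases "l2norm M g = 0")
  case True
  have "l2inner M f g = l2inner M f (\<lambda>x. 0)"
    by (rule l2inner_cong_AE) (use assms L2_zero l2norm_zero_AE[OF assms(2) True] in auto)
  then show ?thesis using True by (simp add: l2inner_def)
next
  case False
  define G where "G = (l2norm M g)\<^sup>2"
  have G: "G > 0" using False by (simp add: G_def)
  define z where "z = l2inner M f g"
  \<comment> \<open>The negative of the orthogonal projection of \<open>f\<close> onto
    \<open>g\<close>; this multiple of \<open>g\<close> minimizes the norm of the sum.\<close>
  let ?h = "\<lambda>x. - (z / of_real G) * g x"
  have "0 \<le> (l2norm M (\<lambda>x. f x + ?h x))\<^sup>2" by simp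
  also have "\<dots> = (l2norm M f)\<^sup>2 + 2 * Re (cnj (- (z / of_real G)) * z) + (cmod (- (z / of_real G)))\<^sup>2 * G"
    by (subst l2norm_add_square)
      (auto intro!: L2_scale assms simp only: l2inner_scale_right l2norm_scale z_def G_def power_mult_distrib)
  also have "cnj (- (z / of_real G)) * z = - of_real ((cmod z)\<^sup>2 / G)"
    using complex_norm_square[of z] by (simp add: mult.commute)
  also have "(cmod (- (z / of_real G)))\<^sup>2 * G = (cmod z)\<^sup>2 / G"
    using G by (simp add: norm_divide power_divide power2_eq_square)
  finally have "(cmod z)\<^sup>2 / G \<le> (l2norm M f)\<^sup>2" by simp
  then have "(cmod z)\<^sup>2 \<le> (l2norm M f * l2norm M g)\<^sup>2"
    using G by (simp add: divide_simps G_def power_mult_distrib)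
  then show ?thesis unfolding z_def
    by (rule power2_le_imp_le) (simp add: l2norm_nonneg)
qed

lemma l2norm_triangle:
  assumes "f \<in> L2 M" "g \<in> L2 M"
  shows "l2norm M (\<lambda>x. f x + g x) \<le> l2norm M f + l2norm M g"
proof (rule power2_le_imp_le)
  have "Re (l2inner M f g) \<le> l2norm M f * l2norm M g"
    using l2inner_bound[OF assms] complex_Re_le_cmod order_trans by blast
  then show "(l2norm M (\<lambda>x. f x + g x))\<^sup>2 \<le> (l2norm M f + l2norm M g)\<^sup>2"
    by (simp add: l2norm_add_square assms power2_sum)
qed (simp add: l2norm_nonneg)

text \<open>A letter \<open>(True, l)\<close> stands for \<open>t\<^sub>l\<close> and \<open>(False, l)\<close> for its adjoint.\<close>

definition letter_op ::
  "'x measure \<Rightarrow> ('a \<Rightarrow> ('x \<Rightarrow> complex) \<Rightarrow> ('x \<Rightarrow> complex)) \<Rightarrow> bool \<times> 'a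
     \<Rightarrow> ('x \<Rightarrow> complex) \<Rightarrow> ('x \<Rightarrow> complex)" where
  "letter_op M T = (\<lambda>(b, l). if b then T l else adj M (T l))"

definition word_op ::
  "'x measure \<Rightarrow> ('a \<Rightarrow> ('x \<Rightarrow> complex) \<Rightarrow> ('x \<Rightarrow> complex)) \<Rightarrow> (bool \<times> 'a) list
     \<Rightarrow> ('x \<Rightarrow> complex) \<Rightarrow> ('x \<Rightarrow> complex)" where
  "word_op M T ws = foldr (letter_op M T) ws"

text \<open>\<open>adj\<close> is an arbitrary choice, so its properties become available only once
  some adjoint is exhibited. It is then fixed only up to null sets, which is why it is used through
  inner products alone.\<close>

lemma is_adjoint_adj: "is_adjoint M T S \<Longrightarrow> is_adjoint M T (adj M T)"
  unfolding adj_def by (rule someI[of "is_adjoint M T"])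

text \<open>The annihilator \<open>V\<close> of all vectors \<open>word_op M T ws g\<close> is
  closed by Cauchy-Schwarz and invariant, since a generator moved across the inner product extends
  the word by one letter. It contains \<open>f\<close>. If \<open>V\<close> is the null space, then
  \<open>f\<close> is null; if it is everything, then \<open>g\<close> is orthogonal to itself by
  the empty word. Working with the annihilator avoids closures of spans and projections.\<close>

lemma irreducible_rep_cyclic:
  assumes irr: "irreducible_rep M I T"
    and TL2: "\<And>l f. l \<in> I \<Longrightarrow> f \<in> L2 M \<Longrightarrow> T l f \<in> L2 M"
    and TS: "\<And>l. l \<in> I \<Longrightarrow> is_adjoint M (T l) (S l)"
    and f: "f \<in> L2 M" and g: "g \<in> L2 M"
    and orth: "\<And>ws. ws \<in> lists (UNIV \<times> I) \<Longrightarrow> l2inner M f (word_op M T ws g) = 0"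
  shows "(AE x in M. f x = 0) \<or> (AE x in M. g x = 0)"
proof -
  note adj = is_adjoint_adj[OF TS]
  have adjL2: "adj M (T l) h \<in> L2 M" if "l \<in> I" "h \<in> L2 M" for l h
    using adj[OF that(1)] that(2) by (simp add: is_adjoint_def)
  have adj_eq: "l2inner M (T l h) h' = l2inner M h (adj M (T l) h')"
    if "l \<in> I" "h \<in> L2 M" "h' \<in> L2 M" for l h h'
    using adj[OF that(1)] that(2,3) by (simp add: is_adjoint_def)
  have wL2: "word_op M T ws g \<in> L2 M" if "ws \<in> lists (UNIV \<times> I)" for ws
    using that
  proof (induction ws)
    case Nil then show ?case by (simp add: word_op_def g)
  next
    case (Cons x ws)
    obtain b l where x: "x = (b, l)" by (cases x)
    with Cons have "l \<in> I" "word_op M T ws g \<in> L2 M" by auto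
    then show ?case by (simp add: word_op_def letter_op_def x TL2 adjL2)
  qed
  define V where "V = {h \<in> L2 M. \<forall>ws\<in>lists (UNIV \<times> I). l2inner M h (word_op M T ws g) = 0}"
  have "closed_subspace M V"
    unfolding closed_subspace_def
  proof (intro conjI ballI allI impI)
    show "V \<subseteq> L2 M" by (auto simp: V_def)
    show "(\<lambda>x. 0) \<in> V" by (auto simp: V_def L2_zero l2inner_def)
    show "(\<lambda>x. h x + h' x) \<in> V" if "h \<in> V" "h' \<in> V" for h h'
      using that by (auto simp: V_def L2_add l2inner_add_left wL2)
    show "(\<lambda>x. c * h x) \<in> V" if "h \<in> V" for h c
      using that by (auto simp: V_def L2_scale l2inner_scale_left)
    show "h' \<in> V" if "h \<in> V" "h' \<in> L2 M" "AE x in M. h x = h' x" for h h'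
    proof -
      have "l2inner M h' (word_op M T ws g) = l2inner M h (word_op M T ws g)"
        if "ws \<in> lists (UNIV \<times> I)" for ws
        using that \<open>h \<in> V\<close> \<open>h' \<in> L2 M\<close> \<open>AE x in M. h x = h' x\<close>
        by (intro l2inner_cong_AE wL2) (auto simp: V_def)
      then show ?thesis using that unfolding V_def by simp
    qed
    show "h \<in> V" if h: "h \<in> L2 M" and lim: "\<forall>e>0. \<exists>h'\<in>V. l2norm M (\<lambda>x. h x - h' x) < e" for h
    proof -
      have "l2inner M h k = 0" if ws: "ws \<in> lists (UNIV \<times> I)" and k: "k = word_op M T ws g" for ws k
      proof (rule ccontr)
        assume nz: "l2inner M h k \<noteq> 0"
        have kL2: "k \<in> L2 M" using wL2[OF ws] k by simp
        have N: "l2norm M k > 0"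
          using l2inner_bound[OF h kL2] nz l2norm_nonneg[of M k]
          by (cases "l2norm M k = 0") auto
        then have "cmod (l2inner M h k) / l2norm M k > 0" using nz by simp
        then obtain h' where h': "h' \<in> V" and lt: "l2norm M (\<lambda>x. h x - h' x) < cmod (l2inner M h k) / l2norm M k"
          using lim by blast
        have h'L2: "h' \<in> L2 M" and h'0: "l2inner M h' k = 0" using h' ws k by (auto simp: V_def)
        have "l2inner M h k = l2inner M (\<lambda>x. h x - h' x) k"
          by (simp add: l2inner_diff_left h h'L2 kL2 h'0)
        then have "cmod (l2inner M h k) \<le> l2norm M (\<lambda>x. h x - h' x) * l2norm M k"
          using l2inner_bound[OF L2_diff[OF h h'L2] kL2] by simp
        also have "\<dots> < cmod (l2inner M h k)" using lt N by (simp add: field_simps)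
        finally show False by simp
      qed
      then show ?thesis using h by (auto simp: V_def)
    qed
  qed
  moreover have "T l h \<in> V" if "l \<in> I" "h \<in> V" for l h
  proof -
    have "l2inner M (T l h) (word_op M T ws g) = 0" if ws: "ws \<in> lists (UNIV \<times> I)" for ws
    proof -
      \<comment> \<open>Invariance under \<open>T l\<close> is tested against the word extended by
        the adjoint of \<open>T l\<close>, and conversely in the next block.\<close>
      have "(False, l) # ws \<in> lists (UNIV \<times> I)" using ws \<open>l \<in> I\<close> by auto
      then have "l2inner M h (word_op M T ((False, l) # ws) g) = 0"
        using \<open>h \<in> V\<close> unfolding V_def by blast
      then show ?thesis
        using adj_eq[OF \<open>l \<in> I\<close> _ wL2[OF ws], of h] \<open>h \<in> V\<close>
        by (simp add: V_def word_op_def letter_op_def)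
    qed
    then show ?thesis using that TL2 by (auto simp: V_def)
  qed
  moreover have "adj M (T l) h \<in> V" if "l \<in> I" "h \<in> V" for l h
  proof -
    have "l2inner M (adj M (T l) h) (word_op M T ws g) = 0" if ws: "ws \<in> lists (UNIV \<times> I)" for ws
    proof -
      have "(True, l) # ws \<in> lists (UNIV \<times> I)" using ws \<open>l \<in> I\<close> by auto
      then have "l2inner M h (word_op M T ((True, l) # ws) g) = 0"
        using \<open>h \<in> V\<close> unfolding V_def by blast
      then have "l2inner M (T l (word_op M T ws g)) h = 0"
        by (subst l2inner_cnj[symmetric]) (simp add: word_op_def letter_op_def)
      then have "l2inner M (word_op M T ws g) (adj M (T l) h) = 0"
        using adj_eq[OF \<open>l \<in> I\<close> wL2[OF ws], of h] \<open>h \<in> V\<close> by (simp add: V_def)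
      then show ?thesis by (subst l2inner_cnj[symmetric]) simp
    qed
    then show ?thesis using that adjL2 by (auto simp: V_def)
  qed
  ultimately have "V = l2null M \<or> V = L2 M"
    using irr by (simp add: irreducible_rep_def)
  moreover have "f \<in> V" using f orth by (auto simp: V_def)
  moreover have "AE x in M. g x = 0" if "g \<in> V"
  proof -
    have "l2inner M g (word_op M T [] g) = 0" using that unfolding V_def by blast
    then have "l2norm M g = 0" by (simp add: word_op_def l2inner_self)
    then show ?thesis using l2norm_zero_AE[OF g] by simp
  qed
  ultimately show ?thesis using g by (auto simp: l2null_def)
qed

subsection \<open>Atoms\<close>

text \<open>Unlike \<open>has_atom\<close>, finite measure is demanded, so that the indicator is
  square-integrable. The zero-one law is phrased with almost-everywhere statements and ranges over
  all measurable \<open>B\<close>, which lets it be applied to preimages directly.\<close>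

definition atomic_set :: "'x measure \<Rightarrow> 'x set \<Rightarrow> bool" where
  "atomic_set M A \<longleftrightarrow> A \<in> sets M \<and> emeasure M A < \<infinity> \<and> \<not> (AE x in M. x \<notin> A) \<and>
     (\<forall>B\<in>sets M. (AE x in M. x \<in> A \<longrightarrow> x \<in> B) \<or> (AE x in M. x \<in> A \<longrightarrow> x \<notin> B))"

text \<open>Atoms are handled up to null sets: an atom is represented by the filter of measurable
  sets that contain it almost everywhere. The empty family plays the role of the zero vector.\<close>

definition atom_filter :: "'x measure \<Rightarrow> 'x set \<Rightarrow> 'x set set" where
  "atom_filter M A = {E \<in> sets M. AE x in M. x \<in> A \<longrightarrow> x \<in> E}"

definition atoms :: "'x measure \<Rightarrow> 'x set set set" where
  "atoms M = atom_filter M ` {A. atomic_set M A}"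

definition rep :: "'x measure \<Rightarrow> 'x set set \<Rightarrow> 'x set" where
  "rep M p = (SOME A. atomic_set M A \<and> atom_filter M A = p)"

text \<open>The normalized indicator of an atom. The value 0 off \<open>atoms M\<close> turns the
  empty family into the zero vector, so that formulas for generators also cover atoms that are
  killed.\<close>

definition atom_vec :: "'x measure \<Rightarrow> 'x set set \<Rightarrow> 'x \<Rightarrow> complex" where
  "atom_vec M p = (\<lambda>x. if p \<in> atoms M
     then complex_of_real (indicator (rep M p) x / sqrt (measure M (rep M p))) else 0)"

definition coord :: "'x measure \<Rightarrow> ('x \<Rightarrow> complex) \<Rightarrow> 'x set set \<Rightarrow> complex" where
  "coord M f p = l2inner M f (atom_vec M p)"

lemma atomic_set_rep:
  assumes "p \<in> atoms M" shows "atomic_set M (rep M p)" "atom_filter M (rep M p) = p"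
  using someI_ex[of "\<lambda>A. atomic_set M A \<and> atom_filter M A = p"] assms
  by (auto simp: rep_def atoms_def)

lemma atomic_set_atoms: "atomic_set M A \<Longrightarrow> atom_filter M A \<in> atoms M"
  by (simp add: atoms_def)

lemma rep_sets [measurable]: "p \<in> atoms M \<Longrightarrow> rep M p \<in> sets M"
  using atomic_set_rep(1) by (auto simp: atomic_set_def)

lemma rep_finite: "p \<in> atoms M \<Longrightarrow> emeasure M (rep M p) < \<infinity>"
  using atomic_set_rep(1) by (auto simp: atomic_set_def)

lemma rep_not_null: "p \<in> atoms M \<Longrightarrow> \<not> (AE x in M. x \<notin> rep M p)"
  using atomic_set_rep(1) by (auto simp: atomic_set_def)

lemma mem_atom_iff:
  "p \<in> atoms M \<Longrightarrow> E \<in> p \<longleftrightarrow> E \<in> sets M \<and> (AE x in M. x \<in> rep M p \<longrightarrow> x \<in> E)"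
  using atomic_set_rep(2) by (fastforce simp: atom_filter_def)

lemma atom_not_mem:
  "p \<in> atoms M \<Longrightarrow> E \<in> sets M \<Longrightarrow> E \<notin> p \<Longrightarrow> AE x in M. x \<in> rep M p \<longrightarrow> x \<notin> E"
  using atomic_set_rep(1) by (auto simp: atomic_set_def mem_atom_iff)

lemma space_mem_atom: "p \<in> atoms M \<Longrightarrow> space M \<in> p"
  by (auto simp: mem_atom_iff intro: AE_mp[OF AE_space])

lemma atom_nonempty: "{} \<notin> atoms M"
  using space_mem_atom by fastforce

lemma atom_disjoint_sets:
  assumes "p \<in> atoms M" "E \<in> p" "F \<in> p"
  shows "\<not> (AE x in M. \<not> (x \<in> E \<and> x \<in> F))"
proof
  assume ae: "AE x in M. \<not> (x \<in> E \<and> x \<in> F)"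
  have "AE x in M. x \<in> rep M p \<longrightarrow> x \<in> E" "AE x in M. x \<in> rep M p \<longrightarrow> x \<in> F"
    using assms by (simp_all add: mem_atom_iff)
  with ae have "AE x in M. x \<notin> rep M p" by eventually_elim auto
  then show False using rep_not_null assms(1) by blast
qed

lemma atom_cong:
  assumes "p \<in> atoms M" "E \<in> p" "F \<in> sets M" "AE x in M. x \<in> E \<longrightarrow> x \<in> F"
  shows "F \<in> p"
proof -
  have "AE x in M. x \<in> rep M p \<longrightarrow> x \<in> E" using assms by (simp_all add: mem_atom_iff)
  with assms(4) have "AE x in M. x \<in> rep M p \<longrightarrow> x \<in> F" by eventually_elim auto
  then show ?thesis using assms by (simp add: mem_atom_iff)
qed

lemma atom_Int:
  assumes "p \<in> atoms M" "E \<in> p" "F \<in> p" shows "E \<inter> F \<in> p"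
proof -
  have "AE x in M. x \<in> rep M p \<longrightarrow> x \<in> E" "AE x in M. x \<in> rep M p \<longrightarrow> x \<in> F"
    using assms by (simp_all add: mem_atom_iff)
  then have "AE x in M. x \<in> rep M p \<longrightarrow> x \<in> E \<inter> F" by eventually_elim auto
  moreover have "E \<inter> F \<in> sets M" using assms by (simp add: mem_atom_iff sets.Int)
  ultimately show ?thesis using mem_atom_iff[OF assms(1)] by metis
qed

text \<open>Otherwise the zero-one law puts the atom almost everywhere outside each
  \<open>R i\<close>, and countability puts it outside their union.\<close>

lemma atom_countable_cover:
  assumes p: "p \<in> atoms M" and "countable I" "\<And>i. i \<in> I \<Longrightarrow> R i \<in> sets M"
    "AE x in M. \<exists>i\<in>I. x \<in> R i"
  shows "\<exists>i\<in>I. R i \<in> p"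
proof (rule ccontr)
  assume "\<not> (\<exists>i\<in>I. R i \<in> p)"
  then have "R i \<notin> p" if "i \<in> I" for i using that by blast
  then have "AE x in M. x \<in> rep M p \<longrightarrow> x \<notin> R i" if "i \<in> I" for i
    using \<open>i \<in> I\<close> by (intro atom_not_mem[OF p] assms(3)) auto
  then have "AE x in M. \<forall>i\<in>I. x \<in> rep M p \<longrightarrow> x \<notin> R i"
    by (subst AE_ball_countable[OF assms(2)]) simp
  with assms(4) have "AE x in M. x \<notin> rep M p" by eventually_elim auto
  then show False using rep_not_null p by blast
qed

lemma rep_mem: "p \<in> atoms M \<Longrightarrow> rep M p \<in> p"
  by (simp add: mem_atom_iff rep_sets)

text \<open>Of two nested atoms the larger cannot be split by the smaller, and disjointness would
  make the smaller null. So they agree almost everywhere and define the same filter.\<close>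

lemma atom_eqI:
  assumes "p \<in> atoms M" "q \<in> atoms M" "rep M q \<in> p" shows "p = q"
proof -
  have pq: "AE x in M. x \<in> rep M p \<longrightarrow> x \<in> rep M q" using assms by (simp add: mem_atom_iff)
  have "rep M p \<in> q"
  proof (rule ccontr)
    assume "rep M p \<notin> q"
    then have "AE x in M. x \<in> rep M q \<longrightarrow> x \<notin> rep M p"
      by (intro atom_not_mem) (use assms rep_sets in auto)
    with pq have "AE x in M. x \<notin> rep M p" by eventually_elim auto
    then show False using rep_not_null assms(1) by blast
  qed
  then have qp: "AE x in M. x \<in> rep M q \<longrightarrow> x \<in> rep M p" using assms by (simp add: mem_atom_iff)
  have "E \<in> p \<longleftrightarrow> E \<in> q" for E
  proof -
    have "(AE x in M. x \<in> rep M p \<longrightarrow> x \<in> E) \<longleftrightarrow> (AE x in M. x \<in> rep M q \<longrightarrow> x \<in> E)"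
    proof
      assume "AE x in M. x \<in> rep M p \<longrightarrow> x \<in> E"
      with qp show "AE x in M. x \<in> rep M q \<longrightarrow> x \<in> E" by eventually_elim auto
    next
      assume "AE x in M. x \<in> rep M q \<longrightarrow> x \<in> E"
      with pq show "AE x in M. x \<in> rep M p \<longrightarrow> x \<in> E" by eventually_elim auto
    qed
    then show ?thesis using assms by (simp add: mem_atom_iff)
  qed
  then show ?thesis by blast
qed

lemma rep_disjoint:
  assumes "p \<in> atoms M" "q \<in> atoms M" "p \<noteq> q"
  shows "AE x in M. \<not> (x \<in> rep M p \<and> x \<in> rep M q)"
proof -
  have "AE x in M. x \<in> rep M p \<longrightarrow> x \<notin> rep M q"
    by (rule atom_not_mem) (use assms atom_eqI rep_sets in auto)
  then show ?thesis by eventually_elim auto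
qed

lemma rep_atom_filter:
  assumes "atomic_set M A"
  shows "AE x in M. x \<in> rep M (atom_filter M A) \<longleftrightarrow> x \<in> A"
proof -
  let ?p = "atom_filter M A"
  have p: "?p \<in> atoms M" using assms by (rule atomic_set_atoms)
  have "A \<in> ?p" using assms by (simp add: atom_filter_def atomic_set_def)
  then have 1: "AE x in M. x \<in> rep M ?p \<longrightarrow> x \<in> A" using p by (simp add: mem_atom_iff)
  have "rep M ?p \<in> ?p" by (rule rep_mem[OF p])
  then have "AE x in M. x \<in> A \<longrightarrow> x \<in> rep M ?p" by (simp add: atom_filter_def)
  with 1 show ?thesis by eventually_elim auto
qed

lemma measure_rep_pos:
  assumes "p \<in> atoms M" shows "0 < measure M (rep M p)"
proof -
  have "emeasure M (rep M p) \<noteq> 0"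
    using rep_not_null[OF assms] rep_sets[OF assms] by (auto simp: AE_iff_null_sets[symmetric])
  then show ?thesis using rep_finite[OF assms]
    by (simp add: measure_def enn2real_positive_iff zero_less_iff_neq_zero)
qed

section \<open>Measurable functions on an atom and coordinates\<close>

text \<open>Every rational lies on one side of \<open>f\<close> almost everywhere on
  \<open>A\<close>. Outside a countable union of null sets these sides are the same for all points,
  and rationals separate distinct reals.\<close>

lemma atomic_set_const_real:
  fixes f :: "'x \<Rightarrow> real"
  assumes A: "atomic_set M A" and f [measurable]: "f \<in> borel_measurable M"
  obtains c where "AE x in M. x \<in> A \<longrightarrow> f x = c"
proof -
  define le gt where "le q \<longleftrightarrow> (AE x in M. x \<in> A \<longrightarrow> f x \<le> q)"
    and "gt q \<longleftrightarrow> (AE x in M. x \<in> A \<longrightarrow> q < f x)" for q :: real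
  have dich: "le q \<or> gt q" for q
  proof -
    have "{x \<in> space M. f x \<le> q} \<in> sets M" by measurable
    then consider "AE x in M. x \<in> A \<longrightarrow> x \<in> {x \<in> space M. f x \<le> q}"
      | "AE x in M. x \<in> A \<longrightarrow> x \<notin> {x \<in> space M. f x \<le> q}"
      using A unfolding atomic_set_def by blast
    then show ?thesis
    proof cases
      case 1 then have "le q" unfolding le_def by eventually_elim auto
      then show ?thesis ..
    next
      case 2 then have "gt q" unfolding gt_def using AE_space by eventually_elim auto
      then show ?thesis ..
    qed
  qed
  \<comment> \<open>The points on the generic side of every rational at once; one of them,
    \<open>x0\<close> below, supplies the constant.\<close>
  define ok where "ok x \<longleftrightarrow> (\<forall>q\<in>\<rat>. (le q \<longrightarrow> f x \<le> q) \<and> (gt q \<longrightarrow> q < f x))" for x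
  have "AE x in M. x \<in> A \<longrightarrow> (le q \<longrightarrow> f x \<le> q) \<and> (gt q \<longrightarrow> q < f x)" for q
  proof (cases "le q")
    case True
    then show ?thesis
    proof (cases "gt q")
      case True
      with \<open>le q\<close> show ?thesis unfolding le_def gt_def by eventually_elim auto
    next
      case False
      from \<open>le q\<close> show ?thesis unfolding le_def by eventually_elim (use False in auto)
    qed
  next
    case False
    with dich have "gt q" by blast
    then show ?thesis unfolding gt_def by eventually_elim (use False in auto)
  qed
  then have "AE x in M. \<forall>q\<in>\<rat>. x \<in> A \<longrightarrow> (le q \<longrightarrow> f x \<le> q) \<and> (gt q \<longrightarrow> q < f x)"
    by (subst AE_ball_countable[OF countable_rat]) auto
  then have ok: "AE x in M. x \<in> A \<longrightarrow> ok x" by eventually_elim (auto simp: ok_def)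
  have "\<exists>x\<in>A. ok x"
  proof (rule ccontr)
    assume no: "\<not> (\<exists>x\<in>A. ok x)"
    from ok have "AE x in M. x \<notin> A" by eventually_elim (use no in auto)
    then show False using A by (simp add: atomic_set_def)
  qed
  then obtain x0 where x0: "x0 \<in> A" "ok x0" by blast
  have eq: "\<not> f x < f y" if "ok x" "ok y" for x y
  proof
    assume "f x < f y"
    then obtain q where q: "q \<in> \<rat>" "f x < q" "q < f y" using Rats_dense_in_real by blast
    then show False using that dich[of q] unfolding ok_def by fastforce
  qed
  from ok have "AE x in M. x \<in> A \<longrightarrow> f x = f x0"
  proof eventually_elim
    case (elim x)
    then show ?case using eq[of x x0] eq[of x0 x] x0 by auto
  qed
  then show thesis by (rule that)
qed

lemma atomic_set_const:
  fixes f :: "'x \<Rightarrow> complex"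
  assumes A: "atomic_set M A" and f: "f \<in> borel_measurable M"
  obtains c where "AE x in M. x \<in> A \<longrightarrow> f x = c"
proof -
  have "(\<lambda>x. Re (f x)) \<in> borel_measurable M" "(\<lambda>x. Im (f x)) \<in> borel_measurable M"
    using f by measurable
  then obtain a b where "AE x in M. x \<in> A \<longrightarrow> Re (f x) = a" "AE x in M. x \<in> A \<longrightarrow> Im (f x) = b"
    using atomic_set_const_real[OF A] by metis
  then have "AE x in M. x \<in> A \<longrightarrow> f x = Complex a b"
    by eventually_elim (auto simp: complex_eq_iff)
  then show thesis by (rule that)
qed

lemma atom_vec_L2: "atom_vec M p \<in> L2 M"
proof (cases "p \<in> atoms M")
  case True
  then have "atom_vec M p = (\<lambda>x. complex_of_real (1 / sqrt (measure M (rep M p))) * complex_of_real (indicator (rep M p) x))"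
    by (auto simp: atom_vec_def)
  then show ?thesis
    by (simp only:) (rule L2_scale[OF L2_indicator[OF rep_sets[OF True] rep_finite[OF True]]])
next
  case False
  then show ?thesis using L2_zero by (simp add: atom_vec_def)
qed

lemma atom_vec_zero: "p \<notin> atoms M \<Longrightarrow> atom_vec M p = (\<lambda>x. 0)"
  by (simp add: atom_vec_def)

lemma coord_zero: "p \<notin> atoms M \<Longrightarrow> coord M f p = 0"
  by (simp add: coord_def atom_vec_zero l2inner_def)

lemma set_integral_rep_const:
  assumes p: "p \<in> atoms M" and ae: "AE x in M. x \<in> rep M p \<longrightarrow> F x = (c :: complex)"
    and F: "F \<in> borel_measurable M"
  shows "(LINT x:rep M p|M. F x) = of_real (measure M (rep M p)) * c"
proof -
  have "(LINT x:rep M p|M. F x) = (LINT x|M. indicat_real (rep M p) x *\<^sub>R c)"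
    unfolding set_lebesgue_integral_def
  proof (rule integral_cong_AE)
    show "AE x in M. indicat_real (rep M p) x *\<^sub>R F x = indicat_real (rep M p) x *\<^sub>R c"
      using ae by eventually_elim (auto simp: indicator_def)
  qed (use F rep_sets[OF p] in measurable)
  also have "\<dots> = of_real (measure M (rep M p)) * c"
    using rep_sets[OF p] rep_finite[OF p] by (simp add: scaleR_conv_of_real less_top)
  finally show ?thesis .
qed

lemma coord_const:
  assumes p: "p \<in> atoms M" and ae: "AE x in M. x \<in> rep M p \<longrightarrow> f x = c"
    and f: "f \<in> borel_measurable M"
  shows "coord M f p = of_real (sqrt (measure M (rep M p))) * c"
proof -
  let ?m = "measure M (rep M p)"
  have m: "?m > 0" using measure_rep_pos[OF p] .
  have "coord M f p = (LINT x:rep M p|M. f x * of_real (1 / sqrt ?m))"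
    unfolding coord_def l2inner_def set_lebesgue_integral_def
    by (rule Bochner_Integration.integral_cong) (auto simp: atom_vec_def p indicator_def)
  also have "\<dots> = of_real ?m * (c * of_real (1 / sqrt ?m))"
  proof (rule set_integral_rep_const[OF p])
    show "AE x in M. x \<in> rep M p \<longrightarrow> f x * of_real (1 / sqrt ?m) = c * of_real (1 / sqrt ?m)"
      using ae by eventually_elim auto
  qed (use f in measurable)
  also have "\<dots> = of_real (?m / sqrt ?m) * c" by simp
  also have "?m / sqrt ?m = sqrt ?m" using m by (simp add: real_div_sqrt)
  finally show ?thesis .
qed

lemma coord_atom_vec:
  assumes p: "p \<in> atoms M"
  shows "coord M (atom_vec M q) p = (if p = q then 1 else 0)"
proof (cases "p = q")
  case True
  have "coord M (atom_vec M q) p = of_real (sqrt (measure M (rep M p))) * of_real (1 / sqrt (measure M (rep M p)))"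
    by (rule coord_const[OF p]) (use True p atom_vec_L2 in \<open>auto simp: atom_vec_def[of M q]\<close>)
  then show ?thesis using True measure_rep_pos[OF p] by simp
next
  case False
  have "AE x in M. x \<in> rep M p \<longrightarrow> atom_vec M q x = 0"
  proof (cases "q \<in> atoms M")
    case True
    show ?thesis using rep_disjoint[OF p True False]
      by eventually_elim (auto simp: atom_vec_def)
  qed (simp add: atom_vec_def)
  from coord_const[OF p this L2_measurable[OF atom_vec_L2]] False show ?thesis by simp
qed

text \<open>The representative chosen by \<open>rep\<close> differs from \<open>A\<close> by a null
  set only, so any convenient atomic set may be used to compute the vector.\<close>

lemma atom_vec_atom_filter:
  assumes "atomic_set M A"
  shows "AE x in M. atom_vec M (atom_filter M A) x = complex_of_real (indicator A x / sqrt (measure M A))"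
proof -
  let ?p = "atom_filter M A"
  have p: "?p \<in> atoms M" using assms by (rule atomic_set_atoms)
  have ae: "AE x in M. x \<in> rep M ?p \<longleftrightarrow> x \<in> A" by (rule rep_atom_filter[OF assms])
  have "measure M (rep M ?p) = measure M A"
    by (rule measure_eq_AE) (use ae p assms rep_sets in \<open>auto simp: atomic_set_def\<close>)
  note m = this
  show ?thesis using ae by eventually_elim (simp add: atom_vec_def p indicator_def m)
qed

section \<open>Expansions along a countable family of atoms\<close>

text \<open>Padding with zeros treats finite and infinite \<open>Q\<close> alike and gives access to
  results on sequences.\<close>

lemma has_sum_countable_nat:
  fixes g :: "'b \<Rightarrow> 'c::{comm_monoid_add, topological_space}"
  assumes Q: "countable Q"
  shows "((\<lambda>n. if n \<in> to_nat_on Q ` Q then g (from_nat_into Q n) else 0) has_sum S) UNIV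
    \<longleftrightarrow> (g has_sum S) Q" (is "(?g has_sum S) UNIV \<longleftrightarrow> _")
proof -
  have "(?g has_sum S) UNIV \<longleftrightarrow> (?g has_sum S) (to_nat_on Q ` Q)"
    by (rule has_sum_cong_neutral) auto
  also have "\<dots> \<longleftrightarrow> (g has_sum S) Q"
    by (rule has_sum_reindex_bij_witness[of _ "to_nat_on Q" "from_nat_into Q"])
      (use Q in \<open>auto intro: from_nat_into\<close>)
  finally show ?thesis .
qed

text \<open>Countable additivity yields an ordered series; \<open>has_sum\<close> needs
  unconditional convergence, which comes from the absolute values of the pieces.\<close>

lemma has_sum_integral_partition:
  fixes F :: "'x \<Rightarrow> complex"
  assumes Q: "countable Q" and B: "\<And>q. q \<in> Q \<Longrightarrow> B q \<in> sets M" and disj: "disjoint_family_on B Q"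
    and cover: "AE x in M. \<exists>q\<in>Q. x \<in> B q" and F: "integrable M F"
  shows "((\<lambda>q. LINT x:B q|M. F x) has_sum (LINT x|M. F x)) Q"
proof -
  define A where "A n = (if n \<in> to_nat_on Q ` Q then B (from_nat_into Q n) else {})" for n
  have fn: "from_nat_into Q n \<in> Q" if "n \<in> to_nat_on Q ` Q" for n
    using that Q by auto
  have A: "A n \<in> sets M" for n using B fn by (auto simp: A_def)
  have disjA: "A i \<inter> A j = {}" if "i \<noteq> j" for i j
  proof (cases "i \<in> to_nat_on Q ` Q \<and> j \<in> to_nat_on Q ` Q")
    case True
    then have "from_nat_into Q i \<noteq> from_nat_into Q j" using that Q by auto
    then show ?thesis using disj fn True by (auto simp: A_def disjoint_family_on_def)
  qed (auto simp: A_def)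
  have UA: "(\<Union>n. A n) = (\<Union>q\<in>Q. B q)"
    using Q fn by (force simp: A_def split: if_splits)
  have UAs: "(\<Union>n. A n) \<in> sets M" using A by auto
  have int: "set_integrable M (\<Union>n. A n) G" if "integrable M G" for G :: "'x \<Rightarrow> 'b::{banach, second_countable_topology}"
    unfolding set_integrable_def using integrable_mult_indicator[OF UAs that] .
  have intA: "integrable M (\<lambda>x. indicat_real (A n) x *\<^sub>R F x)" for n
    using integrable_mult_indicator[OF A F] .
  have sums: "(\<lambda>n. LINT x:A n|M. F x) sums (LINT x:(\<Union>n. A n)|M. F x)"
    and summ: "summable (\<lambda>n. norm (LINT x:A n|M. F x))"
  proof -
    \<comment> \<open>The pieces are disjoint, so every partial sum of absolute integrals is at most
      the integral of \<open>norm (F x)\<close>.\<close>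
    have sm: "summable (\<lambda>n. LINT x|M. norm (indicat_real (A n) x *\<^sub>R F x))"
    proof (rule bounded_imp_summable)
      fix n
      have "(\<Sum>k\<le>n. LINT x|M. norm (indicat_real (A k) x *\<^sub>R F x))
        = (LINT x|M. (\<Sum>k\<le>n. norm (indicat_real (A k) x *\<^sub>R F x)))"
        by (rule Bochner_Integration.integral_sum[symmetric]) (rule integrable_norm[OF intA])
      also have "\<dots> \<le> (LINT x|M. norm (F x))"
      proof (rule integral_mono)
        show "integrable M (\<lambda>x. \<Sum>k\<le>n. norm (indicat_real (A k) x *\<^sub>R F x))"
          by (intro Bochner_Integration.integrable_sum integrable_norm intA)
        show "integrable M (\<lambda>x. norm (F x))" using F by simp
        fix x
        have "(\<Sum>k\<le>n. norm (indicat_real (A k) x *\<^sub>R F x)) = (\<Sum>k\<le>n. indicat_real (A k) x) * norm (F x)"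
          by (simp add: sum_distrib_right)
        also have "(\<Sum>k\<le>n. indicat_real (A k) x) = indicat_real (\<Union>k\<le>n. A k) x"
          by (rule indicator_UN_disjoint[symmetric]) (auto simp: disjoint_family_on_def dest: disjA)
        also have "\<dots> * norm (F x) \<le> norm (F x)"
          by (auto simp: indicator_def)
        finally show "(\<Sum>k\<le>n. norm (indicat_real (A k) x *\<^sub>R F x)) \<le> norm (F x)" .
      qed
      finally show "(\<Sum>k\<le>n. LINT x|M. norm (indicat_real (A k) x *\<^sub>R F x)) \<le> (LINT x|M. norm (F x))" .
    qed simp
    show sn: "summable (\<lambda>n. norm (LINT x:A n|M. F x))"
      unfolding set_lebesgue_integral_def
      by (rule summable_comparison_test'[OF sm, of 0]) (simp only: real_norm_def abs_norm_cancel integral_norm_bound)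
    from summable_norm_cancel[OF sn] show "(\<lambda>n. LINT x:A n|M. F x) sums (LINT x:(\<Union>n. A n)|M. F x)"
      using lebesgue_integral_countable_add[OF A disjA int[OF F]] by (simp add: summable_sums)
  qed
  have "((\<lambda>n. LINT x:A n|M. F x) has_sum (LINT x:(\<Union>n. A n)|M. F x)) UNIV"
    by (rule norm_summable_imp_has_sum[OF summ sums])
  also have "(\<lambda>n. LINT x:A n|M. F x) = (\<lambda>n. if n \<in> to_nat_on Q ` Q then (LINT x:B (from_nat_into Q n)|M. F x) else 0)"
    by (rule ext) (simp add: A_def set_lebesgue_integral_def)
  finally have "((\<lambda>q. LINT x:B q|M. F x) has_sum (LINT x:(\<Union>n. A n)|M. F x)) Q"
    by (rule has_sum_countable_nat[OF Q, THEN iffD1])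
  also have "(LINT x:(\<Union>n. A n)|M. F x) = (LINT x|M. F x)"
    unfolding set_lebesgue_integral_def
  proof (rule integral_cong_AE)
    show "AE x in M. indicat_real (\<Union>n. A n) x *\<^sub>R F x = F x"
      using cover unfolding UA by eventually_elim (auto simp: indicator_def)
  qed (use UAs F in measurable)
  finally show ?thesis .
qed

text \<open>Distinct atoms have representatives that overlap in a null set. Countably many overlaps
  can be removed together, which makes the family literally disjoint.\<close>

lemma disjoint_reps:
  assumes Q: "countable Q" "Q \<subseteq> atoms M"
  obtains B where "\<And>q. q \<in> Q \<Longrightarrow> B q \<in> sets M" "disjoint_family_on B Q"
    "AE x in M. \<forall>q\<in>Q. x \<in> B q \<longleftrightarrow> x \<in> rep M q"
proof -
  define N where "N = (\<Union>p\<in>Q. \<Union>q\<in>Q - {p}. rep M p \<inter> rep M q)"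
  have null: "rep M p \<inter> rep M q \<in> null_sets M" if "p \<in> Q" "q \<in> Q - {p}" for p q
  proof -
    have "AE x in M. \<not> (x \<in> rep M p \<and> x \<in> rep M q)"
      using that Q by (intro rep_disjoint) auto
    then have "AE x in M. x \<notin> rep M p \<inter> rep M q" by eventually_elim auto
    moreover have "rep M p \<inter> rep M q \<in> sets M" using that Q by (intro sets.Int rep_sets) auto
    ultimately show ?thesis using AE_iff_null_sets by blast
  qed
  have N: "N \<in> null_sets M"
    unfolding N_def using Q null by (intro null_sets_UN') auto
  show thesis
  proof (rule that[of "\<lambda>q. rep M q - N"])
    show "rep M q - N \<in> sets M" if "q \<in> Q" for q
      using that Q N rep_sets by (auto simp: null_setsD2)
    show "disjoint_family_on (\<lambda>q. rep M q - N) Q"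
      by (auto simp: disjoint_family_on_def N_def)
    show "AE x in M. \<forall>q\<in>Q. (x \<in> rep M q - N) \<longleftrightarrow> x \<in> rep M q"
      using AE_not_in[OF N] by eventually_elim auto
  qed
qed

text \<open>Both functions are constant almost everywhere on each representative, so the integral
  over it is a measure times a product of constants. Normalization splits the measure into two
  square roots, one for each coordinate.\<close>

lemma parseval:
  assumes Q: "countable Q" "Q \<subseteq> atoms M" and cover: "AE x in M. \<exists>q\<in>Q. x \<in> rep M q"
    and f: "f \<in> L2 M" and h: "h \<in> L2 M"
  shows "((\<lambda>q. coord M f q * cnj (coord M h q)) has_sum l2inner M f h) Q"
proof -
  obtain B where B: "\<And>q. q \<in> Q \<Longrightarrow> B q \<in> sets M" "disjoint_family_on B Q"
    "AE x in M. \<forall>q\<in>Q. x \<in> B q \<longleftrightarrow> x \<in> rep M q" by (rule disjoint_reps[OF Q]) (rule that)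
  have "((\<lambda>q. LINT x:B q|M. f x * cnj (h x)) has_sum l2inner M f h) Q"
    unfolding l2inner_def
  proof (rule has_sum_integral_partition[OF Q(1) B(1,2)])
    show "AE x in M. \<exists>q\<in>Q. x \<in> B q"
      using cover B(3) by eventually_elim auto
  qed (auto intro: L2_prod_integrable f h)
  also have "?this \<longleftrightarrow> ?thesis"
  proof (rule has_sum_cong)
    fix q assume q: "q \<in> Q"
    then have qa: "q \<in> atoms M" using Q by blast
    obtain c d where cd: "AE x in M. x \<in> rep M q \<longrightarrow> f x = c" "AE x in M. x \<in> rep M q \<longrightarrow> h x = d"
      using atomic_set_const[OF atomic_set_rep(1)[OF qa]] f h by (metis L2_measurable)
    have "(LINT x:B q|M. f x * cnj (h x)) = (LINT x:rep M q|M. f x * cnj (h x))"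
      unfolding set_lebesgue_integral_def
    proof (rule integral_cong_AE)
      show "AE x in M. indicat_real (B q) x *\<^sub>R (f x * cnj (h x)) = indicat_real (rep M q) x *\<^sub>R (f x * cnj (h x))"
        using B(3) by eventually_elim (use q in \<open>auto simp: indicator_def\<close>)
    qed (use B(1)[OF q] rep_sets[OF qa] f h in measurable)
    also have "\<dots> = of_real (measure M (rep M q)) * (c * cnj d)"
    proof (rule set_integral_rep_const[OF qa])
      show "AE x in M. x \<in> rep M q \<longrightarrow> f x * cnj (h x) = c * cnj d"
        using cd by eventually_elim auto
    qed (use f h in measurable)
    also have "\<dots> = coord M f q * cnj (coord M h q)"
    proof -
      let ?m = "measure M (rep M q)"
      have "coord M f q * cnj (coord M h q) = of_real (sqrt ?m * sqrt ?m) * (c * cnj d)"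
        using coord_const[OF qa cd(1) L2_measurable[OF f]] coord_const[OF qa cd(2) L2_measurable[OF h]]
        by (simp only: of_real_mult complex_cnj_mult complex_cnj_complex_of_real mult_ac)
      also have "sqrt ?m * sqrt ?m = ?m" by simp
      finally show ?thesis ..
    qed
    finally show "(LINT x:B q|M. f x * cnj (h x)) = coord M f q * cnj (coord M h q)" .
  qed
  finally show ?thesis .
qed

text \<open>The Riesz-Fischer direction: the step function with value \<open>a q\<close> divided by
  the root of the measure on the atom \<open>q\<close>. The squared norm is then the sum of the
  squared moduli of \<open>a\<close>.\<close>

lemma vector_with_coords:
  assumes Q: "countable Q" "Q \<subseteq> atoms M" and a: "(\<lambda>q. (cmod (a q))\<^sup>2) summable_on Q"
  obtains f where "f \<in> L2 M" "\<And>q. q \<in> Q \<Longrightarrow> coord M f q = a q"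
proof -
  obtain B where B: "\<And>q. q \<in> Q \<Longrightarrow> B q \<in> sets M" "disjoint_family_on B Q"
    "AE x in M. \<forall>q\<in>Q. x \<in> B q \<longleftrightarrow> x \<in> rep M q" by (rule disjoint_reps[OF Q]) (rule that)
  define v where "v q = a q / of_real (sqrt (measure M (rep M q)))" for q
  define A where "A n = (if n \<in> to_nat_on Q ` Q then B (from_nat_into Q n) else {})" for n
  define w where "w n = v (from_nat_into Q n)" for n
  have fn: "from_nat_into Q n \<in> Q" if "n \<in> to_nat_on Q ` Q" for n
    using that Q by auto
  have A [measurable]: "A n \<in> sets M" for n using B(1) fn by (auto simp: A_def)
  \<comment> \<open>At each point at most one term is nonzero; writing the step function as a series
    gives its measurability.\<close>
  define f where "f x = (\<Sum>n. indicat_real (A n) x *\<^sub>R w n)" for x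
  have f_eq: "f x = v q" if "q \<in> Q" "x \<in> B q" for x q
  proof -
    have "x \<in> A n \<longleftrightarrow> n = to_nat_on Q q" for n
    proof
      assume "x \<in> A n"
      then have n: "n \<in> to_nat_on Q ` Q" "x \<in> B (from_nat_into Q n)" by (auto simp: A_def split: if_splits)
      then have "from_nat_into Q n = q"
        using B(2) that fn[OF n(1)] by (auto simp: disjoint_family_on_def)
      then show "n = to_nat_on Q q" using n(1) Q(1) by auto
    qed (use that Q(1) in \<open>auto simp: A_def\<close>)
    then have "(\<lambda>n. indicat_real (A n) x *\<^sub>R w n) = (\<lambda>n. if n = to_nat_on Q q then v q else 0)"
      using that Q(1) by (auto simp: w_def indicator_def)
    then show ?thesis
      using sums_unique[OF sums_single[of "to_nat_on Q q" "\<lambda>_. v q"]] by (simp add: f_def)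
  qed
  have fmeas: "f \<in> borel_measurable M"
    unfolding f_def using A by measurable
  have norm_eq: "ennreal ((cmod (f x))\<^sup>2) = (\<Sum>n. ennreal ((cmod (w n))\<^sup>2) * indicator (A n) x)" for x
  proof (cases "\<exists>q\<in>Q. x \<in> B q")
    case True
    then obtain q where q: "q \<in> Q" "x \<in> B q" by blast
    have "x \<in> A n \<longleftrightarrow> n = to_nat_on Q q" for n
    proof
      assume "x \<in> A n"
      then have n: "n \<in> to_nat_on Q ` Q" "x \<in> B (from_nat_into Q n)" by (auto simp: A_def split: if_splits)
      then have "from_nat_into Q n = q"
        using B(2) q fn[OF n(1)] by (auto simp: disjoint_family_on_def)
      then show "n = to_nat_on Q q" using n(1) Q(1) by auto
    qed (use q Q(1) in \<open>auto simp: A_def\<close>)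
    then have "(\<lambda>n. ennreal ((cmod (w n))\<^sup>2) * indicator (A n) x)
        = (\<lambda>n. if n = to_nat_on Q q then ennreal ((cmod (v q))\<^sup>2) else 0)"
      using q Q(1) by (auto simp: w_def indicator_def)
    then show ?thesis
      using sums_unique[OF sums_single[of "to_nat_on Q q" "\<lambda>_. ennreal ((cmod (v q))\<^sup>2)"]]
      by (simp add: f_eq[OF q])
  next
    case False
    then have "x \<notin> A n" for n using fn by (auto simp: A_def)
    then show ?thesis by (simp add: f_def)
  qed
  have meas_eq: "emeasure M (B q) = ennreal (measure M (rep M q))" if "q \<in> Q" for q
  proof -
    have "q \<in> atoms M" using that Q by blast
    have "emeasure M (B q) = emeasure M (rep M q)"
    proof (rule emeasure_eq_AE)
      show "AE x in M. x \<in> B q \<longleftrightarrow> x \<in> rep M q"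
        using B(3) by eventually_elim (use that in auto)
    qed (use that B(1) rep_sets \<open>q \<in> atoms M\<close> in auto)
    then show ?thesis using rep_finite[OF \<open>q \<in> atoms M\<close>] by (simp add: emeasure_eq_ennreal_measure)
  qed
  let ?b = "\<lambda>n. if n \<in> to_nat_on Q ` Q then (cmod (a (from_nat_into Q n)))\<^sup>2 else 0"
  have "(?b has_sum (\<Sum>\<^sub>\<infinity>q\<in>Q. (cmod (a q))\<^sup>2)) UNIV"
    using has_sum_countable_nat[OF Q(1), where g = "\<lambda>q. (cmod (a q))\<^sup>2"] has_sum_infsum[OF a]
    by (rule iffD2)
  then have summb: "summable ?b"
    by (intro sums_summable has_sum_imp_sums)
  have term_eq: "ennreal ((cmod (w n))\<^sup>2) * emeasure M (A n) = ennreal (?b n)" for n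
  proof (cases "n \<in> to_nat_on Q ` Q")
    case True
    let ?q = "from_nat_into Q n"
    have q: "?q \<in> Q" by (rule fn[OF True])
    then have "measure M (rep M ?q) > 0" using Q measure_rep_pos by blast
    then have "(cmod (w n))\<^sup>2 * measure M (rep M ?q) = (cmod (a ?q))\<^sup>2"
      by (simp add: w_def v_def norm_divide power_divide)
    then show ?thesis
      using True meas_eq[OF q] by (simp add: A_def ennreal_mult'[symmetric])
  qed (simp add: A_def)
  have "(\<integral>\<^sup>+x. ennreal ((cmod (f x))\<^sup>2) \<partial>M) = (\<Sum>n. \<integral>\<^sup>+x. ennreal ((cmod (w n))\<^sup>2) * indicator (A n) x \<partial>M)"
    unfolding norm_eq by (intro nn_integral_suminf) measurable
  also have "\<dots> = (\<Sum>n. ennreal (?b n))"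
    by (simp only: nn_integral_cmult_indicator[OF A] term_eq)
  also have "\<dots> = ennreal (\<Sum>n. ?b n)"
    by (rule suminf_ennreal2[OF _ summb]) auto
  finally have "(\<integral>\<^sup>+x. ennreal ((cmod (f x))\<^sup>2) \<partial>M) < \<infinity>" by simp
  then have fL2: "f \<in> L2 M"
    using fmeas by (intro L2I) (auto intro!: integrableI_nonneg)
  show thesis
  proof (rule that[OF fL2])
    fix q assume q: "q \<in> Q"
    then have qa: "q \<in> atoms M" using Q by blast
    have "AE x in M. x \<in> rep M q \<longrightarrow> f x = v q"
      using B(3) by eventually_elim (use q f_eq in auto)
    from coord_const[OF qa this fmeas] show "coord M f q = a q"
      using measure_rep_pos[OF qa] by (simp add: v_def)
  qed
qed

subsection \<open>A single prefixing map\<close>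

locale prefixing =
  fixes M :: "'x measure" and D :: "'x set" and tau :: "'x \<Rightarrow> 'x" and Phi :: "'x \<Rightarrow> real" and c :: "'x \<Rightarrow> 'x"
  assumes D_sets [measurable]: "D \<in> sets M" and D_finite: "emeasure M D < \<infinity>"
    and tau_measurable: "tau \<in> measurable (restrict_space M D) M"
    and R_sets [measurable]: "tau ` D \<in> sets M" and R_finite: "emeasure M (tau ` D) < \<infinity>"
    and Phi_measurable [measurable]: "Phi \<in> borel_measurable M"
    and image: "\<And>E. E \<in> sets M \<Longrightarrow> E \<subseteq> D \<Longrightarrow>
      tau ` E \<in> sets M \<and> emeasure M (tau ` E) = (\<integral>\<^sup>+x\<in>E. ennreal (Phi x) \<partial>M)"
    and Phi_pos: "AE x in M. x \<in> D \<longrightarrow> 0 < Phi x"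
    and c_tau: "\<And>x. x \<in> D \<Longrightarrow> c (tau x) = x"
    and c_measurable [measurable]: "c \<in> measurable M M"
begin

abbreviation R where "R \<equiv> tau ` D"

definition T :: "('x \<Rightarrow> complex) \<Rightarrow> 'x \<Rightarrow> complex" where
  "T f x = (if x \<in> R then complex_of_real (inverse (sqrt (Phi (c x)))) * f (c x) else 0)"

text \<open>This is what the substitution \<open>y = tau x\<close> gives for the adjoint of
  \<open>T\<close>: the density \<open>Phi x\<close> times the reciprocal root in \<open>T\<close>
  leaves \<open>sqrt (Phi x)\<close>.\<close>

definition S :: "('x \<Rightarrow> complex) \<Rightarrow> 'x \<Rightarrow> complex" where
  "S f x = (if x \<in> D then complex_of_real (sqrt (Phi x)) * f (tau x) else 0)"

text \<open>The image filter under \<open>tau\<close>. Restricting the preimage to \<open>D\<close>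
  makes the family empty when \<open>D\<close> is not in \<open>p\<close>, which encodes that
  \<open>T\<close> kills the atom. \<open>pull\<close> does the same for \<open>c\<close> on
  \<open>R\<close>.\<close>

definition push :: "'x set set \<Rightarrow> 'x set set" where
  "push p = {E \<in> sets M. {x \<in> D. tau x \<in> E} \<in> p}"

definition pull :: "'x set set \<Rightarrow> 'x set set" where
  "pull p = {E \<in> sets M. {x \<in> R. c x \<in> E} \<in> p}"

lemma D_space: "D \<subseteq> space M" and R_space: "R \<subseteq> space M"
  using D_sets R_sets sets.sets_into_space by blast+

lemma tau_vimage_sets: "E \<in> sets M \<Longrightarrow> {x \<in> D. tau x \<in> E} \<in> sets M"
proof -
  assume "E \<in> sets M"
  then have "tau -` E \<inter> space (restrict_space M D) \<in> sets (restrict_space M D)"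
    using tau_measurable by (rule measurable_sets[rotated])
  moreover have "tau -` E \<inter> space (restrict_space M D) = {x \<in> D. tau x \<in> E}"
    using D_space by (auto simp: space_restrict_space)
  ultimately show ?thesis by (simp add: sets_restrict_space_iff)
qed

lemma c_vimage_sets: "E \<in> sets M \<Longrightarrow> {x \<in> R. c x \<in> E} \<in> sets M"
proof -
  assume "E \<in> sets M"
  then have "R \<inter> (c -` E \<inter> space M) \<in> sets M"
    by (intro sets.Int R_sets measurable_sets[OF c_measurable])
  moreover have "R \<inter> (c -` E \<inter> space M) = {x \<in> R. c x \<in> E}"
    using R_space by auto
  ultimately show ?thesis by simp
qed

section \<open>Null sets and change of variables along a prefixing map\<close>

lemma image_null:
  assumes "N \<in> null_sets M" "N \<subseteq> D" shows "tau ` N \<in> null_sets M"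
proof -
  have "N \<in> sets M" using assms by auto
  have "emeasure M (tau ` N) = 0"
    using image[OF \<open>N \<in> sets M\<close> assms(2)] nn_integral_null_set[OF assms(1)] by simp
  then show ?thesis using image[OF \<open>N \<in> sets M\<close> assms(2)] by (intro null_setsI) auto
qed

text \<open>Positivity of \<open>Phi\<close> enters here: the integral of \<open>Phi\<close> over
  the preimage is the measure of a null set, and a positive function has integral zero only over a
  null set.\<close>

lemma vimage_null:
  assumes "N \<in> null_sets M" shows "{x \<in> D. tau x \<in> N} \<in> null_sets M"
proof -
  let ?E = "{x \<in> D. tau x \<in> N}"
  have E [measurable]: "?E \<in> sets M" using assms by (intro tau_vimage_sets) auto
  have "tau ` ?E = R \<inter> N" by auto
  moreover have "R \<inter> N \<in> null_sets M" using assms by (intro null_set_Int1) auto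
  ultimately have "(\<integral>\<^sup>+x\<in>?E. ennreal (Phi x) \<partial>M) = 0"
    using image[OF E] by auto
  then have "AE x in M. ennreal (Phi x) * indicator ?E x = 0"
    by (subst (asm) nn_integral_0_iff_AE) measurable
  with Phi_pos have "AE x in M. x \<notin> ?E"
    by eventually_elim (auto simp: indicator_def ennreal_eq_0_iff split: if_splits)
  then show ?thesis using AE_iff_null_sets[OF E] by simp
qed

text \<open>\<open>tau\<close> carries null sets to null sets in both directions, so exceptional
  sets can be moved between \<open>D\<close> and \<open>R\<close>. No measurability of
  \<open>P\<close> is involved, as exceptional sets are only required to lie in a null set.\<close>

lemma AE_tau_iff: "(AE x in M. x \<in> D \<longrightarrow> P (tau x)) \<longleftrightarrow> (AE y in M. y \<in> R \<longrightarrow> P y)"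
proof
  assume "AE x in M. x \<in> D \<longrightarrow> P (tau x)"
  then obtain N where N: "N \<in> null_sets M" "{x \<in> space M. \<not> (x \<in> D \<longrightarrow> P (tau x))} \<subseteq> N"
    by (auto simp: eventually_ae_filter)
  have "tau ` (D \<inter> N) \<in> null_sets M"
    using N(1) by (intro image_null null_set_Int1) auto
  from AE_not_in[OF this] show "AE y in M. y \<in> R \<longrightarrow> P y"
    by eventually_elim (use N(2) D_space in auto)
next
  assume "AE y in M. y \<in> R \<longrightarrow> P y"
  then obtain N where N: "N \<in> null_sets M" "{y \<in> space M. \<not> (y \<in> R \<longrightarrow> P y)} \<subseteq> N"
    by (auto simp: eventually_ae_filter)
  from AE_not_in[OF vimage_null[OF N(1)]] show "AE x in M. x \<in> D \<longrightarrow> P (tau x)"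
    by eventually_elim (use N(2) R_space in auto)
qed

lemma AE_c_iff: "(AE y in M. y \<in> R \<longrightarrow> P (c y)) \<longleftrightarrow> (AE x in M. x \<in> D \<longrightarrow> P x)"
proof -
  have "(AE y in M. y \<in> R \<longrightarrow> P (c y)) \<longleftrightarrow> (AE x in M. x \<in> D \<longrightarrow> P (c (tau x)))"
    by (rule AE_tau_iff[symmetric])
  also have "\<dots> \<longleftrightarrow> (AE x in M. x \<in> D \<longrightarrow> P x)"
    by (simp add: c_tau cong: imp_cong)
  finally show ?thesis .
qed

text \<open>Each side assigns to \<open>B\<close> the measure of \<open>R \<inter> B\<close>, which
  is the image of the preimage of \<open>B\<close>. Stated for measures, this reduces substitution
  in integrals to the general rules for \<open>distr\<close> and \<open>density\<close>.\<close>

lemma distr_eq: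
  "distr (density (restrict_space M D) (\<lambda>x. ennreal (Phi x))) M tau = density M (\<lambda>x. ennreal (indicator R x))"
proof (rule measure_eqI)
  let ?L = "distr (density (restrict_space M D) (\<lambda>x. ennreal (Phi x))) M tau"
  fix B assume "B \<in> sets ?L"
  then have B [measurable]: "B \<in> sets M" by simp
  let ?E = "{x \<in> D. tau x \<in> B}"
  have E [measurable]: "?E \<in> sets M" by (rule tau_vimage_sets[OF B])
  have "emeasure ?L B = emeasure (density (restrict_space M D) (\<lambda>x. ennreal (Phi x))) ?E"
  proof (subst emeasure_distr)
    show "tau \<in> measurable (density (restrict_space M D) (\<lambda>x. ennreal (Phi x))) M"
      using tau_measurable by simp
    have "tau -` B \<inter> space (density (restrict_space M D) (\<lambda>x. ennreal (Phi x))) = ?E"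
      using D_space by (auto simp: space_restrict_space)
    then show "emeasure (density (restrict_space M D) (\<lambda>x. ennreal (Phi x)))
        (tau -` B \<inter> space (density (restrict_space M D) (\<lambda>x. ennreal (Phi x))))
      = emeasure (density (restrict_space M D) (\<lambda>x. ennreal (Phi x))) ?E" by simp
  qed (rule B)
  also have "\<dots> = (\<integral>\<^sup>+x. ennreal (Phi x) * indicator ?E x \<partial>restrict_space M D)"
  proof (rule emeasure_density)
    show "(\<lambda>x. ennreal (Phi x)) \<in> borel_measurable (restrict_space M D)"
      by (rule measurable_restrict_space1) measurable
    show "?E \<in> sets (restrict_space M D)" using E by (simp add: sets_restrict_space_iff)
  qed
  also have "\<dots> = (\<integral>\<^sup>+x\<in>?E. ennreal (Phi x) \<partial>M)"
    by (subst nn_integral_restrict_space) (auto intro!: nn_integral_cong simp: indicator_def)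
  also have "\<dots> = emeasure M (tau ` ?E)" using image[OF E] by auto
  also have "tau ` ?E = R \<inter> B" by auto
  also have "emeasure M (R \<inter> B) = (\<integral>\<^sup>+x. indicator (R \<inter> B) x \<partial>M)" by simp
  also have "\<dots> = (\<integral>\<^sup>+x. ennreal (indicator R x) * indicator B x \<partial>M)"
    by (intro nn_integral_cong) (simp add: indicator_def)
  also have "\<dots> = emeasure (density M (\<lambda>x. ennreal (indicator R x))) B"
    by (rule emeasure_density[symmetric]) measurable
  finally show "emeasure ?L B = emeasure (density M (\<lambda>x. ennreal (indicator R x))) B" .
qed simp

lemma compose_tau_measurable:
  fixes F :: "'x \<Rightarrow> 'b::real_normed_vector"
  assumes "F \<in> borel_measurable M"
  shows "(\<lambda>x. indicat_real D x *\<^sub>R F (tau x)) \<in> borel_measurable M"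
  using measurable_compose[OF tau_measurable assms]
  by (subst (asm) borel_measurable_restrict_space_iff) auto

lemma Phi_tau_measurable:
  fixes F :: "'x \<Rightarrow> 'b::{real_normed_vector, second_countable_topology}"
  assumes "F \<in> borel_measurable M"
  shows "(\<lambda>x. indicat_real D x *\<^sub>R (Phi x *\<^sub>R F (tau x))) \<in> borel_measurable M"
proof -
  have "(\<lambda>x. Phi x *\<^sub>R (indicat_real D x *\<^sub>R F (tau x))) \<in> borel_measurable M"
    using compose_tau_measurable[OF assms] by measurable
  then show ?thesis by (simp add: mult.commute)
qed

lemma Phi_nonneg_restrict: "AE x in restrict_space M D. 0 \<le> Phi x"
  using Phi_pos by (subst AE_restrict_space_iff) (auto elim!: eventually_mono)

lemma change_of_variables:
  fixes F :: "'x \<Rightarrow> 'b::{banach, second_countable_topology}"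
  assumes F [measurable]: "F \<in> borel_measurable M"
  shows "(LINT y|M. indicat_real R y *\<^sub>R F y) = (LINT x|M. indicat_real D x *\<^sub>R (Phi x *\<^sub>R F (tau x)))"
    and "integrable M (\<lambda>y. indicat_real R y *\<^sub>R F y)
      \<longleftrightarrow> integrable M (\<lambda>x. indicat_real D x *\<^sub>R (Phi x *\<^sub>R F (tau x)))"
proof -
  note m = measurable_compose[OF tau_measurable F]
  have Phi_r: "Phi \<in> borel_measurable (restrict_space M D)"
    by (rule measurable_restrict_space1) measurable
  have tau_d: "tau \<in> measurable (density (restrict_space M D) (\<lambda>x. ennreal (Phi x))) M"
    using tau_measurable by simp
  have "(LINT y|M. indicat_real R y *\<^sub>R F y) = integral\<^sup>L (density M (\<lambda>x. ennreal (indicator R x))) F"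
    by (rule integral_density[symmetric]) auto
  also have "\<dots> = (LINT x|density (restrict_space M D) (\<lambda>x. ennreal (Phi x)). F (tau x))"
    unfolding distr_eq[symmetric] by (rule integral_distr[OF tau_d F])
  also have "\<dots> = (LINT x|restrict_space M D. Phi x *\<^sub>R F (tau x))"
    by (rule integral_density[OF m Phi_r Phi_nonneg_restrict])
  also have "\<dots> = (LINT x|M. indicat_real D x *\<^sub>R (Phi x *\<^sub>R F (tau x)))"
    by (rule integral_restrict_space) simp
  finally show "(LINT y|M. indicat_real R y *\<^sub>R F y) = (LINT x|M. indicat_real D x *\<^sub>R (Phi x *\<^sub>R F (tau x)))" .
  have "integrable M (\<lambda>y. indicat_real R y *\<^sub>R F y) \<longleftrightarrow> integrable (density M (\<lambda>x. ennreal (indicator R x))) F"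
    by (rule integrable_density[symmetric]) auto
  also have "\<dots> \<longleftrightarrow> integrable (density (restrict_space M D) (\<lambda>x. ennreal (Phi x))) (\<lambda>x. F (tau x))"
    unfolding distr_eq[symmetric] by (rule integrable_distr_eq[OF tau_d F])
  also have "\<dots> \<longleftrightarrow> integrable (restrict_space M D) (\<lambda>x. Phi x *\<^sub>R F (tau x))"
    by (rule integrable_density[OF m Phi_r Phi_nonneg_restrict])
  also have "\<dots> \<longleftrightarrow> integrable M (\<lambda>x. indicat_real D x *\<^sub>R (Phi x *\<^sub>R F (tau x)))"
    by (rule integrable_restrict_space) simp
  finally show "integrable M (\<lambda>y. indicat_real R y *\<^sub>R F y)
      \<longleftrightarrow> integrable M (\<lambda>x. indicat_real D x *\<^sub>R (Phi x *\<^sub>R F (tau x)))" .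
qed

section \<open>The generator and its adjoint\<close>

lemma T_L2:
  assumes f: "f \<in> L2 M" shows "T f \<in> L2 M"
proof (rule L2I)
  have fm [measurable]: "f \<in> borel_measurable M" using f by (rule L2_measurable)
  show "T f \<in> borel_measurable M" unfolding T_def by measurable
  let ?F = "\<lambda>y. (cmod (complex_of_real (inverse (sqrt (Phi (c y)))) * f (c y)))\<^sup>2"
  have "(\<lambda>x. (cmod (T f x))\<^sup>2) = (\<lambda>y. indicat_real R y *\<^sub>R ?F y)"
    by (auto simp: T_def indicator_def)
  moreover have "integrable M (\<lambda>y. indicat_real R y *\<^sub>R ?F y)"
  proof (subst change_of_variables(2))
    have "integrable M (\<lambda>x. indicat_real D x *\<^sub>R (cmod (f x))\<^sup>2)"
      by (rule integrable_mult_indicator[OF D_sets L2_integrable_square[OF f]])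
    also have "?this \<longleftrightarrow> integrable M (\<lambda>x. indicat_real D x *\<^sub>R (Phi x *\<^sub>R ?F (tau x)))"
    proof (rule integrable_cong_AE)
      show "(\<lambda>x. indicat_real D x *\<^sub>R (Phi x *\<^sub>R ?F (tau x))) \<in> borel_measurable M"
        by (rule Phi_tau_measurable) measurable
      show "AE x in M. indicat_real D x *\<^sub>R (cmod (f x))\<^sup>2 = indicat_real D x *\<^sub>R (Phi x *\<^sub>R ?F (tau x))"
        using Phi_pos by eventually_elim
          (auto simp: indicator_def c_tau norm_mult norm_inverse power_mult_distrib power_inverse)
    qed measurable
    finally show "integrable M (\<lambda>x. indicat_real D x *\<^sub>R (Phi x *\<^sub>R ?F (tau x)))" .
  qed measurable
  ultimately show "integrable M (\<lambda>x. (cmod (T f x))\<^sup>2)" by simp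
qed

lemma S_L2:
  assumes f: "f \<in> L2 M" shows "S f \<in> L2 M"
proof (rule L2I)
  have fm [measurable]: "f \<in> borel_measurable M" using f by (rule L2_measurable)
  have "(\<lambda>x. complex_of_real (sqrt (Phi x)) * (indicat_real D x *\<^sub>R f (tau x))) \<in> borel_measurable M"
    using compose_tau_measurable[OF fm] by measurable
  also have "(\<lambda>x. complex_of_real (sqrt (Phi x)) * (indicat_real D x *\<^sub>R f (tau x))) = S f"
    by (auto simp: S_def indicator_def)
  finally show Sm [measurable]: "S f \<in> borel_measurable M" .
  let ?F = "\<lambda>y. (cmod (f y))\<^sup>2"
  have "integrable M (\<lambda>x. indicat_real D x *\<^sub>R (Phi x *\<^sub>R ?F (tau x)))"
    by (subst change_of_variables(2)[symmetric])
      (auto intro!: integrable_mult_indicator[OF R_sets L2_integrable_square[OF f], unfolded real_scaleR_def])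
  also have "?this \<longleftrightarrow> integrable M (\<lambda>x. (cmod (S f x))\<^sup>2)"
  proof (rule integrable_cong_AE)
    show "(\<lambda>x. indicat_real D x *\<^sub>R (Phi x *\<^sub>R ?F (tau x))) \<in> borel_measurable M"
      by (rule Phi_tau_measurable) measurable
    show "AE x in M. indicat_real D x *\<^sub>R (Phi x *\<^sub>R ?F (tau x)) = (cmod (S f x))\<^sup>2"
      using Phi_pos by eventually_elim
        (auto simp: indicator_def S_def norm_mult power_mult_distrib)
  qed measurable
  finally show "integrable M (\<lambda>x. (cmod (S f x))\<^sup>2)" .
qed

lemma is_adjoint_T_S: "is_adjoint M T S"
  unfolding is_adjoint_def
proof (intro conjI ballI)
  fix f g assume f: "f \<in> L2 M" and g: "g \<in> L2 M"
  have [measurable]: "f \<in> borel_measurable M" "g \<in> borel_measurable M"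
    using f g by (auto intro: L2_measurable)
  let ?F = "\<lambda>y. complex_of_real (inverse (sqrt (Phi (c y)))) * f (c y) * cnj (g y)"
  have "l2inner M (T f) g = (LINT y|M. indicat_real R y *\<^sub>R ?F y)"
    unfolding l2inner_def T_def by (intro Bochner_Integration.integral_cong) (auto simp: indicator_def)
  also have "\<dots> = (LINT x|M. indicat_real D x *\<^sub>R (Phi x *\<^sub>R ?F (tau x)))"
    by (rule change_of_variables(1)) measurable
  also have "\<dots> = l2inner M f (S g)"
    unfolding l2inner_def
  proof (rule integral_cong_AE)
    show "(\<lambda>x. indicat_real D x *\<^sub>R (Phi x *\<^sub>R ?F (tau x))) \<in> borel_measurable M"
      by (rule Phi_tau_measurable) measurable
    show "(\<lambda>x. f x * cnj (S g x)) \<in> borel_measurable M"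
      by (intro borel_measurable_integrable L2_prod_integrable f S_L2 g)
    show "AE x in M. indicat_real D x *\<^sub>R (Phi x *\<^sub>R ?F (tau x)) = f x * cnj (S g x)"
      using Phi_pos
    proof eventually_elim
      case (elim x)
      have "Phi x * inverse (sqrt (Phi x)) = sqrt (Phi x)" if "x \<in> D"
        using elim that by (metis divide_inverse less_imp_le real_div_sqrt)
      then have "x \<in> D \<Longrightarrow> complex_of_real (Phi x) * complex_of_real (inverse (sqrt (Phi x))) = complex_of_real (sqrt (Phi x))"
        by (metis of_real_mult)
      then show ?case
        by (auto simp: indicator_def S_def c_tau scaleR_conv_of_real simp del: of_real_inverse)
    qed
  qed
  finally show "l2inner M (T f) g = l2inner M f (S g)" .
qed (rule S_L2)

lemma T_nonzero:
  assumes "emeasure M D > 0"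
  shows "\<exists>f\<in>L2 M. \<not> (AE x in M. T f x = 0)"
proof (rule bexI[OF _ L2_indicator[OF D_sets D_finite]], rule)
  assume "AE x in M. T (\<lambda>x. complex_of_real (indicator D x)) x = 0"
  then have "AE x in M. x \<in> R \<longrightarrow> T (\<lambda>x. complex_of_real (indicator D x)) x = 0" by eventually_elim simp
  then have "AE x in M. x \<in> D \<longrightarrow> T (\<lambda>x. complex_of_real (indicator D x)) (tau x) = 0"
    by (subst AE_tau_iff)
  with Phi_pos have "AE x in M. x \<notin> D"
    by eventually_elim (auto simp: T_def c_tau)
  then have "D \<in> null_sets M" using AE_iff_null_sets[OF D_sets] by simp
  then show False using assms by auto
qed

section \<open>Transport of atoms along a prefixing map\<close>

text \<open>\<open>tau\<close> identifies \<open>D\<close> with \<open>R\<close> up to null sets, so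
  the image of an atom inside \<open>D\<close> inherits its zero-one law. The image is written with
  \<open>c\<close>, which makes it visibly measurable.\<close>

lemma atom_push_sets:
  assumes A: "atomic_set M A" and D: "AE x in M. x \<in> A \<longrightarrow> x \<in> D"
  shows "atomic_set M {y \<in> R. c y \<in> A}"
    and "push (atom_filter M A) = atom_filter M {y \<in> R. c y \<in> A}"
proof -
  let ?B = "{y \<in> R. c y \<in> A}"
  have As: "A \<in> sets M" using A by (simp add: atomic_set_def)
  have Bs: "?B \<in> sets M" by (rule c_vimage_sets[OF As])
  \<comment> \<open>Valid for arbitrary \<open>E\<close>: below it is used with \<open>{}\<close>
    for non-nullness and with \<open>- E\<close>, which need not be measurable, for the second half
    of the zero-one law.\<close>
  have iff: "(AE x in M. x \<in> A \<longrightarrow> x \<in> {x \<in> D. tau x \<in> E}) \<longleftrightarrow> (AE y in M. y \<in> ?B \<longrightarrow> y \<in> E)" for E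
  proof -
    have "(AE y in M. y \<in> ?B \<longrightarrow> y \<in> E) \<longleftrightarrow> (AE y in M. y \<in> R \<longrightarrow> c y \<in> A \<longrightarrow> y \<in> E)"
      by (rule AE_cong) auto
    also have "\<dots> \<longleftrightarrow> (AE x in M. x \<in> D \<longrightarrow> x \<in> A \<longrightarrow> tau x \<in> E)"
      by (subst AE_tau_iff[symmetric]) (simp add: c_tau cong: imp_cong)
    also have "\<dots> \<longleftrightarrow> (AE x in M. x \<in> A \<longrightarrow> x \<in> {x \<in> D. tau x \<in> E})"
    proof
      assume "AE x in M. x \<in> D \<longrightarrow> x \<in> A \<longrightarrow> tau x \<in> E"
      with D show "AE x in M. x \<in> A \<longrightarrow> x \<in> {x \<in> D. tau x \<in> E}" by eventually_elim auto
    next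
      assume "AE x in M. x \<in> A \<longrightarrow> x \<in> {x \<in> D. tau x \<in> E}"
      then show "AE x in M. x \<in> D \<longrightarrow> x \<in> A \<longrightarrow> tau x \<in> E" by eventually_elim auto
    qed
    finally show ?thesis by blast
  qed
  show "atomic_set M ?B"
    unfolding atomic_set_def
  proof (intro conjI ballI)
    have "emeasure M ?B \<le> emeasure M R" by (rule emeasure_mono) auto
    then show "emeasure M ?B < \<infinity>" using R_finite by (rule order_le_less_trans)
    show "\<not> (AE x in M. x \<notin> ?B)"
    proof
      assume "AE x in M. x \<notin> ?B"
      then have "AE y in M. y \<in> ?B \<longrightarrow> y \<in> {}" by eventually_elim auto
      then have "AE x in M. x \<in> A \<longrightarrow> x \<in> {x \<in> D. tau x \<in> {}}" by (simp only: iff)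
      then have "AE x in M. x \<notin> A" by eventually_elim auto
      then show False using A by (simp add: atomic_set_def)
    qed
    fix E assume E: "E \<in> sets M"
    have "{x \<in> D. tau x \<in> E} \<in> sets M" by (rule tau_vimage_sets[OF E])
    then consider "AE x in M. x \<in> A \<longrightarrow> x \<in> {x \<in> D. tau x \<in> E}"
      | "AE x in M. x \<in> A \<longrightarrow> x \<notin> {x \<in> D. tau x \<in> E}"
      using A unfolding atomic_set_def by blast
    then show "(AE x in M. x \<in> ?B \<longrightarrow> x \<in> E) \<or> (AE x in M. x \<in> ?B \<longrightarrow> x \<notin> E)"
    proof cases
      case 1 then show ?thesis by (simp only: iff simp_thms)
    next
      case 2
      with D have "AE x in M. x \<in> A \<longrightarrow> x \<in> {x \<in> D. tau x \<in> - E}" by eventually_elim auto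
      then have "AE x in M. x \<in> ?B \<longrightarrow> x \<in> - E" by (simp only: iff)
      then show ?thesis by simp
    qed
  qed (rule Bs)
  show "push (atom_filter M A) = atom_filter M ?B"
    using iff by (auto simp: push_def atom_filter_def tau_vimage_sets)
qed

lemma atom_pull_sets:
  assumes A: "atomic_set M A" and R: "AE x in M. x \<in> A \<longrightarrow> x \<in> R"
  shows "atomic_set M {x \<in> D. tau x \<in> A}"
    and "pull (atom_filter M A) = atom_filter M {x \<in> D. tau x \<in> A}"
proof -
  let ?B = "{x \<in> D. tau x \<in> A}"
  have As: "A \<in> sets M" using A by (simp add: atomic_set_def)
  have Bs: "?B \<in> sets M" by (rule tau_vimage_sets[OF As])
  have iff: "(AE y in M. y \<in> A \<longrightarrow> y \<in> {y \<in> R. c y \<in> E}) \<longleftrightarrow> (AE x in M. x \<in> ?B \<longrightarrow> x \<in> E)" for E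
  proof -
    have "(AE x in M. x \<in> ?B \<longrightarrow> x \<in> E) \<longleftrightarrow> (AE x in M. x \<in> D \<longrightarrow> tau x \<in> A \<longrightarrow> c (tau x) \<in> E)"
      by (rule AE_cong) (auto simp: c_tau)
    also have "\<dots> \<longleftrightarrow> (AE y in M. y \<in> R \<longrightarrow> y \<in> A \<longrightarrow> c y \<in> E)"
      by (rule AE_tau_iff)
    also have "\<dots> \<longleftrightarrow> (AE y in M. y \<in> A \<longrightarrow> y \<in> {y \<in> R. c y \<in> E})"
    proof
      assume "AE y in M. y \<in> R \<longrightarrow> y \<in> A \<longrightarrow> c y \<in> E"
      with R show "AE y in M. y \<in> A \<longrightarrow> y \<in> {y \<in> R. c y \<in> E}" by eventually_elim auto
    next
      assume "AE y in M. y \<in> A \<longrightarrow> y \<in> {y \<in> R. c y \<in> E}"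
      then show "AE y in M. y \<in> R \<longrightarrow> y \<in> A \<longrightarrow> c y \<in> E" by eventually_elim auto
    qed
    finally show ?thesis by blast
  qed
  show "atomic_set M ?B"
    unfolding atomic_set_def
  proof (intro conjI ballI)
    have "emeasure M ?B \<le> emeasure M D" by (rule emeasure_mono) auto
    then show "emeasure M ?B < \<infinity>" using D_finite by (rule order_le_less_trans)
    show "\<not> (AE x in M. x \<notin> ?B)"
    proof
      assume "AE x in M. x \<notin> ?B"
      then have "AE y in M. y \<in> ?B \<longrightarrow> y \<in> {}" by eventually_elim auto
      then have "AE x in M. x \<in> A \<longrightarrow> x \<in> {y \<in> R. c y \<in> {}}" by (simp only: iff)
      then have "AE x in M. x \<notin> A" by eventually_elim auto
      then show False using A by (simp add: atomic_set_def)
    qed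
    fix E assume E: "E \<in> sets M"
    have "{y \<in> R. c y \<in> E} \<in> sets M" by (rule c_vimage_sets[OF E])
    then consider "AE x in M. x \<in> A \<longrightarrow> x \<in> {y \<in> R. c y \<in> E}"
      | "AE x in M. x \<in> A \<longrightarrow> x \<notin> {y \<in> R. c y \<in> E}"
      using A unfolding atomic_set_def by blast
    then show "(AE x in M. x \<in> ?B \<longrightarrow> x \<in> E) \<or> (AE x in M. x \<in> ?B \<longrightarrow> x \<notin> E)"
    proof cases
      case 1 then show ?thesis by (simp only: iff simp_thms)
    next
      case 2
      with R have "AE x in M. x \<in> A \<longrightarrow> x \<in> {y \<in> R. c y \<in> - E}" by eventually_elim auto
      then have "AE x in M. x \<in> ?B \<longrightarrow> x \<in> - E" by (simp only: iff)
      then show ?thesis by simp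
    qed
  qed (rule Bs)
  show "pull (atom_filter M A) = atom_filter M ?B"
    using iff by (auto simp: pull_def atom_filter_def c_vimage_sets)
qed

lemma mem_push_iff:
  assumes p: "p \<in> atoms M" and E: "E \<in> sets M"
  shows "E \<in> push p \<longleftrightarrow> {x \<in> D. tau x \<in> E} \<in> p"
  using E by (simp add: push_def)

lemma push_nonempty_iff:
  assumes p: "p \<in> atoms M" shows "push p \<noteq> {} \<longleftrightarrow> D \<in> p"
proof
  assume "push p \<noteq> {}"
  then obtain E where "{x \<in> D. tau x \<in> E} \<in> p" by (auto simp: push_def)
  then show "D \<in> p" by (rule atom_cong[OF p _ D_sets]) auto
next
  assume "D \<in> p"
  moreover have "{x \<in> D. tau x \<in> R} = D" by auto
  ultimately have "R \<in> push p" by (simp add: push_def)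
  then show "push p \<noteq> {}" by blast
qed

lemma pull_nonempty_iff:
  assumes p: "p \<in> atoms M" shows "pull p \<noteq> {} \<longleftrightarrow> R \<in> p"
proof
  assume "pull p \<noteq> {}"
  then obtain E where "{x \<in> R. c x \<in> E} \<in> p" by (auto simp: pull_def)
  then show "R \<in> p" by (rule atom_cong[OF p _ R_sets]) auto
next
  assume "R \<in> p"
  moreover have "{x \<in> R. c x \<in> D} = R" by (auto simp: c_tau)
  ultimately have "D \<in> pull p" by (simp add: pull_def)
  then show "pull p \<noteq> {}" by blast
qed

lemma push_empty [simp]: "push {} = {}" and pull_empty [simp]: "pull {} = {}"
  by (auto simp: push_def pull_def)

lemma push_atom:
  assumes p: "p \<in> atoms M" and D: "D \<in> p" shows "push p \<in> atoms M"
proof -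
  have "AE x in M. x \<in> rep M p \<longrightarrow> x \<in> D" using D p by (simp add: mem_atom_iff)
  from atom_push_sets[OF atomic_set_rep(1)[OF p] this] show ?thesis
    using atomic_set_atoms by (fastforce simp: atomic_set_rep(2)[OF p])
qed

lemma pull_atom:
  assumes p: "p \<in> atoms M" and R: "R \<in> p" shows "pull p \<in> atoms M"
proof -
  have "AE x in M. x \<in> rep M p \<longrightarrow> x \<in> R" using R p by (simp add: mem_atom_iff)
  from atom_pull_sets[OF atomic_set_rep(1)[OF p] this] show ?thesis
    using atomic_set_atoms by (fastforce simp: atomic_set_rep(2)[OF p])
qed

lemma R_mem_push: "p \<in> atoms M \<Longrightarrow> D \<in> p \<Longrightarrow> R \<in> push p"
proof -
  assume "D \<in> p"
  moreover have "{x \<in> D. tau x \<in> R} = D" by auto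
  ultimately show ?thesis by (simp add: push_def)
qed

lemma D_mem_pull: "p \<in> atoms M \<Longrightarrow> R \<in> p \<Longrightarrow> D \<in> pull p"
proof -
  assume "R \<in> p"
  moreover have "{x \<in> R. c x \<in> D} = R" by (auto simp: c_tau)
  ultimately show ?thesis by (simp add: pull_def)
qed

lemma pull_push:
  assumes p: "p \<in> atoms M" and D: "D \<in> p" shows "pull (push p) = p"
proof -
  have "E \<in> pull (push p) \<longleftrightarrow> E \<in> p" for E
  proof (cases "E \<in> sets M")
    case True
    have "{x \<in> D. tau x \<in> {y \<in> R. c y \<in> E}} = D \<inter> E" by (auto simp: c_tau) (metis c_tau)
    then have "E \<in> pull (push p) \<longleftrightarrow> D \<inter> E \<in> p"
      using True by (simp add: pull_def push_def c_vimage_sets)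
    also have "\<dots> \<longleftrightarrow> E \<in> p"
      using atom_Int[OF p D, of E] atom_cong[OF p _ True, of "D \<inter> E"] by auto
    finally show ?thesis .
  next
    case False
    then show ?thesis using p by (simp add: pull_def mem_atom_iff)
  qed
  then show ?thesis by blast
qed

lemma push_pull:
  assumes p: "p \<in> atoms M" and R: "R \<in> p" shows "push (pull p) = p"
proof -
  have "E \<in> push (pull p) \<longleftrightarrow> E \<in> p" for E
  proof (cases "E \<in> sets M")
    case True
    have "{y \<in> R. c y \<in> {x \<in> D. tau x \<in> E}} = R \<inter> E" by (auto simp: c_tau)
    then have "E \<in> push (pull p) \<longleftrightarrow> R \<inter> E \<in> p"
      using True by (simp add: pull_def push_def tau_vimage_sets)
    also have "\<dots> \<longleftrightarrow> E \<in> p"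
      using atom_Int[OF p R, of E] atom_cong[OF p _ True, of "R \<inter> E"] by auto
    finally show ?thesis .
  next
    case False
    then show ?thesis using p by (simp add: push_def mem_atom_iff)
  qed
  then show ?thesis by blast
qed

text \<open>Since \<open>p\<close> lives on \<open>R\<close>, intersecting with \<open>R\<close>
  changes nothing. The right side involves only the coding map, hence only the degree of the path
  that is removed.\<close>

lemma pull_eq:
  assumes p: "p \<in> atoms M" and R: "R \<in> p"
  shows "pull p = {E \<in> sets M. c -` E \<inter> space M \<in> p}"
proof -
  have "{x \<in> R. c x \<in> E} \<in> p \<longleftrightarrow> c -` E \<inter> space M \<in> p" if E: "E \<in> sets M" for E
  proof
    have m: "c -` E \<inter> space M \<in> sets M" using E by (rule measurable_sets[OF c_measurable])
    assume "{x \<in> R. c x \<in> E} \<in> p"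
    then show "c -` E \<inter> space M \<in> p"
      by (rule atom_cong[OF p _ m]) (use R_space in auto)
  next
    assume "c -` E \<inter> space M \<in> p"
    with atom_Int[OF p R] have "R \<inter> (c -` E \<inter> space M) \<in> p" by blast
    moreover have "R \<inter> (c -` E \<inter> space M) = {x \<in> R. c x \<in> E}" using R_space by auto
    ultimately show "{x \<in> R. c x \<in> E} \<in> p" by simp
  qed
  then show ?thesis by (auto simp: pull_def)
qed

lemma Phi_const:
  assumes A: "atomic_set M A" and D: "AE x in M. x \<in> A \<longrightarrow> x \<in> D"
  obtains k where "k > 0" "AE x in M. x \<in> A \<longrightarrow> Phi x = k"
proof -
  obtain k where k: "AE x in M. x \<in> A \<longrightarrow> Phi x = k"
    using atomic_set_const_real[OF A Phi_measurable] by metis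
  have "k > 0"
  proof (rule ccontr)
    assume "\<not> k > 0"
    from k D Phi_pos have "AE x in M. x \<notin> A" by eventually_elim (use \<open>\<not> k > 0\<close> in auto)
    then show False using A by (simp add: atomic_set_def)
  qed
  then show thesis using k by (rule that)
qed

lemma measure_image_const:
  assumes B: "B \<in> sets M" "B \<subseteq> D" and k: "k > 0" "AE x in M. x \<in> B \<longrightarrow> Phi x = k"
  shows "measure M (tau ` B) = k * measure M B"
proof -
  have "emeasure M (tau ` B) = (\<integral>\<^sup>+x. ennreal k * indicator B x \<partial>M)"
  proof -
    have "(\<integral>\<^sup>+x\<in>B. ennreal (Phi x) \<partial>M) = (\<integral>\<^sup>+x. ennreal k * indicator B x \<partial>M)"
    proof (rule nn_integral_cong_AE)
      show "AE x in M. ennreal (Phi x) * indicator B x = ennreal k * indicator B x"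
        using k(2) by eventually_elim (auto simp: indicator_def)
    qed
    then show ?thesis using image[OF B] by simp
  qed
  also have "\<dots> = ennreal k * emeasure M B" using B by (simp add: nn_integral_cmult_indicator)
  finally show ?thesis using k(1) by (simp add: measure_def enn2real_mult)
qed

text \<open>On the atom \<open>Phi\<close> is a constant \<open>k\<close>, and \<open>tau\<close>
  multiplies its measure by \<open>k\<close>. The factor \<open>1 / sqrt k\<close> in
  \<open>T\<close> therefore turns one normalized indicator into the other.\<close>

lemma T_atom_vec:
  assumes "p \<in> insert {} (atoms M)"
  shows "AE x in M. T (atom_vec M p) x = atom_vec M (push p) x"
proof (cases "p \<in> atoms M")
  case False
  then show ?thesis using assms by (simp add: atom_vec_def T_def atom_nonempty)
next
  case p: True
  let ?A = "rep M p"
  have A: "atomic_set M ?A" by (rule atomic_set_rep(1)[OF p])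
  show ?thesis
  proof (cases "D \<in> p")
    case False
    then have "push p = {}" using push_nonempty_iff[OF p] by blast
    moreover have "AE x in M. x \<in> D \<longrightarrow> x \<notin> ?A"
      using atom_not_mem[OF p D_sets False] by eventually_elim auto
    then have "AE y in M. y \<in> R \<longrightarrow> c y \<notin> ?A" by (simp add: AE_c_iff[where P = "\<lambda>x. x \<notin> ?A"])
    then have "AE x in M. T (atom_vec M p) x = 0"
      by eventually_elim (auto simp: T_def atom_vec_def)
    ultimately show ?thesis by (simp add: atom_vec_zero atom_nonempty)
  next
    case True
    then have D: "AE x in M. x \<in> ?A \<longrightarrow> x \<in> D" using p by (simp add: mem_atom_iff)
    let ?B = "{y \<in> R. c y \<in> ?A}"
    obtain k where k: "k > 0" "AE x in M. x \<in> ?A \<longrightarrow> Phi x = k" by (rule Phi_const[OF A D])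
    have eqv: "AE x in M. atom_vec M (push p) x = complex_of_real (indicator ?B x / sqrt (measure M ?B))"
      using atom_vec_atom_filter[OF atom_push_sets(1)[OF A D]]
      by (simp only: atom_push_sets(2)[OF A D, symmetric] atomic_set_rep(2)[OF p])
    have B: "?B = tau ` (?A \<inter> D)" by (auto simp: c_tau)
    have "measure M (tau ` (?A \<inter> D)) = k * measure M (?A \<inter> D)"
    proof (rule measure_image_const[OF _ _ k(1)])
      show "AE x in M. x \<in> ?A \<inter> D \<longrightarrow> Phi x = k" using k(2) by eventually_elim auto
    qed (use rep_sets[OF p] D_sets in auto)
    also have "measure M (?A \<inter> D) = measure M ?A"
    proof (rule measure_eq_AE)
      show "AE x in M. x \<in> ?A \<inter> D \<longleftrightarrow> x \<in> ?A" using D by eventually_elim auto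
    qed (use rep_sets[OF p] D_sets in auto)
    finally have meas: "measure M ?B = k * measure M ?A" by (simp only: B)
    from k(2) have "AE x in M. x \<in> D \<longrightarrow> x \<in> ?A \<longrightarrow> Phi x = k" by eventually_elim auto
    then have "AE y in M. y \<in> R \<longrightarrow> c y \<in> ?A \<longrightarrow> Phi (c y) = k"
      by (simp add: AE_c_iff[where P = "\<lambda>x. x \<in> ?A \<longrightarrow> Phi x = k"])
    with eqv show ?thesis
    proof eventually_elim
      case (elim x)
      show ?case unfolding elim(1)
        using elim(2) by (auto simp: T_def atom_vec_def p meas real_sqrt_mult indicator_def divide_inverse)
    qed
  qed
qed

lemma S_atom_vec:
  assumes "p \<in> insert {} (atoms M)"
  shows "AE x in M. S (atom_vec M p) x = atom_vec M (pull p) x"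
proof (cases "p \<in> atoms M")
  case False
  then show ?thesis using assms by (simp add: atom_vec_def S_def atom_nonempty)
next
  case p: True
  let ?A = "rep M p"
  have A: "atomic_set M ?A" by (rule atomic_set_rep(1)[OF p])
  show ?thesis
  proof (cases "R \<in> p")
    case False
    then have "pull p = {}" using pull_nonempty_iff[OF p] by blast
    moreover have "AE x in M. x \<in> R \<longrightarrow> x \<notin> ?A"
      using atom_not_mem[OF p R_sets False] by eventually_elim auto
    then have "AE x in M. x \<in> D \<longrightarrow> tau x \<notin> ?A" by (simp add: AE_tau_iff[where P = "\<lambda>x. x \<notin> ?A"])
    then have "AE x in M. S (atom_vec M p) x = 0"
      by eventually_elim (auto simp: S_def atom_vec_def)
    ultimately show ?thesis by (simp add: atom_vec_zero atom_nonempty)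
  next
    case True
    then have R: "AE x in M. x \<in> ?A \<longrightarrow> x \<in> R" using p by (simp add: mem_atom_iff)
    let ?B = "{x \<in> D. tau x \<in> ?A}"
    note B = atom_pull_sets[OF A R]
    obtain k where k: "k > 0" "AE x in M. x \<in> ?B \<longrightarrow> Phi x = k"
    proof (rule Phi_const[OF B(1)])
      show "AE x in M. x \<in> ?B \<longrightarrow> x \<in> D" by simp
    qed (rule that)
    have eqv: "AE x in M. atom_vec M (pull p) x = complex_of_real (indicator ?B x / sqrt (measure M ?B))"
      using atom_vec_atom_filter[OF B(1)]
      by (simp only: B(2)[symmetric] atomic_set_rep(2)[OF p])
    have "measure M ?A = measure M (tau ` ?B)"
    proof (rule measure_eq_AE)
      have eq: "tau ` ?B = ?A \<inter> R" by auto
      from R show "AE x in M. x \<in> ?A \<longleftrightarrow> x \<in> tau ` ?B"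
        by eventually_elim (use eq in auto)
      show "tau ` ?B \<in> sets M" using eq rep_sets[OF p] by simp
    qed (rule rep_sets[OF p])
    also have "\<dots> = k * measure M ?B"
      by (rule measure_image_const[OF _ _ k]) (use tau_vimage_sets rep_sets[OF p] in auto)
    finally have meas: "measure M ?A = k * measure M ?B" .
    from eqv k(2) show ?thesis
    proof eventually_elim
      case (elim x)
      show ?case unfolding elim(1)
        using elim(2) k(1) by (auto simp: S_def atom_vec_def p meas real_sqrt_mult indicator_def)
    qed
  qed
qed

end

subsection \<open>The action on atoms\<close>

locale lambda_system =
  fixes k :: nat and G :: "'a kgraph" and M :: "'x measure"
    and D :: "'a \<Rightarrow> 'x set" and tau :: "'a \<Rightarrow> 'x \<Rightarrow> 'x"
    and Phi :: "'a \<Rightarrow> 'x \<Rightarrow> real" and cod :: "(nat \<Rightarrow> nat) \<Rightarrow> 'x \<Rightarrow> 'x"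
  assumes kg: "kgraph k G" and sb: "lambda_sbfs k G M D tau Phi cod"
begin

abbreviation R where "R l \<equiv> tau l ` D l"
abbreviation pushl where "pushl l \<equiv> prefixing.push M (D l) (tau l)"
abbreviation pulll where "pulll l \<equiv> prefixing.pull M (D l) (tau l) (cod (deg G l))"
abbreviation t where "t \<equiv> sbfs_op G D tau Phi cod"

lemma rng_arr: "l \<in> arr G \<Longrightarrow> rng G l \<in> arr G"
  and src_arr: "l \<in> arr G \<Longrightarrow> src G l \<in> arr G"
  and src_rng: "l \<in> arr G \<Longrightarrow> src G (rng G l) = rng G l"
  and rng_src: "l \<in> arr G \<Longrightarrow> rng G (src G l) = src G l"
  and cmp_rng: "l \<in> arr G \<Longrightarrow> cmp G (rng G l) l = l"
  and cmp_src: "l \<in> arr G \<Longrightarrow> cmp G l (src G l) = l"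
  and deg_Nk: "l \<in> arr G \<Longrightarrow> deg G l \<in> Nk k"
  and countable_arr: "countable (arr G)"
  using kg unfolding kgraph_def by blast+

lemma cmp_arr: "l \<in> arr G \<Longrightarrow> n \<in> arr G \<Longrightarrow> src G l = rng G n \<Longrightarrow> cmp G l n \<in> arr G"
  and deg_cmp: "l \<in> arr G \<Longrightarrow> n \<in> arr G \<Longrightarrow> src G l = rng G n \<Longrightarrow> deg G (cmp G l n) = (\<lambda>i. deg G l i + deg G n i)"
  using kg unfolding kgraph_def by blast+

lemma factorization:
  assumes "l \<in> arr G" "\<And>i. deg G l i = m i + n i"
  obtains a b where "a \<in> arr G" "b \<in> arr G" "src G a = rng G b" "deg G a = m" "deg G b = n" "cmp G a b = l"
proof -
  have "\<forall>l\<in>arr G. \<forall>m n. (\<forall>i. deg G l i = m i + n i) \<longrightarrow>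
        (\<exists>!p. fst p \<in> arr G \<and> snd p \<in> arr G \<and> src G (fst p) = rng G (snd p) \<and>
              deg G (fst p) = m \<and> deg G (snd p) = n \<and> cmp G (fst p) (snd p) = l)"
    using kg unfolding kgraph_def by (elim conjE)
  from this[rule_format, OF assms(1), of m n, OF assms(2)]
  obtain p where "fst p \<in> arr G \<and> snd p \<in> arr G \<and> src G (fst p) = rng G (snd p) \<and>
              deg G (fst p) = m \<and> deg G (snd p) = n \<and> cmp G (fst p) (snd p) = l"
    by (rule ex1E)
  then show thesis by (intro that[of "fst p" "snd p"]) simp_all
qed

lemma deg_rng: "l \<in> arr G \<Longrightarrow> deg G (rng G l) = (\<lambda>_. 0)"
proof
  fix i assume l: "l \<in> arr G"
  have "deg G (cmp G (rng G l) l) i = deg G (rng G l) i + deg G l i"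
    using deg_cmp[OF rng_arr[OF l] l src_rng[OF l]] by simp
  then show "deg G (rng G l) i = 0" using cmp_rng[OF l] by simp
qed

lemma deg_src: "l \<in> arr G \<Longrightarrow> deg G (src G l) = (\<lambda>_. 0)"
  using deg_rng[OF src_arr] rng_src by metis

lemma family: "m \<in> Nk k \<Longrightarrow> sbfs_family M {l \<in> arr G. deg G l = m} D tau Phi (cod m)"
  using sb unfolding lambda_sbfs_def by blast

lemma family_member:
  assumes l: "l \<in> arr G"
  shows "prefixing M (D l) (tau l) (Phi l) (cod (deg G l))" and "emeasure M (D l) > 0"
proof -
  note fam = family[OF deg_Nk[OF l], unfolded sbfs_family_def]
  have "l \<in> {n \<in> arr G. deg G n = deg G l}" using l by simp
  note m = bspec[OF conjunct1[OF fam] this]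
  have c: "cod (deg G l) \<in> measurable M M" by (rule conjunct2[OF conjunct2[OF conjunct2[OF fam]]])
  show "prefixing M (D l) (tau l) (Phi l) (cod (deg G l))"
    by unfold_locales (use m c in \<open>elim conjE; simp\<close>)+
  show "emeasure M (D l) > 0" using m by (elim conjE)
qed

lemmas pre = family_member(1) and D_positive = family_member(2)

lemma t_eq: "t l = prefixing.T (D l) (tau l) (Phi l) (cod (deg G l))" if "l \<in> arr G"
  by (intro ext) (simp add: sbfs_op_def prefixing.T_def[OF pre[OF that]])

lemma R_sets: "l \<in> arr G \<Longrightarrow> R l \<in> sets M"
  using prefixing.R_sets[OF pre] .

lemma D_sets: "l \<in> arr G \<Longrightarrow> D l \<in> sets M"
  using prefixing.D_sets[OF pre] .

lemma cod_measurable: "m \<in> Nk k \<Longrightarrow> cod m \<in> measurable M M"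
  using family unfolding sbfs_family_def by blast

lemma vertex_tau: "l \<in> arr G \<Longrightarrow> R (rng G l) = D (rng G l)"
proof -
  assume "l \<in> arr G"
  then have "\<forall>x\<in>D (rng G l). tau (rng G l) x = x"
    using sb unfolding lambda_sbfs_def vertices_def by blast
  then show ?thesis by force
qed

lemma sbfs_compose:
  assumes "l \<in> arr G" "n \<in> arr G" "src G l = rng G n"
  shows "AE x in M. x \<in> R n \<longrightarrow> x \<in> D l"
    and "AE x in M. x \<in> D n \<longleftrightarrow> x \<in> D (cmp G l n)"
    and "AE x in M. x \<in> D n \<longrightarrow> tau l (tau n x) = tau (cmp G l n) x"
proof -
  note * = sb[unfolded lambda_sbfs_def, THEN conjunct2, THEN conjunct2, THEN conjunct1, rule_format, OF assms]
  have sets: "R n \<in> sets M" "D l \<in> sets M" "D n \<in> sets M" "D (cmp G l n) \<in> sets M"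
    using assms by (auto intro: R_sets D_sets cmp_arr)
  have "R n - D l \<in> null_sets M" using * sets by (intro null_setsI) auto
  from AE_not_in[OF this] show "AE x in M. x \<in> R n \<longrightarrow> x \<in> D l" by eventually_elim auto
  have "(D n - D (cmp G l n)) \<union> (D (cmp G l n) - D n) \<in> null_sets M"
    using * sets by (intro null_setsI) auto
  from AE_not_in[OF this] show "AE x in M. x \<in> D n \<longleftrightarrow> x \<in> D (cmp G l n)" by eventually_elim auto
  show "AE x in M. x \<in> D n \<longrightarrow> tau l (tau n x) = tau (cmp G l n) x" using * by blast
qed

lemma R_cover_AE: "m \<in> Nk k \<Longrightarrow> AE x in M. \<exists>l\<in>{l \<in> arr G. deg G l = m}. x \<in> R l"
  using family unfolding sbfs_family_def by blast

lemma R_cover: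
  assumes p: "p \<in> atoms M" and m: "m \<in> Nk k"
  obtains l where "l \<in> arr G" "deg G l = m" "R l \<in> p"
proof -
  have "\<exists>l\<in>{l \<in> arr G. deg G l = m}. R l \<in> p"
    by (rule atom_countable_cover[OF p _ _ R_cover_AE[OF m]])
      (auto intro: countable_subset[OF _ countable_arr] R_sets)
  then show thesis using that by blast
qed

lemma R_unique:
  assumes p: "p \<in> atoms M" and "l \<in> arr G" "l' \<in> arr G" "deg G l = deg G l'" "R l \<in> p" "R l' \<in> p"
  shows "l = l'"
proof (rule ccontr)
  assume "l \<noteq> l'"
  then have "emeasure M (R l \<inter> R l') = 0"
    using family[OF deg_Nk[OF assms(2)]] assms(2,3,4) unfolding sbfs_family_def by simp
  then have "R l \<inter> R l' \<in> null_sets M" using assms R_sets by (intro null_setsI) auto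
  from AE_not_in[OF this] have "AE x in M. \<not> (x \<in> R l \<and> x \<in> R l')" by eventually_elim auto
  then show False using atom_disjoint_sets[OF p assms(5,6)] by simp
qed

section \<open>Composition and paths seen from an atom\<close>

text \<open>Composing \<open>l\<close> with the identity at its source gives \<open>l\<close>, so
  the two domains agree almost everywhere; and a vertex map is the identity, so its range is its
  domain. Thus the range sets containing an atom already decide which \<open>l\<close> can be
  prefixed to it.\<close>

lemma D_mem_iff:
  assumes p: "p \<in> atoms M" and l: "l \<in> arr G"
  shows "D l \<in> p \<longleftrightarrow> R (src G l) \<in> p"
proof -
  have ae: "AE x in M. x \<in> D (src G l) \<longleftrightarrow> x \<in> D l"
    using sbfs_compose(2)[OF l src_arr[OF l] rng_src[OF l, symmetric]] by (simp add: cmp_src l)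
  have R: "R (src G l) = D (src G l)"
    using vertex_tau[OF src_arr[OF l]] by (simp add: rng_src l)
  show ?thesis unfolding R
  proof
    assume "D l \<in> p"
    then show "D (src G l) \<in> p"
      by (rule atom_cong[OF p _ D_sets[OF src_arr[OF l]]]) (use ae in \<open>eventually_elim; auto\<close>)
  next
    assume "D (src G l) \<in> p"
    then show "D l \<in> p"
      by (rule atom_cong[OF p _ D_sets[OF l]]) (use ae in \<open>eventually_elim; auto\<close>)
  qed
qed

lemma R_rng_mem:
  assumes p: "p \<in> atoms M" and l: "l \<in> arr G" and "R l \<in> p"
  shows "R (rng G l) \<in> p"
  unfolding vertex_tau[OF l]
  by (rule atom_cong[OF p assms(3) D_sets[OF rng_arr[OF l]]])
    (rule sbfs_compose(1)[OF rng_arr[OF l] l src_rng[OF l]])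

text \<open>Both vertices have degree 0 and both range sets belong to \<open>p\<close>, so
  \<open>R_unique\<close> applies.\<close>

lemma vertex_match:
  assumes p: "p \<in> atoms M" and "l \<in> arr G" "n \<in> arr G" "D l \<in> p" "R n \<in> p"
  shows "src G l = rng G n"
  by (rule R_unique[OF p])
    (use assms in \<open>auto simp: deg_src deg_rng D_mem_iff[symmetric] intro: src_arr rng_arr R_rng_mem\<close>)

lemma pushl_compose:
  assumes p: "p \<in> atoms M" and l: "l \<in> arr G" and n: "n \<in> arr G" and ln: "src G l = rng G n"
    and Dn: "D n \<in> p"
  shows "D l \<in> pushl n p" and "pushl l (pushl n p) = pushl (cmp G l n) p"
proof -
  note pl = pre[OF l] and pn = pre[OF n] and pln = pre[OF cmp_arr[OF l n ln]]
  have inD: "AE x in M. x \<in> D n \<longrightarrow> tau n x \<in> D l"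
    by (rule iffD2[OF prefixing.AE_tau_iff[OF pn, where P = "\<lambda>y. y \<in> D l"] sbfs_compose(1)[OF l n ln]])
  have "{x \<in> D n. tau n x \<in> D l} \<in> p"
    by (rule atom_cong[OF p Dn prefixing.tau_vimage_sets[OF pn D_sets[OF l]]])
      (use inD in \<open>eventually_elim; auto\<close>)
  then show "D l \<in> pushl n p"
    by (simp add: prefixing.mem_push_iff[OF pn p D_sets[OF l]])
  have "E \<in> pushl l (pushl n p) \<longleftrightarrow> E \<in> pushl (cmp G l n) p" if E: "E \<in> sets M" for E
  proof -
    let ?A = "{y \<in> D l. tau l y \<in> E}" and ?C = "{x \<in> D (cmp G l n). tau (cmp G l n) x \<in> E}"
    have A: "?A \<in> sets M" by (rule prefixing.tau_vimage_sets[OF pl E])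
    have B: "{x \<in> D n. tau n x \<in> ?A} \<in> sets M" by (rule prefixing.tau_vimage_sets[OF pn A])
    have C: "?C \<in> sets M" by (rule prefixing.tau_vimage_sets[OF pln E])
    have "AE x in M. x \<in> {x \<in> D n. tau n x \<in> ?A} \<longleftrightarrow> x \<in> ?C"
      using inD sbfs_compose(2,3)[OF l n ln] by eventually_elim auto
    then have "AE x in M. x \<in> {x \<in> D n. tau n x \<in> ?A} \<longrightarrow> x \<in> ?C"
      "AE x in M. x \<in> ?C \<longrightarrow> x \<in> {x \<in> D n. tau n x \<in> ?A}"
      by (eventually_elim, auto)+
    then have "{x \<in> D n. tau n x \<in> ?A} \<in> p \<longleftrightarrow> ?C \<in> p"
      using atom_cong[OF p _ C] atom_cong[OF p _ B] by blast
    then show ?thesis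
      using E A by (simp add: prefixing.push_def[OF pn] prefixing.push_def[OF pl] prefixing.push_def[OF pln])
  qed
  then show "pushl l (pushl n p) = pushl (cmp G l n) p"
    by (auto simp: prefixing.push_def[OF pl] prefixing.push_def[OF pln])
qed

text \<open>Write \<open>r\<close> as the image of an atom under both prefixings and use that these
  compose. It says that \<open>pulll l\<close> deletes the prefix \<open>l\<close> from the path of
  \<open>r\<close>.\<close>

lemma R_cmp_iff:
  assumes r: "r \<in> atoms M" and l: "l \<in> arr G" and n: "n \<in> arr G"
  shows "R l \<in> r \<and> R n \<in> pulll l r \<longleftrightarrow> src G l = rng G n \<and> R (cmp G l n) \<in> r"
proof
  note pl = pre[OF l] and pn = pre[OF n]
  assume a: "R l \<in> r \<and> R n \<in> pulll l r"
  then have q: "pulll l r \<in> atoms M" using prefixing.pull_atom[OF pl r] by blast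
  have ln: "src G l = rng G n"
    by (rule vertex_match[OF q l n]) (use a prefixing.D_mem_pull[OF pl r] in auto)
  note pln = pre[OF cmp_arr[OF l n ln]]
  let ?s = "pulll n (pulll l r)"
  have s: "?s \<in> atoms M" using prefixing.pull_atom[OF pn q] a by blast
  have Dn: "D n \<in> ?s" using prefixing.D_mem_pull[OF pn q] a by blast
  have "r = pushl l (pushl n ?s)"
    using prefixing.push_pull[OF pl r] prefixing.push_pull[OF pn q] a by simp
  then have req: "r = pushl (cmp G l n) ?s"
    using pushl_compose(2)[OF s l n ln Dn] by simp
  then have "D (cmp G l n) \<in> ?s"
    using prefixing.push_nonempty_iff[OF pln s] r atom_nonempty by metis
  then show "src G l = rng G n \<and> R (cmp G l n) \<in> r"
    using prefixing.R_mem_push[OF pln s] req ln by metis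
next
  note pl = pre[OF l] and pn = pre[OF n]
  assume a: "src G l = rng G n \<and> R (cmp G l n) \<in> r"
  then have ln: "src G l = rng G n" by blast
  note pln = pre[OF cmp_arr[OF l n ln]]
  let ?s = "pulll (cmp G l n) r"
  have s: "?s \<in> atoms M" using prefixing.pull_atom[OF pln r] a by blast
  have "D (cmp G l n) \<in> ?s" using prefixing.D_mem_pull[OF pln r] a by blast
  then have Dn: "D n \<in> ?s"
    by (rule atom_cong[OF s _ D_sets[OF n]]) (use sbfs_compose(2)[OF l n ln] in \<open>eventually_elim; auto\<close>)
  have q: "pushl n ?s \<in> atoms M" by (rule prefixing.push_atom[OF pn s Dn])
  have Dl: "D l \<in> pushl n ?s" by (rule pushl_compose(1)[OF s l n ln Dn])
  have req: "r = pushl l (pushl n ?s)"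
    using pushl_compose(2)[OF s l n ln Dn] prefixing.push_pull[OF pln r] a by simp
  have "R l \<in> r" using prefixing.R_mem_push[OF pl q Dl] req by simp
  moreover have "pulll l r = pushl n ?s" using prefixing.pull_push[OF pl q Dl] req by simp
  ultimately show "R l \<in> r \<and> R n \<in> pulll l r" using prefixing.R_mem_push[OF pn s Dn] by simp
qed

text \<open>The set of all \<open>l\<close> with \<open>R l \<in> p\<close> is the infinite path over which the atom \<open>p\<close> sits.\<close>

definition same_path :: "'x set set \<Rightarrow> 'x set set \<Rightarrow> bool" where
  "same_path p q \<longleftrightarrow> (\<forall>l\<in>arr G. R l \<in> p \<longleftrightarrow> R l \<in> q)"

lemma same_path_sym: "same_path p q \<Longrightarrow> same_path q p"
  and same_path_trans: "same_path p q \<Longrightarrow> same_path q r \<Longrightarrow> same_path p r"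
  and same_path_refl: "same_path p p"
  by (auto simp: same_path_def)

lemma zero_Nk: "(\<lambda>_. 0) \<in> Nk k"
  by (simp add: Nk_def)

lemma same_path_empty: "p \<in> insert {} (atoms M) \<Longrightarrow> same_path p {} \<Longrightarrow> p = {}"
  using R_cover[OF _ zero_Nk, of p] unfolding same_path_def by blast

text \<open>By \<open>R_cmp_iff\<close> the path after deleting \<open>l\<close> is determined by
  the path before.\<close>

lemma same_path_pulll:
  assumes "p \<in> insert {} (atoms M)" "q \<in> insert {} (atoms M)" "same_path p q" and l: "l \<in> arr G"
  shows "same_path (pulll l p) (pulll l q)"
proof (cases "p = {} \<or> q = {}")
  case True
  then have "p = {} \<and> q = {}" using assms same_path_empty same_path_sym by blast
  then show ?thesis by (simp add: same_path_refl)
next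
  case False
  then have p: "p \<in> atoms M" and q: "q \<in> atoms M" using assms by auto
  show ?thesis
  proof (cases "R l \<in> p")
    case True
    then have Rq: "R l \<in> q" using assms by (simp add: same_path_def)
    show ?thesis unfolding same_path_def
    proof
      fix n assume n: "n \<in> arr G"
      have "src G l = rng G n \<Longrightarrow> R (cmp G l n) \<in> p \<longleftrightarrow> R (cmp G l n) \<in> q"
        using assms(3) cmp_arr[OF l n] by (simp add: same_path_def)
      then show "R n \<in> pulll l p \<longleftrightarrow> R n \<in> pulll l q"
        using R_cmp_iff[OF p l n] R_cmp_iff[OF q l n] True Rq by blast
    qed
  next
    case False
    then have "R l \<notin> q" using assms by (simp add: same_path_def)
    then have "pulll l p = {}" "pulll l q = {}"
      using False prefixing.pull_nonempty_iff[OF pre[OF l]] p q by blast+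
    then show ?thesis by (simp add: same_path_refl)
  qed
qed

text \<open>A path of degree \<open>deg G n\<close> over the prefixed atom is found inside
  \<open>l\<close> followed by a long enough piece \<open>a\<close> of the original path. As
  \<open>a\<close> is common to \<open>p\<close> and \<open>q\<close>, so is this initial
  segment.\<close>

lemma R_pushl_transfer:
  assumes p: "p \<in> atoms M" and q: "q \<in> atoms M" and sp: "same_path p q"
    and l: "l \<in> arr G" and Dp: "D l \<in> p" and Dq: "D l \<in> q" and n: "n \<in> arr G" and Rn: "R n \<in> pushl l p"
  shows "R n \<in> pushl l q"
proof -
  note pl = pre[OF l]
  \<comment> \<open>Truncated subtraction: \<open>n\<close> and \<open>l\<close> may be incomparable
    in degree, and the composite of \<open>l\<close> with a path of degree \<open>?d\<close> has the
    coordinatewise maximum of the two degrees.\<close>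
  let ?d = "\<lambda>i. deg G n i - deg G l i"
  have "?d \<in> Nk k" using deg_Nk[OF n] by (simp add: Nk_def)
  then obtain a where a: "a \<in> arr G" "deg G a = ?d" "R a \<in> p" by (rule R_cover[OF p])
  then have aq: "R a \<in> q" using sp by (simp add: same_path_def)
  have la: "src G l = rng G a" by (rule vertex_match[OF p l a(1) Dp a(3)])
  have Rla: "R (cmp G l a) \<in> pushl l r" if r: "r \<in> atoms M" "D l \<in> r" "R a \<in> r" for r
    using R_cmp_iff[OF prefixing.push_atom[OF pl r(1,2)] l a(1)]
      prefixing.pull_push[OF pl r(1,2)] prefixing.R_mem_push[OF pl r(1,2)] r(3) by simp
  have dla: "deg G (cmp G l a) i = deg G n i + (deg G l i - deg G n i)" for i
    by (simp add: deg_cmp[OF l a(1) la] a(2))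
  obtain b g where bg: "b \<in> arr G" "g \<in> arr G" "src G b = rng G g" "deg G b = deg G n" "cmp G b g = cmp G l a"
    by (rule factorization[OF cmp_arr[OF l a(1) la] dla]) (rule that)
  have Rb: "R b \<in> pushl l r" if r: "r \<in> atoms M" "D l \<in> r" "R a \<in> r" for r
    using R_cmp_iff[OF prefixing.push_atom[OF pl r(1,2)] bg(1,2)] Rla[OF r] bg by simp
  have "b = n"
    by (rule R_unique[OF prefixing.push_atom[OF pl p Dp] bg(1) n bg(4) Rb[OF p Dp a(3)] Rn])
  then show ?thesis using Rb[OF q Dq aq] by simp
qed

lemma same_path_pushl:
  assumes "p \<in> insert {} (atoms M)" "q \<in> insert {} (atoms M)" "same_path p q" and l: "l \<in> arr G"
  shows "same_path (pushl l p) (pushl l q)"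
proof (cases "p = {} \<or> q = {}")
  case True
  then have "p = {} \<and> q = {}" using assms same_path_empty same_path_sym by blast
  then show ?thesis by (simp add: same_path_refl)
next
  case False
  then have p: "p \<in> atoms M" and q: "q \<in> atoms M" using assms by auto
  have iff: "D l \<in> p \<longleftrightarrow> D l \<in> q"
    using assms(3) D_mem_iff[OF p l] D_mem_iff[OF q l] src_arr[OF l] by (simp add: same_path_def)
  show ?thesis
  proof (cases "D l \<in> p")
    case True
    then show ?thesis
      using R_pushl_transfer[OF p q assms(3) l] R_pushl_transfer[OF q p same_path_sym[OF assms(3)] l] iff
      unfolding same_path_def by blast
  next
    case False
    then have "pushl l p = {}" "pushl l q = {}"
      using iff prefixing.push_nonempty_iff[OF pre[OF l]] p q by blast+
    then show ?thesis by (simp add: same_path_refl)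
  qed
qed

section \<open>Shifts by a degree on atoms\<close>

text \<open>The image filter under \<open>cod m\<close>, without reference to a path. It agrees with
  \<open>pulll l\<close> where the latter is nonempty, and unlike \<open>pulll\<close> it obeys an
  additive and thus commutative law in the degree.\<close>

definition codpush :: "(nat \<Rightarrow> nat) \<Rightarrow> 'x set set \<Rightarrow> 'x set set" where
  "codpush m p = {E \<in> sets M. cod m -` E \<inter> space M \<in> p}"

lemma codpush_add:
  assumes m: "m \<in> Nk k" and n: "n \<in> Nk k"
  shows "codpush m (codpush n p) = codpush (\<lambda>i. m i + n i) p"
proof -
  have "cod m \<circ> cod n = cod (\<lambda>i. m i + n i)"
    using sb m n unfolding lambda_sbfs_def by blast
  then have "cod n -` (cod m -` E \<inter> space M) \<inter> space M = cod (\<lambda>i. m i + n i) -` E \<inter> space M" for E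
    using measurable_space[OF cod_measurable[OF n]] by (auto simp: fun_eq_iff)
  moreover have "E \<in> sets M \<Longrightarrow> cod m -` E \<inter> space M \<in> sets M" for E
    using cod_measurable[OF m] by (rule measurable_sets)
  ultimately show ?thesis by (auto simp: codpush_def)
qed

lemma pulll_codpush: "p \<in> atoms M \<Longrightarrow> l \<in> arr G \<Longrightarrow> R l \<in> p \<Longrightarrow> pulll l p = codpush (deg G l) p"
  unfolding codpush_def by (rule prefixing.pull_eq[OF pre])

text \<open>Atoms over one path have the same initial segment \<open>l\<close> of degree
  \<open>m\<close>, and prefixing \<open>l\<close> undoes the shift.\<close>

lemma codpush_inj:
  assumes p: "p \<in> atoms M" and q: "q \<in> atoms M" and sp: "same_path p q" and m: "m \<in> Nk k"
    and eq: "codpush m p = codpush m q"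
  shows "p = q"
proof -
  obtain l where l: "l \<in> arr G" "deg G l = m" "R l \<in> p" by (rule R_cover[OF p m])
  then have Rq: "R l \<in> q" using sp by (simp add: same_path_def)
  have eq': "pulll l p = pulll l q"
  proof -
    have "pulll l p = codpush (deg G l) p" by (rule pulll_codpush[OF p l(1,3)])
    also have "\<dots> = codpush (deg G l) q" unfolding l(2) by (rule eq)
    also have "\<dots> = pulll l q" by (rule pulll_codpush[OF q l(1) Rq, symmetric])
    finally show ?thesis .
  qed
  have "p = pushl l (pulll l p)" by (rule prefixing.push_pull[OF pre[OF l(1)] p l(3), symmetric])
  also have "\<dots> = q" unfolding eq' by (rule prefixing.push_pull[OF pre[OF l(1)] q Rq])
  finally show ?thesis .
qed

section \<open>Words acting on atoms\<close>

text \<open>This is the action on coordinates, so it is dual to \<open>letter_op\<close>: the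
  coordinate of \<open>t l f\<close> at \<open>q\<close> is that of \<open>f\<close> at
  \<open>pulll l q\<close>. The generator thus acts by \<open>pulll\<close> and its adjoint by
  \<open>pushl\<close>.\<close>

definition letter_act :: "bool \<times> 'a \<Rightarrow> 'x set set \<Rightarrow> 'x set set" where
  "letter_act = (\<lambda>(b, l). if b then pulll l else pushl l)"

text \<open>\<open>fold\<close> against the \<open>foldr\<close> in \<open>word_op\<close>: passing
  to coordinates reverses the order of composition.\<close>

definition act :: "(bool \<times> 'a) list \<Rightarrow> 'x set set \<Rightarrow> 'x set set" where
  "act ws = fold letter_act ws"

definition inverse_word :: "(bool \<times> 'a) list \<Rightarrow> (bool \<times> 'a) list" where
  "inverse_word ws = rev (map (\<lambda>(b, l). (\<not> b, l)) ws)"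

abbreviation words where "words \<equiv> lists ((UNIV :: bool set) \<times> arr G)"

lemma act_Nil [simp]: "act [] p = p" and act_Cons [simp]: "act (x # ws) p = act ws (letter_act x p)"
  and act_append: "act (ws @ vs) p = act vs (act ws p)"
  by (simp_all add: act_def)

lemma letter_act_closed:
  assumes p: "p \<in> insert {} (atoms M)" and x: "x \<in> UNIV \<times> arr G"
  shows "letter_act x p \<in> insert {} (atoms M)"
proof -
  obtain b l where xl: "x = (b, l)" "l \<in> arr G" using x by auto
  note pl = pre[OF xl(2)]
  have "pulll l p \<in> insert {} (atoms M)" "pushl l p \<in> insert {} (atoms M)"
    using p prefixing.pull_atom[OF pl, of p] prefixing.push_atom[OF pl, of p]
      prefixing.pull_nonempty_iff[OF pl, of p] prefixing.push_nonempty_iff[OF pl, of p]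
      prefixing.pull_empty[OF pl] prefixing.push_empty[OF pl] by auto
  then show ?thesis by (simp add: letter_act_def xl)
qed

lemma letter_act_inverse:
  assumes p: "p \<in> atoms M" and x: "(b, l) \<in> UNIV \<times> arr G" and ne: "letter_act (b, l) p \<noteq> {}"
  shows "letter_act (\<not> b, l) (letter_act (b, l) p) = p"
proof -
  have l: "l \<in> arr G" using x by auto
  note pl = pre[OF l]
  show ?thesis
    using ne prefixing.pull_nonempty_iff[OF pl p] prefixing.push_nonempty_iff[OF pl p]
      prefixing.push_pull[OF pl p] prefixing.pull_push[OF pl p]
    by (cases b) (auto simp: letter_act_def)
qed

lemma letter_act_same_path:
  assumes "p \<in> insert {} (atoms M)" "q \<in> insert {} (atoms M)" "same_path p q" "x \<in> UNIV \<times> arr G"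
  shows "same_path (letter_act x p) (letter_act x q)"
  using assms same_path_pulll same_path_pushl by (cases x) (auto simp: letter_act_def)

lemma letter_act_empty: "x \<in> UNIV \<times> arr G \<Longrightarrow> letter_act x {} = {}"
  using prefixing.pull_empty[OF pre] prefixing.push_empty[OF pre]
  by (cases x; cases "fst x") (simp_all add: letter_act_def)

lemma act_empty: "ws \<in> words \<Longrightarrow> act ws {} = {}"
  by (induction ws) (auto simp: letter_act_empty)

lemma act_closed: "ws \<in> words \<Longrightarrow> p \<in> insert {} (atoms M) \<Longrightarrow> act ws p \<in> insert {} (atoms M)"
proof (induction ws arbitrary: p rule: list.induct)
  case (Cons x ws)
  have x: "x \<in> UNIV \<times> arr G" and ws: "ws \<in> words" using Cons.prems by simp_all
  show ?case
    unfolding act_Cons by (rule Cons.IH[OF ws letter_act_closed[OF Cons.prems(2) x]])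
qed simp

lemma act_same_path:
  assumes "ws \<in> words" "p \<in> insert {} (atoms M)" "q \<in> insert {} (atoms M)" "same_path p q"
  shows "same_path (act ws p) (act ws q)"
  using assms
proof (induction ws arbitrary: p q rule: list.induct)
  case (Cons x ws)
  have x: "x \<in> UNIV \<times> arr G" and ws: "ws \<in> words" using Cons.prems by simp_all
  note pq = Cons.prems(2-4)
  show ?case
    unfolding act_Cons
    by (rule Cons.IH[OF ws letter_act_closed[OF pq(1) x] letter_act_closed[OF pq(2) x]
          letter_act_same_path[OF pq x]])
qed simp

lemma inverse_word_words: "ws \<in> words \<Longrightarrow> inverse_word ws \<in> words"
  by (auto simp: inverse_word_def in_lists_conv_set)

lemma act_inverse_word:
  assumes "ws \<in> words" "p \<in> atoms M" "act ws p \<noteq> {}"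
  shows "act (inverse_word ws) (act ws p) = p"
  using assms
proof (induction ws arbitrary: p rule: list.induct)
  case (Cons x ws)
  obtain b l where x: "x = (b, l)" by (cases x)
  have xA: "x \<in> UNIV \<times> arr G" and ws: "ws \<in> words" using Cons.prems by simp_all
  have ne: "letter_act x p \<noteq> {}" using Cons.prems(3) act_empty[OF ws] by auto
  then have "letter_act x p \<in> atoms M" using letter_act_closed[OF _ xA, of p] Cons.prems(2) by auto
  then have "act (inverse_word ws) (act ws (letter_act x p)) = letter_act x p"
    using Cons.IH[OF ws] Cons.prems(3) by simp
  moreover have "inverse_word (x # ws) = inverse_word ws @ [(\<not> b, l)]"
    by (simp add: inverse_word_def x)
  ultimately show ?case
    using letter_act_inverse[OF Cons.prems(2), of b l] xA ne by (simp add: act_append x)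
qed (simp add: inverse_word_def)

lemma act_inj:
  assumes "ws \<in> words" "p \<in> atoms M" "q \<in> atoms M" "act ws p \<noteq> {}" "act ws p = act ws q"
  shows "p = q"
  using act_inverse_word[OF assms(1,2)] act_inverse_word[OF assms(1,3)] assms by metis

text \<open>Deleting a prefix adds its degree to \<open>n\<close>, adding a prefix adds its degree
  to \<open>m\<close>. So up to a shift the effect of a word is known from degrees alone, uniformly
  over the atoms that it does not kill.\<close>

lemma act_degrees:
  assumes "ws \<in> words"
  shows "\<exists>m\<in>Nk k. \<exists>n\<in>Nk k. \<forall>p\<in>atoms M. act ws p \<noteq> {} \<longrightarrow> codpush m (act ws p) = codpush n p"
  using assms
proof (induction ws rule: list.induct)
  case Nil
  then show ?case using zero_Nk by auto
next
  case (Cons x ws)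
  obtain b l where x: "x = (b, l)" by (cases x)
  have xA: "x \<in> UNIV \<times> arr G" and l: "l \<in> arr G" and ws: "ws \<in> words" using Cons.prems x by simp_all
  note pl = pre[OF l] and dl = deg_Nk[OF l]
  obtain m n where m: "m \<in> Nk k" and n: "n \<in> Nk k"
    and mn: "\<And>p. p \<in> atoms M \<Longrightarrow> act ws p \<noteq> {} \<Longrightarrow> codpush m (act ws p) = codpush n p"
    using Cons.IH[OF ws] by blast
  have add: "(\<lambda>i. m i + n i) \<in> Nk k" if "m \<in> Nk k" "n \<in> Nk k" for m n
    using that by (simp add: Nk_def)
  have step: "letter_act x p \<in> atoms M" "letter_act x p \<noteq> {}"
    "codpush m (act ws (letter_act x p)) = codpush n (letter_act x p)"
    if p: "p \<in> atoms M" "act (x # ws) p \<noteq> {}" for p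
  proof -
    show ne: "letter_act x p \<noteq> {}" using p(2) act_empty[OF ws] by auto
    then show "letter_act x p \<in> atoms M" using letter_act_closed[OF _ xA, of p] p(1) by auto
    then show "codpush m (act ws (letter_act x p)) = codpush n (letter_act x p)"
      using mn p(2) by simp
  qed
  show ?case
  proof (cases b)
    case True
    have "codpush m (act (x # ws) p) = codpush (\<lambda>i. n i + deg G l i) p"
      if p: "p \<in> atoms M" "act (x # ws) p \<noteq> {}" for p
    proof -
      have la: "letter_act x p = pulll l p" by (simp add: letter_act_def x True)
      then have "letter_act x p = codpush (deg G l) p"
        using pulll_codpush[OF p(1) l] prefixing.pull_nonempty_iff[OF pl p(1)] step(2)[OF p] by simp
      then show ?thesis using step(3)[OF p] codpush_add[OF n dl] by simp
    qed
    then show ?thesis using m add[OF n dl] by blast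
  next
    case False
    have "codpush (\<lambda>i. deg G l i + m i) (act (x # ws) p) = codpush n p"
      if p: "p \<in> atoms M" "act (x # ws) p \<noteq> {}" for p
    proof -
      let ?q = "letter_act x p"
      have la: "?q = pushl l p" by (simp add: letter_act_def x False)
      then have Dp: "D l \<in> p" using prefixing.push_nonempty_iff[OF pl p(1)] step(2)[OF p] by simp
      have "codpush (deg G l) ?q = p"
        using pulll_codpush[OF step(1)[OF p] l] prefixing.R_mem_push[OF pl p(1) Dp]
          prefixing.pull_push[OF pl p(1) Dp] la by simp
      moreover have "codpush (\<lambda>i. deg G l i + m i) (act (x # ws) p) = codpush (deg G l) (codpush n ?q)"
        by (simp only: act_Cons codpush_add[OF dl m, symmetric] step(3)[OF p])
      moreover have "codpush (deg G l) (codpush n ?q) = codpush n (codpush (deg G l) ?q)"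
        by (simp add: codpush_add[OF dl n] codpush_add[OF n dl] add.commute)
      ultimately show ?thesis by simp
    qed
    then show ?thesis using n add[OF dl m] by blast
  qed
qed

text \<open>Both composites have the same image under a common shift, and shifts are injective on the
  atoms over one path.\<close>

lemma act_commute:
  assumes ws: "ws \<in> words" and vs: "vs \<in> words" and r: "r \<in> atoms M"
    and sw: "same_path (act ws r) r" and sv: "same_path (act vs r) r"
  shows "act ws (act vs r) = act vs (act ws r)"
proof -
  \<comment> \<open>An atom always has a path of degree 0, so lying over the path of an atom
    excludes the empty family.\<close>
  have ne: "act us p \<noteq> {}" "act us p \<in> atoms M"
    if "us \<in> words" "p \<in> atoms M" "same_path (act us p) q" "q \<in> atoms M" for us p q
  proof -
    show "act us p \<noteq> {}"
      using same_path_empty[of q] same_path_sym that(3,4) atom_nonempty by fastforce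
    then show "act us p \<in> atoms M" using act_closed[OF that(1), of p] that(2) by auto
  qed
  note w = ne[OF ws r sw r] and v = ne[OF vs r sv r]
  have swv: "same_path (act ws (act vs r)) r"
    using act_same_path[OF ws _ _ sv] v r sw same_path_trans by blast
  have svw: "same_path (act vs (act ws r)) r"
    using act_same_path[OF vs _ _ sw] w r sv same_path_trans by blast
  note wv = ne[OF ws v(2) swv r] and vw = ne[OF vs w(2) svw r]
  obtain m n where m: "m \<in> Nk k" and n: "n \<in> Nk k"
    and mn: "\<And>p. p \<in> atoms M \<Longrightarrow> act ws p \<noteq> {} \<Longrightarrow> codpush m (act ws p) = codpush n p"
    using act_degrees[OF ws] by blast
  obtain m' n' where m': "m' \<in> Nk k" and n': "n' \<in> Nk k"
    and mn': "\<And>p. p \<in> atoms M \<Longrightarrow> act vs p \<noteq> {} \<Longrightarrow> codpush m' (act vs p) = codpush n' p"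
    using act_degrees[OF vs] by blast
  have comm: "codpush a (codpush b p) = codpush b (codpush a p)" if "a \<in> Nk k" "b \<in> Nk k" for a b p
    by (simp add: codpush_add that add.commute)
  have "codpush m' (codpush m (act ws (act vs r))) = codpush n (codpush n' r)"
    by (simp only: mn[OF v(2) wv(1)] comm[OF m' n] mn'[OF r v(1)])
  moreover have "codpush m' (codpush m (act vs (act ws r))) = codpush n (codpush n' r)"
    by (simp only: comm[OF m' m] mn'[OF w(2) vw(1)] mn[OF r w(1)] comm[OF m n'] comm[OF n n'])
  ultimately have "codpush (\<lambda>i. m' i + m i) (act ws (act vs r)) = codpush (\<lambda>i. m' i + m i) (act vs (act ws r))"
    by (simp add: codpush_add m m')
  moreover have "(\<lambda>i. m' i + m i) \<in> Nk k" using m m' by (simp add: Nk_def)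
  ultimately show ?thesis
    using codpush_inj[OF wv(2) vw(2)] swv svw same_path_sym same_path_trans by blast
qed

end

subsection \<open>Rigidity of the orbit of an atom\<close>

text \<open>Negative indices iterate the inverse bijection. One coincidence \<open>P i = P j\<close>
  propagates forwards by applying \<open>W\<close> and backwards by its injectivity, so the whole
  sequence has period \<open>j - i\<close>.\<close>

lemma bij_betw_int_orbit:
  assumes W: "bij_betw W X X" and p: "p \<in> X"
  obtains P :: "int \<Rightarrow> 'b" where "P 0 = p" "\<And>j. P j \<in> X" "\<And>j. P (j + 1) = W (P j)"
    "inj P \<or> finite (range P)"
proof -
  define V where "V = inv_into X W"
  have V: "bij_betw V X X" using W unfolding V_def by (rule bij_betw_inv_into)
  have WV: "W (V x) = x" if "x \<in> X" for x
    using that W unfolding V_def by (simp add: bij_betw_inv_into_right)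
  define P where "P j = (if 0 \<le> j then (W ^^ nat j) p else (V ^^ nat (- j)) p)" for j
  have Wp: "(W ^^ n) p \<in> X" and Vp: "(V ^^ n) p \<in> X" for n
    using bij_betw_apply[OF bij_betw_funpow[OF W] p] bij_betw_apply[OF bij_betw_funpow[OF V] p] by auto
  have P0: "P 0 = p" and PX: "P j \<in> X" for j
    using Wp Vp by (auto simp: P_def)
  have PW: "P (j + 1) = W (P j)" for j
  proof (cases "0 \<le> j")
    case True
    then have "nat (j + 1) = Suc (nat j)" by simp
    then show ?thesis using True by (simp add: P_def)
  next
    case False
    then obtain n where n: "- j = int n + 1" by (metis add.commute not_le zero_less_imp_eq_int neg_0_less_iff_less of_nat_Suc gr0_conv_Suc)
    then have nj: "nat (- j) = Suc n" by simp
    have PV: "P (j + 1) = (V ^^ n) p"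
    proof (cases "n = 0")
      case True then show ?thesis using n by (simp add: P_def)
    next
      case False
      then have "\<not> 0 \<le> j + 1" "nat (- (j + 1)) = n" using n by auto
      then show ?thesis by (simp add: P_def)
    qed
    have "P j = V ((V ^^ n) p)" using False nj by (simp add: P_def)
    then show ?thesis using WV[OF Vp] PV by simp
  qed
  have "finite (range P)" if "\<not> inj P"
  proof -
    obtain i j where ij: "i < j" "P i = P j"
      using \<open>\<not> inj P\<close> unfolding inj_def by (metis linorder_less_linear)
    define d where "d = j - i"
    have d: "d > 0" using ij by (simp add: d_def)
    have per: "P (n + d) = P n" for n
    proof (induction n rule: int_induct[of _ i])
      case base then show ?case using ij by (simp add: d_def)
    next
      case (step1 n)
      then show ?case using PW[of n] PW[of "n + d"] by (simp add: algebra_simps)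
    next
      case (step2 n)
      have "W (P (n - 1 + d)) = W (P (n - 1))"
        using PW[of "n - 1 + d"] PW[of "n - 1"] step2 by (simp add: algebra_simps)
      then show ?case using W PX by (auto simp: bij_betw_def inj_on_def)
    qed
    have perk: "P (n + d * int m) = P n" for n m
    proof (induction m)
      case (Suc m)
      have "P (n + d * int (Suc m)) = P (n + d * int m + d)" by (simp add: algebra_simps)
      then show ?case using Suc per by simp
    qed simp
    have "P n \<in> P ` {0..<d}" for n
    proof -
      have "P n = P (n mod d)"
      proof (cases "n div d \<ge> 0")
        case True
        then show ?thesis using perk[of "n mod d" "nat (n div d)"] by simp
      next
        case False
        then have "n + d * int (nat (- (n div d))) = n mod d"
          by (simp add: minus_div_mult_eq_mod[symmetric] algebra_simps)
        then show ?thesis using perk[of n "nat (- (n div d))"] by simp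
      qed
      then show ?thesis using d by auto
    qed
    then have "range P \<subseteq> P ` {0..<d}" by blast
    then show ?thesis by (rule finite_subset) simp
  qed
  then show thesis using that[OF P0 PX PW] by blast
qed

locale irreducible_atomic = lambda_system k G M D tau Phi cod
  for k :: nat and G :: "'a kgraph" and M :: "'x measure"
    and D :: "'a \<Rightarrow> 'x set" and tau :: "'a \<Rightarrow> 'x \<Rightarrow> 'x"
    and Phi :: "'a \<Rightarrow> 'x \<Rightarrow> real" and cod :: "(nat \<Rightarrow> nat) \<Rightarrow> 'x \<Rightarrow> 'x" +
  fixes p0 :: "'x set set"
  assumes irr: "irreducible_rep M (arr G) (sbfs_op G D tau Phi cod)"
    and p0: "p0 \<in> atoms M"
begin

abbreviation word where "word \<equiv> word_op M t"

section \<open>Generators in coordinates\<close>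

lemma t_L2: "l \<in> arr G \<Longrightarrow> f \<in> L2 M \<Longrightarrow> t l f \<in> L2 M"
  using prefixing.T_L2[OF pre] by (simp add: t_eq)

lemma t_adjoint: "l \<in> arr G \<Longrightarrow> is_adjoint M (t l) (prefixing.S (D l) (tau l) (Phi l))"
  using prefixing.is_adjoint_T_S[OF pre] by (simp add: t_eq)

lemma adj_t_L2: "l \<in> arr G \<Longrightarrow> f \<in> L2 M \<Longrightarrow> adj M (t l) f \<in> L2 M"
  using is_adjoint_adj[OF t_adjoint] by (simp add: is_adjoint_def)

lemma letter_L2: "x \<in> UNIV \<times> arr G \<Longrightarrow> f \<in> L2 M \<Longrightarrow> letter_op M t x f \<in> L2 M"
  using t_L2 adj_t_L2 by (auto simp: letter_op_def)

lemma word_L2: "ws \<in> words \<Longrightarrow> f \<in> L2 M \<Longrightarrow> word ws f \<in> L2 M"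
  by (induction ws rule: list.induct) (simp_all add: word_op_def letter_L2)

text \<open>The operator is moved to the atom vector, where its adjoint is the map of atoms found
  for a single prefixing map. Since \<open>adj\<close> is a choice, inner products rather than
  pointwise formulas are compared.\<close>

lemma coord_letter:
  assumes x: "x \<in> UNIV \<times> arr G" and f: "f \<in> L2 M" and q: "q \<in> insert {} (atoms M)"
  shows "coord M (letter_op M t x f) q = coord M f (letter_act x q)"
proof -
  obtain b l where xl: "x = (b, l)" and l: "l \<in> arr G" using x by auto
  note pl = pre[OF l] and e = atom_vec_L2[of M]
  show ?thesis
  proof (cases b)
    case True
    have "coord M (t l f) q = l2inner M f (prefixing.S (D l) (tau l) (Phi l) (atom_vec M q))"
      using t_adjoint[OF l] f e unfolding coord_def is_adjoint_def by blast
    also have "\<dots> = coord M f (pulll l q)"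
      unfolding coord_def
      by (rule l2inner_cong_AE[OF f f prefixing.S_L2[OF pl e] e _ prefixing.S_atom_vec[OF pl q]]) simp
    finally show ?thesis by (simp add: xl True letter_op_def letter_act_def)
  next
    case False
    have "l2inner M (t l (atom_vec M q)) f = l2inner M (atom_vec M q) (adj M (t l) f)"
      using is_adjoint_adj[OF t_adjoint[OF l]] f e unfolding is_adjoint_def by blast
    then have "coord M (adj M (t l) f) q = l2inner M f (t l (atom_vec M q))"
      unfolding coord_def by (metis l2inner_cnj)
    also have "\<dots> = coord M f (pushl l q)"
      unfolding coord_def
    proof (rule l2inner_cong_AE[OF f f t_L2[OF l e] e])
      show "AE x in M. t l (atom_vec M q) x = atom_vec M (pushl l q) x"
        unfolding t_eq[OF l] by (rule prefixing.T_atom_vec[OF pl q])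
    qed simp
    finally show ?thesis by (simp add: xl False letter_op_def letter_act_def)
  qed
qed

lemma coord_word:
  assumes "ws \<in> words" and f: "f \<in> L2 M" and "q \<in> insert {} (atoms M)"
  shows "coord M (word ws f) q = coord M f (act ws q)"
  using assms(1,3)
proof (induction ws arbitrary: q rule: list.induct)
  case Nil
  then show ?case by (simp add: word_op_def)
next
  case (Cons x ws)
  have x: "x \<in> UNIV \<times> arr G" and ws: "ws \<in> words" using Cons.prems(1) by simp_all
  have "coord M (word (x # ws) f) q = coord M (letter_op M t x (word ws f)) q"
    by (simp add: word_op_def)
  also have "\<dots> = coord M (word ws f) (letter_act x q)"
    by (rule coord_letter[OF x word_L2[OF ws f] Cons.prems(2)])
  also have "\<dots> = coord M f (act ws (letter_act x q))"
    by (rule Cons.IH[OF ws letter_act_closed[OF Cons.prems(2) x]])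
  finally show ?case by simp
qed

lemma cyclic:
  assumes "f \<in> L2 M" "g \<in> L2 M" "\<And>ws. ws \<in> words \<Longrightarrow> l2inner M f (word ws g) = 0"
  shows "(AE x in M. f x = 0) \<or> (AE x in M. g x = 0)"
  by (rule irreducible_rep_cyclic[OF irr t_L2 t_adjoint assms])

lemma coord_null:
  assumes "f \<in> L2 M" "AE x in M. f x = 0" shows "coord M f q = 0"
proof -
  have "coord M f q = l2inner M (\<lambda>x. 0) (atom_vec M q)"
    unfolding coord_def
    by (rule l2inner_cong_AE[OF assms(1) L2_zero atom_vec_L2 atom_vec_L2 assms(2)]) simp
  then show ?thesis by (simp add: l2inner_def)
qed

section \<open>The orbit of an atom\<close>

text \<open>Intersecting with \<open>atoms M\<close> discards the empty family, the value of words
  that kill \<open>p0\<close>.\<close>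

definition orbit where "orbit = {act ws p0 | ws. ws \<in> words} \<inter> atoms M"

lemma orbit_atoms: "orbit \<subseteq> atoms M"
  by (simp add: orbit_def)

lemma orbit_countable: "countable orbit"
proof -
  have "countable ((\<lambda>ws. act ws p0) ` words)"
    by (intro countable_image countable_lists countable_SIGMA countable_arr) auto
  then show ?thesis by (rule countable_subset[rotated]) (auto simp: orbit_def)
qed

lemma orbit_act:
  assumes q: "q \<in> orbit" and ws: "ws \<in> words" shows "act ws q \<in> insert {} orbit"
proof -
  obtain vs where vs: "vs \<in> words" "q = act vs p0" using q by (auto simp: orbit_def)
  have "act ws q = act (vs @ ws) p0" by (simp add: act_append vs)
  moreover have "vs @ ws \<in> words" using vs ws by simp
  moreover have "act ws q \<in> insert {} (atoms M)"
    using act_closed[OF ws, of q] q orbit_atoms by blast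
  ultimately show ?thesis unfolding orbit_def by blast
qed

lemma p0_orbit: "p0 \<in> orbit"
proof -
  have "p0 = act [] p0" "[] \<in> words" by simp_all
  then show ?thesis using p0 unfolding orbit_def by blast
qed

lemma atom_vec_not_null:
  assumes "q \<in> atoms M" shows "\<not> (AE x in M. atom_vec M q x = 0)"
  using coord_null[OF atom_vec_L2, of q q] coord_atom_vec[OF assms, of q] by auto

text \<open>A function supported off the orbit has zero coordinates there. Hence every word applied
  to it has zero coordinate at \<open>p0\<close>, and the irreducibility criterion makes it
  null.\<close>

lemma orbit_cover: "AE x in M. \<exists>q\<in>orbit. x \<in> rep M q"
proof -
  define Z where "Z = space M - (\<Union>q\<in>orbit. rep M q)"
  have Z: "Z \<in> sets M"
    unfolding Z_def using orbit_countable orbit_atoms rep_sets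
    by (intro sets.Diff sets.top sets.countable_UN') auto
  have null: "AE x in M. x \<notin> Z \<inter> R l" if l: "l \<in> arr G" for l
  proof -
    \<comment> \<open>Cutting with \<open>R l\<close> makes the measure finite, so that the
      indicator lies in \<open>L2 M\<close>; countably many such pieces exhaust \<open>Z\<close> up
      to a null set.\<close>
    let ?g = "\<lambda>x. complex_of_real (indicator (Z \<inter> R l) x)"
    have ZR: "Z \<inter> R l \<in> sets M" using Z R_sets[OF l] by simp
    have "emeasure M (Z \<inter> R l) \<le> emeasure M (R l)" using R_sets[OF l] by (intro emeasure_mono) auto
    then have fin: "emeasure M (Z \<inter> R l) < \<infinity>"
      using prefixing.R_finite[OF pre[OF l]] by (rule order_le_less_trans)
    have g: "?g \<in> L2 M" by (rule L2_indicator[OF ZR fin])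
    have cg: "coord M ?g q = 0" if "q \<in> insert {} orbit" for q
    proof (cases "q \<in> orbit")
      case True
      then have q: "q \<in> atoms M" using orbit_atoms by blast
      have "AE x in M. x \<in> rep M q \<longrightarrow> ?g x = 0"
        by (rule AE_I2) (use True in \<open>auto simp: Z_def indicator_def\<close>)
      from coord_const[OF q this L2_measurable[OF g]] show ?thesis by simp
    next
      case False
      then show ?thesis using that atom_nonempty by (intro coord_zero) auto
    qed
    have "l2inner M (atom_vec M p0) (word ws ?g) = 0" if ws: "ws \<in> words" for ws
    proof -
      have "l2inner M (atom_vec M p0) (word ws ?g) = cnj (coord M (word ws ?g) p0)"
        by (simp add: coord_def l2inner_cnj)
      also have "\<dots> = cnj (coord M ?g (act ws p0))"
        using coord_word[OF ws g, of p0] p0 by simp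
      finally show ?thesis using cg[OF orbit_act[OF p0_orbit ws]] by simp
    qed
    from cyclic[OF atom_vec_L2 g this] have "AE x in M. ?g x = 0"
      using atom_vec_not_null[OF p0] by blast
    then show ?thesis by eventually_elim (auto simp: indicator_def split: if_splits)
  qed
  have "AE x in M. \<forall>l\<in>arr G. x \<notin> Z \<inter> R l"
    using null by (subst AE_ball_countable[OF countable_arr]) simp
  with R_cover_AE[OF zero_Nk] AE_space show ?thesis
    by eventually_elim (auto simp: Z_def)
qed

lemma orbit_parseval:
  assumes "f \<in> L2 M" "h \<in> L2 M"
  shows "((\<lambda>q. coord M f q * cnj (coord M h q)) has_sum l2inner M f h) orbit"
  by (rule parseval[OF orbit_countable orbit_atoms orbit_cover assms])

lemma orbit_norm:
  assumes "f \<in> L2 M"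
  shows "((\<lambda>q. (cmod (coord M f q))\<^sup>2) has_sum (l2norm M f)\<^sup>2) orbit"
proof -
  have "((\<lambda>q. complex_of_real ((cmod (coord M f q))\<^sup>2)) has_sum of_real ((l2norm M f)\<^sup>2)) orbit"
    using orbit_parseval[OF assms assms] by (simp only: l2inner_self complex_norm_square)
  then show ?thesis by (simp only: has_sum_of_real_iff)
qed

text \<open>The irreducibility criterion in coordinates: by Parseval the sum is the inner product of
  the vector with coordinates \<open>a\<close> and a word applied to the vector with coordinates
  \<open>b\<close>. The value 0 at the empty family accounts for killed atoms.\<close>

lemma correlation_nonzero:
  assumes a: "(\<lambda>q. (cmod (a q))\<^sup>2) summable_on orbit" and b: "(\<lambda>q. (cmod (b q))\<^sup>2) summable_on orbit"
    and b0: "b {} = 0"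
    and corr: "\<And>ws. ws \<in> words \<Longrightarrow> ((\<lambda>q. a q * cnj (b (act ws q))) has_sum 0) orbit"
  shows "(\<forall>q\<in>orbit. a q = 0) \<or> (\<forall>q\<in>orbit. b q = 0)"
proof -
  obtain f where f: "f \<in> L2 M" "\<And>q. q \<in> orbit \<Longrightarrow> coord M f q = a q"
    by (rule vector_with_coords[OF orbit_countable orbit_atoms a]) (rule that)
  obtain g where g: "g \<in> L2 M" "\<And>q. q \<in> orbit \<Longrightarrow> coord M g q = b q"
    by (rule vector_with_coords[OF orbit_countable orbit_atoms b]) (rule that)
  have "l2inner M f (word ws g) = 0" if ws: "ws \<in> words" for ws
  proof -
    have "coord M f q * cnj (coord M (word ws g) q) = a q * cnj (b (act ws q))" if q: "q \<in> orbit" for q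
    proof -
      have "coord M (word ws g) q = coord M g (act ws q)"
        using coord_word[OF ws g(1), of q] q orbit_atoms by blast
      also have "\<dots> = b (act ws q)"
        using orbit_act[OF q ws] g(2) b0 coord_zero[OF atom_nonempty] by auto
      finally show ?thesis using f(2)[OF q] by simp
    qed
    then have "((\<lambda>q. coord M f q * cnj (coord M (word ws g) q)) has_sum 0) orbit"
      using corr[OF ws] by (subst has_sum_cong) auto
    then show ?thesis
      using orbit_parseval[OF f(1) word_L2[OF ws g(1)]] has_sum_unique by blast
  qed
  from cyclic[OF f(1) g(1) this] show ?thesis
    using coord_null[OF f(1)] coord_null[OF g(1)] f(2) g(2) by metis
qed

text \<open>Two atom vectors are not null, so some word gives a nonzero inner product; this can
  happen only if the word takes one atom to the other.\<close>

lemma orbit_transitive: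
  assumes p: "p \<in> orbit" and q: "q \<in> orbit"
  obtains ws where "ws \<in> words" "act ws p = q"
proof -
  have pa: "p \<in> atoms M" "q \<in> atoms M" using p q orbit_atoms by auto
  obtain ws where ws: "ws \<in> words" "l2inner M (atom_vec M p) (word ws (atom_vec M q)) \<noteq> 0"
    using cyclic[OF atom_vec_L2 atom_vec_L2, of p q] atom_vec_not_null pa by blast
  have "l2inner M (atom_vec M p) (word ws (atom_vec M q)) = cnj (coord M (word ws (atom_vec M q)) p)"
    by (simp add: coord_def l2inner_cnj)
  also have "\<dots> = cnj (coord M (atom_vec M q) (act ws p))"
    using coord_word[OF ws(1) atom_vec_L2, of p] pa by simp
  finally have nz: "coord M (atom_vec M q) (act ws p) \<noteq> 0" using ws(2) by auto
  then have "act ws p \<in> atoms M" using coord_zero by blast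
  from coord_atom_vec[OF this, of q] nz have "act ws p = q" by (auto split: if_splits)
  then show thesis using ws(1) that by blast
qed

lemma inverse_word_twice: "inverse_word (inverse_word ws) = ws"
  by (simp add: inverse_word_def rev_map[symmetric] o_def case_prod_unfold)

lemma rigid:
  assumes p: "p \<in> orbit" and q: "q \<in> orbit" and sp: "same_path p q"
  shows "p = q"
proof (rule ccontr)
  assume pq: "p \<noteq> q"
  obtain ws where ws: "ws \<in> words" and Wp: "act ws p = q" by (rule orbit_transitive[OF p q])
  \<comment> \<open>The atoms of the orbit over the path of \<open>p\<close>. Since
    \<open>ws\<close> keeps one of them over this path, it keeps all of them there, and its inverse
    word shows that it permutes them.\<close>
  define X where "X = {r \<in> orbit. same_path r p}"
  have pX: "p \<in> X" using p by (simp add: X_def same_path_refl)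
  have Xo: "r \<in> orbit" "r \<in> atoms M" if "r \<in> X" for r
    using that orbit_atoms by (auto simp: X_def)
  have Xsp: "same_path r s" if "r \<in> X" "s \<in> X" for r s
    using that unfolding X_def by (blast intro: same_path_sym same_path_trans)
  have XI: "r \<in> X" if "r \<in> insert {} orbit" "same_path r s" "s \<in> X" for r s
  proof -
    have "r \<noteq> {}"
      using same_path_empty[of s] same_path_sym[OF that(2)] Xo[OF that(3)] atom_nonempty by fastforce
    then show ?thesis using that same_path_trans unfolding X_def by blast
  qed
  have qX: "q \<in> X" using q sp same_path_sym by (simp add: X_def)
  have WX: "act ws r \<in> X" if r: "r \<in> X" for r
  proof (rule XI[OF orbit_act[OF Xo(1)[OF r] ws] _ qX])
    show "same_path (act ws r) q"
      using act_same_path[OF ws _ _ Xsp[OF r pX]] Xo[OF r] Xo[OF pX] Wp by simp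
  qed
  have ne: "r \<noteq> {}" if "r \<in> X" for r using Xo[OF that] atom_nonempty by auto
  have Winj: "r = s" if "r \<in> X" "s \<in> X" "act ws r = act ws s" for r s
    using act_inj[OF ws] Xo that ne[OF WX] by metis
  have Wsurj: "s \<in> act ws ` X" if s: "s \<in> X" for s
  proof -
    note iw = inverse_word_words[OF ws]
    let ?r = "act (inverse_word ws) s"
    have "act (inverse_word ws) q = p"
      using act_inverse_word[OF ws Xo(2)[OF pX]] Wp ne[OF qX] by simp
    then have "same_path ?r p"
      using act_same_path[OF iw _ _ Xsp[OF s qX]] Xo[OF s] Xo[OF qX] by simp
    then have r: "?r \<in> X" by (rule XI[OF orbit_act[OF Xo(1)[OF s] iw] _ pX])
    have "act ws ?r = s"
      using act_inverse_word[OF iw Xo(2)[OF s] ne[OF r]] by (simp add: inverse_word_twice)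
    then show ?thesis using r by (metis imageI)
  qed
  have "bij_betw (act ws) X X"
    unfolding bij_betw_def inj_on_def using Winj WX Wsurj by blast
  then obtain P :: "int \<Rightarrow> 'x set set" where P: "P 0 = p" "\<And>j. P j \<in> X" "\<And>j. P (j + 1) = act ws (P j)"
      "inj P \<or> finite (range P)"
    by (rule bij_betw_int_orbit[OF _ pX]) (rule that)
  have Po: "range P \<subseteq> orbit" using P(2) Xo by blast
  have P1: "P 1 = q" using P(3)[of 0] P(1) Wp by simp
  \<comment> \<open>If a word sends even one point of the \<open>W\<close>-orbit back into it,
    commutation with \<open>W\<close> fixes the same displacement at every point.\<close>
  have shift: "(\<exists>m. \<forall>j. act vs (P j) = P (j + m)) \<or> (\<forall>j. act vs (P j) \<notin> range P)"
    if vs: "vs \<in> words" for vs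
  proof (cases "\<exists>i l. act vs (P i) = P l")
    case False
    then show ?thesis by blast
  next
    case True
    then obtain i l where il: "act vs (P i) = P l" by blast
    define m where "m = l - i"
    have "act vs (P j) = P (j + m)" for j
    proof (induction j rule: int_induct[of _ i])
      case base
      then show ?case using il by (simp add: m_def)
    next
      case (step1 j)
      have "act vs (P (j + 1)) = act vs (act ws (P j))" using P(3) by simp
      also have "\<dots> = act ws (act vs (P j))"
        by (rule act_commute[OF vs ws Xo(2)[OF P(2)]]) (use step1 P(2) WX Xsp in auto)
      also have "\<dots> = P (j + 1 + m)" using step1 P(3)[of "j + m"] by (simp add: algebra_simps)
      finally show ?case .
    next
      case (step2 j)
      let ?r = "P (j - 1)"
      have Wr: "act ws ?r = P j" using P(3)[of "j - 1"] by simp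
      have "same_path (act vs ?r) (P (j + m))"
        using act_same_path[OF vs _ _ Xsp[OF P(2) P(2)], of "j - 1" j] Xo(2)[OF P(2)] step2 by simp
      \<comment> \<open>Going backwards, it must first be known that \<open>vs\<close> keeps
        \<open>?r\<close> over the path, since \<open>act_commute\<close> requires this; then
        \<open>W\<close> is cancelled by injectivity.\<close>
      then have rX: "act vs ?r \<in> X"
        by (rule XI[OF orbit_act[OF Xo(1)[OF P(2)] vs] _ P(2)])
      have "act ws (act vs ?r) = act vs (act ws ?r)"
        by (rule act_commute[OF ws vs Xo(2)[OF P(2)]]) (use rX P(2) WX Xsp in auto)
      also have "\<dots> = P (j + m)" using Wr step2 by simp
      also have "\<dots> = act ws (P (j - 1 + m))" using P(3)[of "j - 1 + m"] by (simp add: algebra_simps)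
      finally show ?case by (rule Winj[OF rX P(2)])
    qed
    then show ?thesis by blast
  qed
  show False
  proof (cases "finite (range P)")
    case fin: True
    \<comment> \<open>A translating word permutes the finite orbit, so the sum of \<open>b\<close>
      along it stays 0, both \<open>p = P 0\<close> and \<open>q = P 1\<close> lying in the orbit.
      Any other word moves it away from the support of \<open>b\<close>.\<close>
    define a b :: "'x set set \<Rightarrow> complex" where
      "a r = (if r \<in> range P then 1 else 0)" and
      "b r = (if r = p then 1 else if r = q then -1 else 0)" for r
    have "(\<forall>r\<in>orbit. a r = 0) \<or> (\<forall>r\<in>orbit. b r = 0)"
    proof (rule correlation_nonzero)
      show "(\<lambda>r. (cmod (a r))\<^sup>2) summable_on orbit"
        by (rule has_sum_imp_summable[OF has_sum_finite_neutralI[OF fin Po _ refl]]) (simp add: a_def)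
      show "(\<lambda>r. (cmod (b r))\<^sup>2) summable_on orbit"
        by (rule has_sum_imp_summable[OF has_sum_finite_neutralI[of "{p, q}", OF _ _ _ refl]])
          (use p q in \<open>auto simp: b_def\<close>)
      show "b {} = 0" using ne pX qX by (auto simp: b_def)
      fix vs assume vs: "vs \<in> words"
      show "((\<lambda>r. a r * cnj (b (act vs r))) has_sum 0) orbit"
      proof (rule has_sum_finite_neutralI[OF fin Po])
        have "(\<Sum>r\<in>range P. cnj (b (act vs r))) = 0"
        proof (cases "\<exists>m. \<forall>j. act vs (P j) = P (j + m)")
          case True
          then obtain m where m: "\<And>j. act vs (P j) = P (j + m)" by blast
          have inj: "inj_on (act vs) (range P)"
          proof (rule inj_onI)
            fix x y assume "x \<in> range P" "y \<in> range P" "act vs x = act vs y"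
            then show "x = y"
              using act_inj[OF vs, of x y] Xo P(2) ne[OF P(2)] m by (metis rangeE)
          qed
          have sub: "act vs ` range P \<subseteq> range P" using m by auto
          have img: "act vs ` range P = range P"
            by (rule endo_inj_surj[OF fin sub inj])
          have "(\<Sum>r\<in>range P. cnj (b (act vs r))) = (\<Sum>r\<in>range P. cnj (b r))"
            using sum.reindex[OF inj, of "\<lambda>r. cnj (b r)"] img by simp
          also have "\<dots> = (\<Sum>r\<in>{p, q}. cnj (b r))"
            by (rule sum.mono_neutral_right[OF fin]) (use P(1) P1 in \<open>auto simp: b_def\<close>)
          also have "\<dots> = 0" using pq by (simp add: b_def)
          finally show ?thesis .
        next
          case False
          then have "act vs r \<notin> range P" if "r \<in> range P" for r using shift[OF vs] that by blast
          then have "b (act vs r) = 0" if "r \<in> range P" for r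
            using that P(1) P1 unfolding b_def by (metis rangeI)
          then show ?thesis by simp
        qed
        then show "0 = (\<Sum>r\<in>range P. a r * cnj (b (act vs r)))" by (simp add: a_def)
      qed (simp add: a_def)
    qed
    moreover have "a p \<noteq> 0" "b p \<noteq> 0" using P(1) by (auto simp: a_def b_def)
    ultimately show False using p by blast
  next
    case False
    then have inj: "inj P" using P(4) by blast
    obtain a b :: "int \<Rightarrow> complex"
      where ab: "(\<lambda>j. (cmod (a j))\<^sup>2) summable_on UNIV" "(\<lambda>j. (cmod (b j))\<^sup>2) summable_on UNIV"
        "\<exists>j. a j \<noteq> 0" "\<exists>j. b j \<noteq> 0"
        "\<And>m. ((\<lambda>j. a j * cnj (b (j + m))) has_sum 0) UNIV"
      by (rule orthogonal_translates) (rule that)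
    \<comment> \<open>Sequences on the integers are transported along the injective \<open>P\<close>
      and extended by zero; in particular they vanish at the empty family.\<close>
    define lift :: "(int \<Rightarrow> complex) \<Rightarrow> 'x set set \<Rightarrow> complex"
      where "lift c r = (if r \<in> range P then c (inv P r) else 0)" for c r
    have liftP: "lift c (P j) = c j" for c j by (simp add: lift_def inj)
    have bij: "bij_betw P UNIV (range P)" using inj by (simp add: bij_betw_def)
    have summ: "(\<lambda>r. (cmod (lift c r))\<^sup>2) summable_on orbit"
      if "(\<lambda>j. (cmod (c j))\<^sup>2) summable_on UNIV" for c
    proof -
      have "(\<lambda>r. (cmod (lift c r))\<^sup>2) summable_on range P"
        using that by (subst summable_on_reindex_bij_betw[OF bij, symmetric]) (simp add: liftP)
      then show ?thesis
        by (subst summable_on_cong_neutral[of "range P" orbit]) (use Po in \<open>auto simp: lift_def\<close>)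
    qed
    have "(\<forall>r\<in>orbit. lift a r = 0) \<or> (\<forall>r\<in>orbit. lift b r = 0)"
    proof (rule correlation_nonzero[OF summ[OF ab(1)] summ[OF ab(2)]])
      show "lift b {} = 0" using ne P(2) by (force simp: lift_def)
      fix vs assume vs: "vs \<in> words"
      have "((\<lambda>j. lift a (P j) * cnj (lift b (act vs (P j)))) has_sum 0) UNIV"
      proof (cases "\<exists>m. \<forall>j. act vs (P j) = P (j + m)")
        case True
        then obtain m where "\<And>j. act vs (P j) = P (j + m)" by blast
        then show ?thesis using ab(5)[of m] by (simp add: liftP)
      next
        case False
        then have "act vs (P j) \<notin> range P" for j using shift[OF vs] by blast
        then have "lift b (act vs (P j)) = 0" for j unfolding lift_def by (rule if_not_P)
        then show ?thesis by simp
      qed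
      then have "((\<lambda>r. lift a r * cnj (lift b (act vs r))) has_sum 0) (range P)"
        using has_sum_reindex_bij_betw[OF bij, of "\<lambda>r. lift a r * cnj (lift b (act vs r))"] by simp
      then show "((\<lambda>r. lift a r * cnj (lift b (act vs r))) has_sum 0) orbit"
        by (subst has_sum_cong_neutral[of "range P" orbit]) (use Po in \<open>auto simp: lift_def\<close>)
    qed
    then show False using ab(3,4) liftP Po by (metis rangeI subsetD)
  qed
qed

end

subsection \<open>Density\<close>

lemma summable_tail:
  fixes u :: "'b \<Rightarrow> real"
  assumes u: "u summable_on A" and e: "e > 0"
  obtains F where "finite F" "F \<subseteq> A" "infsum u (A - F) < e"
proof -
  obtain F where F: "finite F" "F \<subseteq> A" "dist (sum u F) (infsum u A) \<le> e / 2"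
    using has_sum_finite_approximation[OF has_sum_infsum[OF u], of "e / 2"] e by auto
  have "infsum u (A - F) = infsum u A - sum u F"
    using infsum_Diff[OF u summable_on_finite[OF F(1)] F(2)] F(1) by simp
  then have "infsum u (A - F) < e" using F(3) e unfolding dist_real_def by linarith
  then show thesis using that F by blast
qed

section \<open>Linear spans and approximation\<close>

lemma cspanI: "finite F \<Longrightarrow> F \<subseteq> S \<Longrightarrow> (\<lambda>x. \<Sum>f\<in>F. c f * f x) \<in> cspan S"
  unfolding cspan_def by (intro CollectI exI conjI) (assumption, assumption, rule refl)

lemma cspan_scale: "g \<in> cspan S \<Longrightarrow> (\<lambda>x. c * g x) \<in> cspan S"
proof -
  assume "g \<in> cspan S"
  then obtain F d where F: "finite F" "F \<subseteq> S" "g = (\<lambda>x. \<Sum>f\<in>F. d f * f x)"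
    by (auto simp: cspan_def)
  then have "(\<lambda>x. c * g x) = (\<lambda>x. \<Sum>f\<in>F. (c * d f) * f x)"
    by (simp add: sum_distrib_left mult.assoc)
  then show ?thesis using cspanI[OF F(1,2), of "\<lambda>f. c * d f"] by simp
qed

lemma cspan_add:
  assumes "g \<in> cspan S" "h \<in> cspan S" shows "(\<lambda>x. g x + h x) \<in> cspan S"
proof -
  obtain F c where F: "finite F" "F \<subseteq> S" "g = (\<lambda>x. \<Sum>f\<in>F. c f * f x)"
    using assms(1) by (auto simp: cspan_def)
  obtain F' d where F': "finite F'" "F' \<subseteq> S" "h = (\<lambda>x. \<Sum>f\<in>F'. d f * f x)"
    using assms(2) by (auto simp: cspan_def)
  let ?c = "\<lambda>f. (if f \<in> F then c f else 0) + (if f \<in> F' then d f else 0)"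
  have "g x + h x = (\<Sum>f\<in>F \<union> F'. ?c f * f x)" for x
  proof -
    have "(\<Sum>f\<in>F \<union> F'. (if f \<in> F then c f else 0) * f x) = g x"
      unfolding F(3) by (rule sum.mono_neutral_cong_right) (use F(1) F'(1) in auto)
    moreover have "(\<Sum>f\<in>F \<union> F'. (if f \<in> F' then d f else 0) * f x) = h x"
      unfolding F'(3) by (rule sum.mono_neutral_cong_right) (use F(1) F'(1) in auto)
    ultimately show ?thesis by (simp only: distrib_right sum.distrib)
  qed
  then have "(\<lambda>x. g x + h x) = (\<lambda>x. \<Sum>f\<in>F \<union> F'. ?c f * f x)" by (rule ext)
  moreover have "finite (F \<union> F')" "F \<union> F' \<subseteq> S" using F F' by auto
  ultimately show ?thesis using cspanI[of "F \<union> F'" S ?c] by (simp only:)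
qed

lemma cspan_base: "g \<in> S \<Longrightarrow> g \<in> cspan S"
  using cspanI[of "{g}" S "\<lambda>_. 1"] by simp

lemma cspan_zero: "(\<lambda>x. 0) \<in> cspan S"
  using cspanI[of "{}" S] by simp

lemma cspan_L2: "S \<subseteq> L2 M \<Longrightarrow> g \<in> cspan S \<Longrightarrow> g \<in> L2 M"
proof -
  assume S: "S \<subseteq> L2 M" and "g \<in> cspan S"
  then obtain F c where F: "finite F" "F \<subseteq> S" "g = (\<lambda>x. \<Sum>f\<in>F. c f * f x)"
    by (auto simp: cspan_def)
  from F(1,2) have "(\<lambda>x. \<Sum>f\<in>F. c f * f x) \<in> L2 M"
  proof (induction F)
    case empty
    show ?case by (simp add: L2_zero)
  next
    case (insert f F)
    then have "(\<lambda>x. c f * f x + (\<Sum>f\<in>F. c f * f x)) \<in> L2 M"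
      using S by (intro L2_add L2_scale) auto
    then show ?case using insert.hyps by simp
  qed
  then show ?thesis using F(3) by simp
qed

definition approximable :: "'x measure \<Rightarrow> ('x \<Rightarrow> complex) set \<Rightarrow> ('x \<Rightarrow> complex) \<Rightarrow> bool" where
  "approximable M S g \<longleftrightarrow> g \<in> L2 M \<and> (\<forall>e>0. \<exists>h\<in>cspan S. l2norm M (\<lambda>x. g x - h x) < e)"

lemma approximable_add:
  assumes S: "S \<subseteq> L2 M" and g: "approximable M S g" and h: "approximable M S h"
  shows "approximable M S (\<lambda>x. g x + h x)"
  unfolding approximable_def
proof (intro conjI allI impI)
  have L: "g \<in> L2 M" "h \<in> L2 M" using g h by (auto simp: approximable_def)
  show "(\<lambda>x. g x + h x) \<in> L2 M" using L by (rule L2_add)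
  fix e :: real assume e: "e > 0"
  have "e / 2 > 0" using e by simp
  obtain g' where g': "g' \<in> cspan S" "l2norm M (\<lambda>x. g x - g' x) < e / 2"
    using g \<open>e / 2 > 0\<close> unfolding approximable_def by blast
  obtain h' where h': "h' \<in> cspan S" "l2norm M (\<lambda>x. h x - h' x) < e / 2"
    using h \<open>e / 2 > 0\<close> unfolding approximable_def by blast
  note L' = cspan_L2[OF S g'(1)] cspan_L2[OF S h'(1)]
  have "l2norm M (\<lambda>x. (g x - g' x) + (h x - h' x)) \<le> l2norm M (\<lambda>x. g x - g' x) + l2norm M (\<lambda>x. h x - h' x)"
    by (intro l2norm_triangle L2_diff L L')
  also have "\<dots> < e" using g'(2) h'(2) by simp
  finally have "l2norm M (\<lambda>x. (g x + h x) - (g' x + h' x)) < e" by (simp add: algebra_simps)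
  then show "\<exists>k\<in>cspan S. l2norm M (\<lambda>x. (g x + h x) - k x) < e"
    by (rule bexI[OF _ cspan_add[OF g'(1) h'(1)]])
qed

lemma approximable_scale:
  assumes g: "approximable M S g"
  shows "approximable M S (\<lambda>x. c * g x)"
  unfolding approximable_def
proof (intro conjI allI impI)
  show "(\<lambda>x. c * g x) \<in> L2 M" using g by (auto simp: approximable_def intro: L2_scale)
  fix e :: real assume e: "e > 0"
  then have "e / (cmod c + 1) > 0" by (simp add: add_nonneg_pos)
  then obtain g' where g': "g' \<in> cspan S" "l2norm M (\<lambda>x. g x - g' x) < e / (cmod c + 1)"
    using g unfolding approximable_def by blast
  have "l2norm M (\<lambda>x. c * g x - c * g' x) = cmod c * l2norm M (\<lambda>x. g x - g' x)"
    by (simp add: l2norm_scale[symmetric] right_diff_distrib)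
  also have "\<dots> \<le> (cmod c + 1) * l2norm M (\<lambda>x. g x - g' x)"
    by (intro mult_right_mono l2norm_nonneg) simp
  also have "\<dots> < e" using g'(2)
    by (subst (asm) pos_less_divide_eq) (simp_all add: mult.commute add_nonneg_pos)
  finally show "\<exists>k\<in>cspan S. l2norm M (\<lambda>x. c * g x - k x) < e"
    by (rule bexI[OF _ cspan_scale[OF g'(1)]])
qed

lemma approximable_sum:
  assumes S: "S \<subseteq> L2 M" and "finite F" "\<And>q. q \<in> F \<Longrightarrow> approximable M S (g q)"
  shows "approximable M S (\<lambda>x. \<Sum>q\<in>F. g q x)"
  using assms(2,3)
proof (induction F)
  case empty
  have "\<exists>h\<in>cspan S. l2norm M (\<lambda>x. 0 - h x) < e" if "e > 0" for e
    using that by (intro bexI[OF _ cspan_zero]) (simp add: l2norm_def)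
  then show ?case by (simp add: approximable_def L2_zero)
next
  case (insert q F)
  then show ?case using approximable_add[OF S, of "g q"] by simp
qed

context irreducible_atomic
begin

section \<open>Separating atoms by range projections\<close>

lemma coord_diff:
  assumes "f \<in> L2 M" "g \<in> L2 M"
  shows "coord M (\<lambda>x. f x - g x) q = coord M f q - coord M g q"
  unfolding coord_def by (rule l2inner_diff_left[OF assms atom_vec_L2])

lemma coord_scale: "coord M (\<lambda>x. c * f x) q = c * coord M f q"
  unfolding coord_def by (rule l2inner_scale_left)

lemma L2_coord_sum:
  assumes "finite F" "\<And>p. p \<in> F \<Longrightarrow> g p \<in> L2 M"
  shows "(\<lambda>x. \<Sum>p\<in>F. g p x) \<in> L2 M \<and> coord M (\<lambda>x. \<Sum>p\<in>F. g p x) q = (\<Sum>p\<in>F. coord M (g p) q)"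
  using assms
proof (induction F)
  case empty
  then show ?case by (simp add: L2_zero coord_def l2inner_def)
next
  case (insert p F)
  then show ?case by (simp add: L2_add coord_def l2inner_add_left atom_vec_L2)
qed

lemma norm_tail_bound:
  assumes f: "f \<in> L2 M" and zero: "\<And>q. q \<in> F \<Longrightarrow> coord M f q = 0"
    and bound: "\<And>q. q \<in> orbit - F \<Longrightarrow> (cmod (coord M f q))\<^sup>2 \<le> u q" and u: "u summable_on orbit - F"
  shows "(l2norm M f)\<^sup>2 \<le> infsum u (orbit - F)"
  by (rule has_sum_mono_neutral[OF orbit_norm[OF f] has_sum_infsum[OF u]]) (use zero bound in auto)

text \<open>Factoring \<open>n\<close> at the degree of \<open>l\<close> gives a prefix that is
  \<open>l\<close> itself, by uniqueness over \<open>q\<close>. The range of a composite lies in the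
  range of its prefix as far as atoms can see.\<close>

lemma prefix_mem:
  assumes q: "q \<in> atoms M" and r: "r \<in> atoms M" and l: "l \<in> arr G" and n: "n \<in> arr G"
    and Rl: "R l \<in> q" and Rn: "R n \<in> q" and le: "\<And>i. deg G l i \<le> deg G n i" and Rr: "R n \<in> r"
  shows "R l \<in> r"
proof -
  have "deg G n i = deg G l i + (deg G n i - deg G l i)" for i using le[of i] by simp
  then obtain a b where ab: "a \<in> arr G" "b \<in> arr G" "src G a = rng G b" "deg G a = deg G l" "cmp G a b = n"
    by (rule factorization[OF n]) (rule that)
  have "R a \<in> q" "R a \<in> r"
    using R_cmp_iff[OF q ab(1,2)] R_cmp_iff[OF r ab(1,2)] ab Rn Rr by auto
  moreover have "a = l" by (rule R_unique[OF q ab(1) l ab(4) \<open>R a \<in> q\<close> Rl])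
  ultimately show ?thesis by simp
qed

text \<open>By \<open>rigid\<close>, each single atom of \<open>F\<close> is told apart from
  \<open>q\<close> by some path. Longer initial segments of the path of \<open>q\<close> keep
  earlier separations, so finitely many can be combined.\<close>

lemma separating_path:
  assumes q: "q \<in> orbit" and F: "finite F" "F \<subseteq> orbit" "q \<notin> F"
  obtains l where "l \<in> arr G" "R l \<in> q" "\<And>r. r \<in> F \<Longrightarrow> R l \<notin> r"
proof -
  have qa: "q \<in> atoms M" using q orbit_atoms by blast
  have "\<exists>l\<in>arr G. R l \<in> q \<and> (\<forall>r\<in>F. R l \<notin> r)"
    using F
  proof (induction F)
    case empty
    then show ?case using R_cover[OF qa zero_Nk] by blast
  next
    case (insert r F)
    then obtain l where l: "l \<in> arr G" "R l \<in> q" "\<forall>s\<in>F. R l \<notin> s" by auto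
    have r: "r \<in> orbit" "r \<noteq> q" using insert.prems by auto
    then have ra: "r \<in> atoms M" using orbit_atoms by blast
    obtain n where n: "n \<in> arr G" "(R n \<in> q) \<noteq> (R n \<in> r)"
      using rigid[OF q r(1)] r(2) unfolding same_path_def by blast
    \<comment> \<open>Different paths may be witnessed by an \<open>n\<close> over \<open>r\<close>
      only; then the path of the same degree over \<open>q\<close> serves, since \<open>r\<close>
      has just one path of each degree.\<close>
    obtain n' where n': "n' \<in> arr G" "R n' \<in> q" "R n' \<notin> r"
    proof (cases "R n \<in> q")
      case True
      then show thesis using that n by blast
    next
      case False
      then have Rnr: "R n \<in> r" using n by blast
      obtain m where m: "m \<in> arr G" "deg G m = deg G n" "R m \<in> q" by (rule R_cover[OF qa deg_Nk[OF n(1)]])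
      have "R m \<notin> r"
      proof
        assume "R m \<in> r"
        then have "m = n" by (rule R_unique[OF ra m(1) n(1) m(2) _ Rnr])
        then show False using m False by simp
      qed
      then show thesis using that m by blast
    qed
    \<comment> \<open>A common upper bound of the two degrees: the path of \<open>q\<close> of this
      degree extends both \<open>l\<close> and \<open>n'\<close>.\<close>
    have "(\<lambda>i. max (deg G l i) (deg G n' i)) \<in> Nk k"
      using deg_Nk[OF l(1)] deg_Nk[OF n'(1)] by (simp add: Nk_def)
    then obtain m where m: "m \<in> arr G" "deg G m = (\<lambda>i. max (deg G l i) (deg G n' i))" "R m \<in> q"
      by (rule R_cover[OF qa])
    have "R m \<notin> r"
      using prefix_mem[OF qa ra n'(1) m(1) n'(2) m(3)] n'(3) m(2) by auto
    moreover have "R m \<notin> s" if "s \<in> F" for s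
    proof -
      have sa: "s \<in> atoms M" using that insert.prems orbit_atoms by auto
      show ?thesis using prefix_mem[OF qa sa l(1) m(1) l(2) m(3)] l(3) that m(2) by auto
    qed
    ultimately show ?case using m by blast
  qed
  then show thesis using that by blast
qed

lemma monic: "monic_rep M (arr G) t"
proof -
  \<comment> \<open>Any strictly positive square-summable weights would do; powers of 1/2 along an
    enumeration of the orbit are convenient.\<close>
  define a :: "'x set set \<Rightarrow> real" where "a q = (1 / 2) ^ to_nat_on orbit q" for q
  have a_pos: "a q > 0" for q by (simp add: a_def)
  have a_sum: "(\<lambda>q. (a q)\<^sup>2) summable_on orbit"
  proof -
    have bij: "bij_betw (to_nat_on orbit) orbit (to_nat_on orbit ` orbit)"
      using inj_on_to_nat_on[OF orbit_countable] by (simp add: bij_betw_def)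
    have "(\<lambda>n. ((1 / 2 :: real) ^ n)\<^sup>2) summable_on UNIV"
    proof (rule summable_nonneg_imp_summable_on)
      have "summable (\<lambda>n. (1 / 4 :: real) ^ n)" by (rule summable_geometric) simp
      moreover have "((1 / 2 :: real) ^ n)\<^sup>2 = (1 / 4) ^ n" for n
        by (simp only: power2_eq_square power_mult_distrib[symmetric]) simp
      ultimately show "summable (\<lambda>n. ((1 / 2 :: real) ^ n)\<^sup>2)" by (simp only:)
    qed simp
    then have "(\<lambda>n. ((1 / 2 :: real) ^ n)\<^sup>2) summable_on to_nat_on orbit ` orbit"
      by (rule summable_on_subset) simp
    then show ?thesis
      unfolding a_def using summable_on_reindex_bij_betw[OF bij, of "\<lambda>n. ((1 / 2 :: real) ^ n)\<^sup>2"] by simp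
  qed
  have "(\<lambda>q. (cmod (complex_of_real (a q)))\<^sup>2) summable_on orbit" using a_sum by simp
  then obtain \<xi> where \<xi>: "\<xi> \<in> L2 M" "\<And>q. q \<in> orbit \<Longrightarrow> coord M \<xi> q = complex_of_real (a q)"
    by (rule vector_with_coords[OF orbit_countable orbit_atoms]) (rule that)
  let ?h = "\<lambda>l. t l (adj M (t l) \<xi>)"
  let ?S = "?h ` arr G"
  have hL2: "?h l \<in> L2 M" if "l \<in> arr G" for l
    using that \<xi>(1) by (intro t_L2 adj_t_L2)
  have S: "?S \<subseteq> L2 M" using hL2 by blast
  \<comment> \<open>On the orbit the range projection is diagonal: it keeps exactly the coordinates
    at atoms lying in \<open>R l\<close>.\<close>
  have h_coord: "coord M (?h l) q = (if R l \<in> q then complex_of_real (a q) else 0)"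
    if l: "l \<in> arr G" and q: "q \<in> orbit" for l q
  proof -
    have qa: "q \<in> atoms M" using q orbit_atoms by blast
    note pl = pre[OF l]
    have w: "[(True, l), (False, l)] \<in> words" using l by simp
    have "coord M (?h l) q = coord M \<xi> (pushl l (pulll l q))"
      using coord_word[OF w \<xi>(1), of q] qa by (simp add: word_op_def letter_op_def letter_act_def)
    then show ?thesis
      using prefixing.push_pull[OF pl qa] prefixing.pull_nonempty_iff[OF pl qa]
        prefixing.push_empty[OF pl] \<xi>(2)[OF q] coord_zero[OF atom_nonempty, of M \<xi>] by auto
  qed
  have e_approx: "approximable M ?S (atom_vec M q)" if q: "q \<in> orbit" for q
    unfolding approximable_def
  proof (intro conjI allI impI)
    show "atom_vec M q \<in> L2 M" by (rule atom_vec_L2)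
    fix e :: real assume e: "e > 0"
    \<comment> \<open>The largest possible squared error at \<open>r\<close> when a range projection
      of \<open>\<xi>\<close> is rescaled to have coordinate 1 at \<open>q\<close>. The finite set
      \<open>F\<close> leaves a tail below the square of \<open>e\<close>.\<close>
    let ?u = "\<lambda>r. (1 / (a q)\<^sup>2) * (a r)\<^sup>2"
    have u: "?u summable_on orbit" using a_sum by (rule summable_on_cmult_right)
    obtain F where F: "finite F" "F \<subseteq> orbit" "infsum ?u (orbit - F) < e\<^sup>2"
      by (rule summable_tail[OF u, of "e\<^sup>2"]) (use e in auto)
    \<comment> \<open>\<open>q\<close> itself may lie in \<open>F\<close> and must survive the
      projection, hence the removal. The error then vanishes on all of \<open>F\<close>.\<close>
    obtain l where l: "l \<in> arr G" "R l \<in> q" "\<And>r. r \<in> F - {q} \<Longrightarrow> R l \<notin> r"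
      by (rule separating_path[OF q, of "F - {q}"]) (use F in auto)
    let ?k = "\<lambda>x. complex_of_real (1 / a q) * ?h l x"
    let ?d = "\<lambda>x. atom_vec M q x - ?k x"
    have kL2: "?k \<in> L2 M" by (rule L2_scale[OF hL2[OF l(1)]])
    have dL2: "?d \<in> L2 M" by (rule L2_diff[OF atom_vec_L2 kL2])
    have d_coord: "coord M ?d r = (if r = q then 0 else if R l \<in> r then - complex_of_real (a r / a q) else 0)"
      if r: "r \<in> orbit" for r
    proof -
      have "r \<in> atoms M" using r orbit_atoms by blast
      then show ?thesis
        using coord_diff[OF atom_vec_L2 kL2, of q r] coord_scale[of "complex_of_real (1 / a q)" "?h l" r]
          coord_atom_vec[of r M q] h_coord[OF l(1) r] l(2) a_pos[of q] by auto
    qed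
    have "(l2norm M ?d)\<^sup>2 \<le> infsum ?u (orbit - F)"
    proof (rule norm_tail_bound[OF dL2])
      show "coord M ?d r = 0" if "r \<in> F" for r
        using that F(2) d_coord l(3) by auto
      show "(cmod (coord M ?d r))\<^sup>2 \<le> ?u r" if "r \<in> orbit - F" for r
        using that d_coord[of r] by (auto simp: norm_divide power_divide)
      show "?u summable_on orbit - F" by (rule summable_on_subset[OF u]) auto
    qed
    also have "\<dots> < e\<^sup>2" by (rule F(3))
    finally have "l2norm M ?d < e" using e by (intro power2_less_imp_less[of _ e]) auto
    moreover have "?k \<in> cspan ?S" using l(1) by (intro cspan_scale cspan_base) auto
    ultimately show "\<exists>h\<in>cspan ?S. l2norm M (\<lambda>x. atom_vec M q x - h x) < e" by (rule bexI)
  qed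
  have "\<exists>h\<in>cspan ?S. l2norm M (\<lambda>x. g x - h x) < e" if g: "g \<in> L2 M" and e: "e > 0" for g e
  proof -
    let ?u = "\<lambda>q. (cmod (coord M g q))\<^sup>2"
    have u: "?u summable_on orbit" by (rule has_sum_imp_summable[OF orbit_norm[OF g]])
    have e2: "(e / 2)\<^sup>2 > 0" using e by simp
    obtain F where F: "finite F" "F \<subseteq> orbit" "infsum ?u (orbit - F) < (e / 2)\<^sup>2"
      by (rule summable_tail[OF u e2])
    let ?f = "\<lambda>x. \<Sum>q\<in>F. coord M g q * atom_vec M q x"
    have ap: "approximable M ?S ?f"
      by (intro approximable_sum[OF S F(1)] approximable_scale e_approx) (use F(2) in auto)
    have fL2: "?f \<in> L2 M" using ap by (simp add: approximable_def)
    have f_coord: "coord M ?f r = (if r \<in> F then coord M g r else 0)" if r: "r \<in> orbit" for r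
    proof -
      have ra: "r \<in> atoms M" using r orbit_atoms by blast
      have "coord M ?f r = (\<Sum>q\<in>F. coord M (\<lambda>x. coord M g q * atom_vec M q x) r)"
        using L2_coord_sum[OF F(1), of "\<lambda>q x. coord M g q * atom_vec M q x"] L2_scale[OF atom_vec_L2] by blast
      also have "\<dots> = (\<Sum>q\<in>F. if r = q then coord M g q else 0)"
        by (intro sum.cong refl) (simp add: coord_scale coord_atom_vec[OF ra])
      also have "\<dots> = (if r \<in> F then coord M g r else 0)" using F(1) by simp
      finally show ?thesis .
    qed
    have "(l2norm M (\<lambda>x. g x - ?f x))\<^sup>2 \<le> infsum ?u (orbit - F)"
    proof (rule norm_tail_bound[OF L2_diff[OF g fL2]])
      show "coord M (\<lambda>x. g x - ?f x) q = 0" if "q \<in> F" for q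
        using that F(2) f_coord[of q] by (subst coord_diff[OF g fL2]) auto
      show "(cmod (coord M (\<lambda>x. g x - ?f x) q))\<^sup>2 \<le> ?u q" if "q \<in> orbit - F" for q
        using that f_coord[of q] by (subst coord_diff[OF g fL2]) auto
      show "?u summable_on orbit - F" by (rule summable_on_subset[OF u]) auto
    qed
    also have "\<dots> < (e / 2)\<^sup>2" by (rule F(3))
    finally have n1: "l2norm M (\<lambda>x. g x - ?f x) < e / 2"
      using e by (intro power2_less_imp_less[of _ "e / 2"]) auto
    obtain h where h: "h \<in> cspan ?S" "l2norm M (\<lambda>x. ?f x - h x) < e / 2"
      using ap e unfolding approximable_def by (meson half_gt_zero)
    have "l2norm M (\<lambda>x. (g x - ?f x) + (?f x - h x)) \<le> l2norm M (\<lambda>x. g x - ?f x) + l2norm M (\<lambda>x. ?f x - h x)"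
      by (intro l2norm_triangle L2_diff g fL2 cspan_L2[OF S h(1)])
    also have "\<dots> < e" using n1 h(2) by simp
    finally have "l2norm M (\<lambda>x. g x - h x) < e" by simp
    then show ?thesis using h(1) by blast
  qed
  moreover have "\<exists>\<xi>\<in>L2 M. \<not> (AE x in M. t l \<xi> x = 0)" if "l \<in> arr G" for l
    using prefixing.T_nonzero[OF pre[OF that] D_positive[OF that]] by (simp add: t_eq[OF that])
  ultimately show ?thesis unfolding monic_rep_def using \<xi>(1) by blast
qed

end

context lambda_system
begin

text \<open>An atom in the sense of \<open>has_atom\<close> may have infinite measure. Since
  countably many ranges of vertices cover the space, one of them meets it in positive measure, and
  this intersection is again an atom, now of finite measure.\<close>

lemma atoms_nonempty:
  assumes "has_atom M" obtains p where "p \<in> atoms M"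
proof -
  obtain A where A: "A \<in> sets M" "0 < emeasure M A"
    "\<And>B. B \<in> sets M \<Longrightarrow> B \<subseteq> A \<Longrightarrow> emeasure M B = 0 \<or> emeasure M (A - B) = 0"
    using assms unfolding has_atom_def by blast
  have notnull: "\<not> (AE x in M. x \<notin> A)"
    using A(1,2) by (auto simp: AE_iff_null_sets[symmetric] null_sets_def)
  have "\<exists>l\<in>arr G. \<not> (AE x in M. x \<notin> A \<inter> R l)"
  proof (rule ccontr)
    assume "\<not> (\<exists>l\<in>arr G. \<not> (AE x in M. x \<notin> A \<inter> R l))"
    then have "AE x in M. \<forall>l\<in>arr G. x \<notin> A \<inter> R l"
      by (subst AE_ball_countable[OF countable_arr]) simp
    with R_cover_AE[OF zero_Nk] have "AE x in M. x \<notin> A" by eventually_elim auto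
    then show False using notnull by simp
  qed
  then obtain l where l: "l \<in> arr G" "\<not> (AE x in M. x \<notin> A \<inter> R l)" by (rule bexE)
  have AR: "A \<inter> R l \<in> sets M" using A(1) R_sets[OF l(1)] by simp
  have "atomic_set M (A \<inter> R l)"
    unfolding atomic_set_def
  proof (intro conjI ballI)
    have "emeasure M (A \<inter> R l) \<le> emeasure M (R l)" using R_sets[OF l(1)] by (intro emeasure_mono) auto
    then show "emeasure M (A \<inter> R l) < \<infinity>"
      using prefixing.R_finite[OF pre[OF l(1)]] by (rule order_le_less_trans)
    fix B assume B: "B \<in> sets M"
    have C: "A \<inter> R l \<inter> B \<in> sets M" using AR B by simp
    then consider "A \<inter> R l \<inter> B \<in> null_sets M" | "A - (A \<inter> R l \<inter> B) \<in> null_sets M"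
      using A(3)[OF C] A(1) by (auto simp: null_sets_def)
    then show "(AE x in M. x \<in> A \<inter> R l \<longrightarrow> x \<in> B) \<or> (AE x in M. x \<in> A \<inter> R l \<longrightarrow> x \<notin> B)"
    proof cases
      case 1
      from AE_not_in[OF this] have "AE x in M. x \<in> A \<inter> R l \<longrightarrow> x \<notin> B" by eventually_elim auto
      then show ?thesis ..
    next
      case 2
      from AE_not_in[OF this] have "AE x in M. x \<in> A \<inter> R l \<longrightarrow> x \<in> B" by eventually_elim auto
      then show ?thesis ..
    qed
  qed (use AR l in auto)
  then show thesis using atomic_set_atoms that by blast
qed

end

theorem theorem5p4:
  fixes k :: nat and G :: "'a kgraph" and M :: "'x measure"
    and D :: "'a \<Rightarrow> 'x set" and tau :: "'a \<Rightarrow> 'x \<Rightarrow> 'x"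
    and Phi :: "'a \<Rightarrow> 'x \<Rightarrow> real" and cod :: "(nat \<Rightarrow> nat) \<Rightarrow> 'x \<Rightarrow> 'x"
  assumes "kgraph k G" and "row_finite k G" and "source_free k G"
    and "lambda_sbfs k G M D tau Phi cod"
    and "irreducible_rep M (arr G) (sbfs_op G D tau Phi cod)"
    and "has_atom M"
  shows "monic_rep M (arr G) (sbfs_op G D tau Phi cod)"
proof -
  interpret lambda_system k G M D tau Phi cod by unfold_locales (fact assms)+
  obtain p0 where "p0 \<in> atoms M" by (rule atoms_nonempty[OF assms(6)])
  then interpret irreducible_atomic k G M D tau Phi cod p0
    by unfold_locales (use assms in auto)
  show ?thesis by (rule monic)
qed

end
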